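(* Let $n\ge1$, $\mathbf s\in\mathbb C^n$ and let $\mathbf s'=\sigma(\mathbf s)$ be obtained from $\mathbf s$ by a permutation $\sigma$ of coordinates. (1) If $\mathbf s$ is typical ($s_i+s_j\ne0$ for all $i\ne j$), then $V(\mathbf s)$ is isomorphic as a $W^n$-module to $V(\mathbf s')$ or to $\Pi V(\mathbf s')$. (2) For arbitrary $\mathbf s$, in the Grothendieck group of finite-dimensional $W^n$-modules one has $[V(\mathbf s)]=[V(\mathbf s')]$ or $[V(\mathbf s)]=[\Pi V(\mathbf s')]$.
   Context: $U(\mathfrak h_n)$ is the associative superalgebra generated by odd elements $\xi_1,\dots,\xi_n$ with $\xi_i\xi_j+\xi_j\xi_i=0$ for $i\neq j$, and $x_i=\xi_i^2$ (central); it is the enveloping algebra of the Cartan subalgebra of the queer Lie superalgebra $Q(n)$. $W^n\subset U(\mathfrak h_n)$ is the finite $W$-algebra of $Q(n)$ for the principal even nilpotent element, realized in $U(\mathfrak h_n)$ via the injective Harish-Chandra homomorphism; concretely it is the subalgebra generated by $u_k(0),u_k(1)$ ($1\le k\le n$), the even and odd parts of $\sum_{1\le i_1<\dots<i_k\le n}\prod_{j=1}^{k}(x_{i_j}+(-1)^{k-j}\xi_{i_j})$ (ordered product). For $\mathbf s\in\mathbb C^n$, $V(\mathbf s)$ is a simple $\mathbb Z_2$-graded $U(\mathfrak h_n)$-module on which each $x_i$ acts by $s_i$ (unique up to isomorphism and parity change $\Pi$), regarded as a $W^n$-module by restriction. *)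

theory Defs
  imports "Jordan_Normal_Form.Matrix" "HOL-Combinatorics.Permutations"
begin

text \<open>A finite-dimensional Z2-graded module is modelled on complex column vectors of
  dimension d; the grading is given by the parity operator P (P*P = 1, +1 on the even
  part, -1 on the odd part).\<close>

text \<open>Z2-graded U(h_n)-module of dimension d on which x_i acts by s_i:
  the odd generators xi_i (indices i < n, 0-based) act by matrices X i that
  anticommute with P, pairwise anticommute, and satisfy X i * X i = s i (since x_i = xi_i^2).\<close>
definition hmod :: "nat \<Rightarrow> (nat \<Rightarrow> complex) \<Rightarrow> nat \<Rightarrow> complex mat \<Rightarrow> (nat \<Rightarrow> complex mat) \<Rightarrow> bool" where
  "hmod n s d P X \<longleftrightarrow> P \<in> carrier_mat d d \<and> P * P = 1\<^sub>m d \<and>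
     (\<forall>i<n. X i \<in> carrier_mat d d \<and> X i * P = - (P * X i) \<and> X i * X i = s i \<cdot>\<^sub>m 1\<^sub>m d) \<and>
     (\<forall>i<n. \<forall>j<n. i \<noteq> j \<longrightarrow> X i * X j + X j * X i = 0\<^sub>m d d)"

definition inv_gsubspace :: "nat \<Rightarrow> complex mat \<Rightarrow> complex mat set \<Rightarrow> complex vec set \<Rightarrow> bool" where
  "inv_gsubspace d P Ops S \<longleftrightarrow> S \<subseteq> carrier_vec d \<and> 0\<^sub>v d \<in> S \<and>
     (\<forall>v\<in>S. \<forall>w\<in>S. v + w \<in> S) \<and> (\<forall>c. \<forall>v\<in>S. c \<cdot>\<^sub>v v \<in> S) \<and>
     (\<forall>v\<in>S. P *\<^sub>v v \<in> S) \<and> (\<forall>B\<in>Ops. \<forall>v\<in>S. B *\<^sub>v v \<in> S)"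

definition simple_hmod :: "nat \<Rightarrow> (nat \<Rightarrow> complex) \<Rightarrow> nat \<Rightarrow> complex mat \<Rightarrow> (nat \<Rightarrow> complex mat) \<Rightarrow> bool" where
  "simple_hmod n s d P X \<longleftrightarrow> hmod n s d P X \<and> d > 0 \<and>
     (\<forall>S. inv_gsubspace d P (X ` {..<n}) S \<longrightarrow> S = {0\<^sub>v d} \<or> S = carrier_vec d)"

text \<open>Expansion of an ordered product (a_1 + B_1)(a_2 + B_2)...(a_k + B_k), a_j scalars
  (images of the even x's), B_j odd operators; pexp d l e keeps exactly the terms with an
  even (e = False) resp. odd (e = True) number of odd factors.\<close>
fun pexp :: "nat \<Rightarrow> (complex \<times> complex mat) list \<Rightarrow> bool \<Rightarrow> complex mat" where
  "pexp d [] e = (if e then 0\<^sub>m d d else 1\<^sub>m d)"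
| "pexp d ((a, B) # r) e = a \<cdot>\<^sub>m pexp d r e + B * pexp d r (\<not> e)"

text \<open>Action of u_k(0) (e = False) and u_k(1) (e = True) on a U(h_n)-module (d, X) on which
  x_i acts by s_i:
  u_k = sum over i_1 < ... < i_k of prod_{j=1..k} (x_{i_j} + (-1)^(k-j) xi_{i_j}).\<close>
definition wact :: "nat \<Rightarrow> nat \<Rightarrow> (nat \<Rightarrow> complex) \<Rightarrow> (nat \<Rightarrow> complex mat) \<Rightarrow> nat \<Rightarrow> bool \<Rightarrow> complex mat" where
  "wact n d s X k e = mat d d (\<lambda>(r, c).
     \<Sum>I\<in>{I. I \<subseteq> {..<n} \<and> card I = k}.
       pexp d (map (\<lambda>(j, i). (s i, ((-1) ^ (k - j)) \<cdot>\<^sub>m X i))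
                   (zip [1..<k+1] (sorted_list_of_set I))) e $$ (r, c))"

text \<open>A (graded) W^n-module datum: dimension d, parity P, and the action A k e of the
  generators u_k(0), u_k(1) (1 <= k <= n).\<close>
definition wops :: "nat \<Rightarrow> (nat \<Rightarrow> bool \<Rightarrow> complex mat) \<Rightarrow> complex mat set" where
  "wops n A = {A k e | k e. k \<in> {1..n}}"

definition wiso :: "nat \<Rightarrow> nat \<Rightarrow> complex mat \<Rightarrow> (nat \<Rightarrow> bool \<Rightarrow> complex mat)
                    \<Rightarrow> nat \<Rightarrow> complex mat \<Rightarrow> (nat \<Rightarrow> bool \<Rightarrow> complex mat) \<Rightarrow> bool" where
  "wiso n d P A d' P' A' \<longleftrightarrow> d = d' \<and>
     (\<exists>F \<in> carrier_mat d' d. invertible_mat F \<and> F * P = P' * F \<and>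
        (\<forall>k\<in>{1..n}. \<forall>e. F * A k e = A' k e * F))"

definition comp_series :: "nat \<Rightarrow> nat \<Rightarrow> complex mat \<Rightarrow> (nat \<Rightarrow> bool \<Rightarrow> complex mat)
                           \<Rightarrow> complex vec set list \<Rightarrow> bool" where
  "comp_series n d P A Ms \<longleftrightarrow> Ms \<noteq> [] \<and> hd Ms = {0\<^sub>v d} \<and> last Ms = carrier_vec d \<and>
     (\<forall>M \<in> set Ms. inv_gsubspace d P (wops n A) M) \<and>
     (\<forall>i. Suc i < length Ms \<longrightarrow> Ms ! i \<subset> Ms ! Suc i \<and>
        \<not> (\<exists>N. inv_gsubspace d P (wops n A) N \<and> Ms ! i \<subset> N \<and> N \<subset> Ms ! Suc i))"

definition factor_iso :: "nat \<Rightarrow> nat \<Rightarrow> complex mat \<Rightarrow> (nat \<Rightarrow> bool \<Rightarrow> complex mat)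
     \<Rightarrow> complex vec set \<Rightarrow> complex vec set
     \<Rightarrow> nat \<Rightarrow> complex mat \<Rightarrow> (nat \<Rightarrow> bool \<Rightarrow> complex mat)
     \<Rightarrow> complex vec set \<Rightarrow> complex vec set \<Rightarrow> bool" where
  "factor_iso n d P A M0 M1 d' P' A' N0 N1 \<longleftrightarrow>
     (\<exists>F \<in> carrier_mat d' d.
        (\<forall>v\<in>M1. F *\<^sub>v v \<in> N1) \<and>
        (\<forall>v\<in>M1. F *\<^sub>v (P *\<^sub>v v) - P' *\<^sub>v (F *\<^sub>v v) \<in> N0) \<and>
        (\<forall>v\<in>M1. \<forall>k\<in>{1..n}. \<forall>e. F *\<^sub>v (A k e *\<^sub>v v) - A' k e *\<^sub>v (F *\<^sub>v v) \<in> N0) \<and>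
        {v\<in>M1. F *\<^sub>v v \<in> N0} = M0 \<and>
        (\<forall>w\<in>N1. \<exists>v\<in>M1. w - F *\<^sub>v v \<in> N0))"

text \<open>Equality of classes in the Grothendieck group of finite-dimensional graded
  W^n-modules: same composition factors with multiplicities (Jordan-Hoelder).\<close>
definition same_K0 :: "nat \<Rightarrow> nat \<Rightarrow> complex mat \<Rightarrow> (nat \<Rightarrow> bool \<Rightarrow> complex mat)
                       \<Rightarrow> nat \<Rightarrow> complex mat \<Rightarrow> (nat \<Rightarrow> bool \<Rightarrow> complex mat) \<Rightarrow> bool" where
  "same_K0 n d P A d' P' A' \<longleftrightarrow>
     (\<exists>Ms Ns \<pi>. comp_series n d P A Ms \<and> comp_series n d' P' A' Ns \<and>
        length Ms = length Ns \<and> \<pi> permutes {..<length Ms - 1} \<and>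
        (\<forall>i < length Ms - 1. factor_iso n d P A (Ms ! i) (Ms ! Suc i)
                                           d' P' A' (Ns ! \<pi> i) (Ns ! Suc (\<pi> i))))"

end

theory Submission
  imports Defs
begin

text \<open>
  Splitting off the last factor of the ordered products gives a recursion for the elements
  \<open>u_k(e)\<close>, from which one reads off that a neighbouring pair \<open>\<xi>_m, \<xi>_{m+1}\<close> enters all of them only
  through the generators \<open>\<xi>_m + \<xi>_{m+1}\<close>, \<open>\<xi>_m \<xi>_{m+1}\<close> and
  \<open>x_m \<xi>_{m+1} - x_{m+1} \<xi>_m\<close> of rank two. Hence it suffices to treat adjacent transpositions.

  If \<open>a + b \<noteq> 0\<close> for the two entries \<open>a, b\<close> to be exchanged, an explicit reflection of the plane
  spanned by \<open>\<xi>_m, \<xi>_{m+1}\<close> exchanges \<open>a\<close> and \<open>b\<close> and fixes these generators, so that the same space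
  with the same action of the W-algebra carries a simple module for the permuted parameters.
  If \<open>b = -a \<noteq> 0\<close>, then \<open>\<theta> = \<xi>_m + \<xi>_{m+1}\<close> satisfies \<open>\<theta>^2 = 0\<close> and \<open>ker \<theta> = im \<theta>\<close>; exchanging
  \<open>\<xi>_m\<close> with \<open>\<xi>_{m+1}\<close>, negating the other \<open>\<xi>_i\<close> and the parity gives a module for the permuted
  parameters such that \<open>\<theta>\<close> identifies \<open>V / ker \<theta>\<close> for either structure with \<open>ker \<theta>\<close> for the
  other one. The classes in the Grothendieck group therefore agree, and the Jordan-Hoelder theorem
  makes this relation transitive.

  Finally, two simple modules with the same parameters are isomorphic up to parity change by
  Schur's lemma: a nonzero intertwiner is a common eigenvector of commuting involutions of
  \<open>Hom(V, V')\<close>, whose eigenvalues are corrected by multiplication with \<open>\<xi>_j P\<close>.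
\<close>

section \<open>Linear algebra\<close>

text \<open>Quotients never appear as spaces: an isomorphism of composition factors is a matrix
  between the ambient spaces that is correct only modulo submodules. Such a matrix need not be
  invertible, so already the symmetry of the relation requires a linear choice of preimages.

  The reflection is forced. Give the plane of xi_m, xi_{m+1} the quadratic form with values a, b on
  these vectors, and put theta = xi_m + xi_{m+1}, so that theta^2 = a + b. Exchanging the entries
  while keeping theta amounts to swapping the two names and applying an isometry that fixes theta;
  the reflection v |-> 2 B(v, theta) / (a + b) theta - v does this. For a + b = 0 the vector theta
  is isotropic and the formula breaks down, but then theta itself becomes an odd intertwiner that is
  exact (kernel = image) as long as a is nonzero. Its oddness is the origin of the sign changes of
  the parity and of the other xi_i. In the remaining case a = b = 0 the exchange does not alter the
  parameters.

  For typical s each neighbouring pair met on the way consists of entries of s at two distinct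
  positions, so reflections suffice and an honest isomorphism results.\<close>

definition linsub :: "nat \<Rightarrow> complex vec set \<Rightarrow> bool" where
  "linsub d S \<longleftrightarrow> S \<subseteq> carrier_vec d \<and> 0\<^sub>v d \<in> S \<and>
     (\<forall>v\<in>S. \<forall>w\<in>S. v + w \<in> S) \<and> (\<forall>c. \<forall>v\<in>S. c \<cdot>\<^sub>v v \<in> S)"

lemma linsubD:
  assumes "linsub d S"
  shows "v \<in> S \<Longrightarrow> v \<in> carrier_vec d" "0\<^sub>v d \<in> S" "v \<in> S \<Longrightarrow> w \<in> S \<Longrightarrow> v + w \<in> S"
    "v \<in> S \<Longrightarrow> c \<cdot>\<^sub>v v \<in> S"
  using assms by (auto simp: linsub_def)

lemma linsub_diff:
  assumes "linsub d S" "v \<in> S" "w \<in> S"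
  shows "v - w \<in> S"
proof -
  have "v - w = v + (-1) \<cdot>\<^sub>v w"
    using linsubD(1)[OF assms(1)] assms(2,3) by (intro eq_vecI) auto
  then show ?thesis
    using assms by (auto intro: linsubD)
qed

lemma linsub_diff_sym:
  assumes "linsub d S" "v - w \<in> S" "v \<in> carrier_vec d" "w \<in> carrier_vec d"
  shows "w - v \<in> S"
proof -
  have "w - v = 0\<^sub>v d - (v - w)"
    using assms(3,4) by (intro eq_vecI) auto
  then show ?thesis
    using linsub_diff[OF assms(1) linsubD(2)[OF assms(1)] assms(2)] by simp
qed

lemma linsub_diff_trans:
  assumes "linsub d S" "u - v \<in> S" "v - w \<in> S"
    "u \<in> carrier_vec d" "v \<in> carrier_vec d" "w \<in> carrier_vec d"
  shows "u - w \<in> S"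
proof -
  have "u - w = (u - v) + (v - w)"
    using assms(4-6) by (intro eq_vecI) auto
  then show ?thesis
    using assms(1-3) by (auto intro: linsubD)
qed

lemma linsub_diff_mem:
  assumes "linsub d S" "v - w \<in> S" "v \<in> carrier_vec d" "w \<in> carrier_vec d"
  shows "v \<in> S \<longleftrightarrow> w \<in> S"
proof
  assume "v \<in> S"
  moreover have "w = v - (v - w)"
    using assms(3,4) by (intro eq_vecI) auto
  ultimately show "w \<in> S"
    using linsub_diff[OF assms(1) _ assms(2)] by metis
next
  assume "w \<in> S"
  moreover have "v = (v - w) + w"
    using assms(3,4) by (intro eq_vecI) auto
  ultimately show "v \<in> S"
    using linsubD(3)[OF assms(1,2)] by metis
qed

lemma mult_mat_vec_zero:
  fixes F :: "complex mat"
  assumes "F \<in> carrier_mat e d"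
  shows "F *\<^sub>v 0\<^sub>v d = 0\<^sub>v e"
  using assms by (intro eq_vecI) auto

lemma linsub_vimage:
  assumes F: "F \<in> carrier_mat e d" and "linsub d S" "linsub e T"
  shows "linsub d {v \<in> S. F *\<^sub>v v \<in> T}"
  unfolding linsub_def using assms
  by (auto simp: linsub_def mult_add_distrib_mat_vec[OF F] mult_mat_vec[OF F] mult_mat_vec_zero[OF F]
        subset_iff)

section \<open>Linear choice of preimages\<close>

definition colmat :: "nat \<Rightarrow> nat \<Rightarrow> nat set \<Rightarrow> (nat \<Rightarrow> complex vec) \<Rightarrow> complex mat" where
  "colmat d e J g = mat d e (\<lambda>(r, c). if c \<in> J then g c $ r else 0)"

lemma colmat_carrier [simp]: "colmat d e J g \<in> carrier_mat d e"
  by (simp add: colmat_def)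

lemma colmat_mult_index:
  assumes "w \<in> carrier_vec e" "J \<subseteq> {..<e}" "r < d"
  shows "(colmat d e J g *\<^sub>v w) $ r = (\<Sum>c\<in>J. g c $ r * w $ c)"
proof -
  have "(colmat d e J g *\<^sub>v w) $ r = (\<Sum>c = 0..<e. (if c \<in> J then g c $ r else 0) * w $ c)"
    using assms by (auto simp: colmat_def scalar_prod_def intro!: sum.cong)
  also have "\<dots> = (\<Sum>c\<in>J. g c $ r * w $ c)"
    using assms(2) by (intro sum.mono_neutral_cong_right) auto
  finally show ?thesis .
qed

lemma colmat_insert_mult:
  assumes "w \<in> carrier_vec e" "insert j J \<subseteq> {..<e}" "j \<notin> J" "g j \<in> carrier_vec d"
  shows "colmat d e (insert j J) g *\<^sub>v w = colmat d e J g *\<^sub>v w + w $ j \<cdot>\<^sub>v g j"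
proof (rule eq_vecI)
  have fin: "finite J" using assms(2) finite_subset[of J "{..<e}"] by auto
  fix r assume "r < dim_vec (colmat d e J g *\<^sub>v w + w $ j \<cdot>\<^sub>v g j)"
  then have r: "r < d" using assms(4) by simp
  have "(colmat d e (insert j J) g *\<^sub>v w) $ r = (\<Sum>c\<in>insert j J. g c $ r * w $ c)"
    using assms r by (intro colmat_mult_index) auto
  also have "\<dots> = (\<Sum>c\<in>J. g c $ r * w $ c) + w $ j * g j $ r"
    using fin assms(3) by simp
  also have "(\<Sum>c\<in>J. g c $ r * w $ c) = (colmat d e J g *\<^sub>v w) $ r"
    using assms r by (intro colmat_mult_index[symmetric]) auto
  finally show "(colmat d e (insert j J) g *\<^sub>v w) $ r = (colmat d e J g *\<^sub>v w + w $ j \<cdot>\<^sub>v g j) $ r"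
    using r assms(4) by simp
qed (use assms(4) in \<open>simp add: colmat_def\<close>)

text \<open>Choosing a partner \<open>v\<close> for each \<open>w\<close> separately gives no linear
  map. Choosing partners only for a basis of \<open>S\<close> and extending linearly does, because
  \<open>R\<close> is closed under sums and multiples. The relation is kept abstract since it is
  used both for preimages modulo a submodule and for exact preimages.\<close>

lemma linear_section:
  fixes R :: "complex vec \<Rightarrow> complex vec \<Rightarrow> bool"
  assumes S: "linsub e S"
    and ex: "\<And>w. w \<in> S \<Longrightarrow> \<exists>v. R w v"
    and car: "\<And>w v. R w v \<Longrightarrow> w \<in> S \<and> v \<in> carrier_vec d"
    and R0: "R (0\<^sub>v e) (0\<^sub>v d)"
    and Radd: "\<And>w v w' v'. R w v \<Longrightarrow> R w' v' \<Longrightarrow> R (w + w') (v + v')"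
    and Rsm: "\<And>c w v. R w v \<Longrightarrow> R (c \<cdot>\<^sub>v w) (c \<cdot>\<^sub>v v)"
  shows "\<exists>G \<in> carrier_mat d e. \<forall>w\<in>S. R w (G *\<^sub>v w)"
proof -
  \<comment> \<open>A minimal set of coordinates separating the points of S has a dual basis in S.\<close>
  define sep where "sep J \<longleftrightarrow> J \<subseteq> {..<e} \<and> (\<forall>w\<in>S. (\<forall>j\<in>J. w $ j = 0) \<longrightarrow> w = 0\<^sub>v e)" for J
  have "sep {..<e}"
    using linsubD(1)[OF S] by (auto simp: sep_def intro!: eq_vecI)
  then obtain J where J: "sep J" and Jmin: "\<And>J'. sep J' \<Longrightarrow> card J \<le> card J'"
    using ex_has_least_nat[of sep "{..<e}" card] by auto
  have Je: "J \<subseteq> {..<e}" and fJ: "finite J"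
    using J finite_subset unfolding sep_def by auto
  have "\<exists>b\<in>S. \<forall>i\<in>J. b $ i = (if i = j then 1 else 0)" if j: "j \<in> J" for j
  proof -
    \<comment> \<open>By minimality, \<open>J - {j}\<close> no longer separates, so some nonzero
      vector of \<open>S\<close> vanishes there. It cannot vanish at \<open>j\<close> as well, and
      rescaling gives the dual vector.\<close>
    have "card (J - {j}) < card J" using j fJ by (meson card_Diff1_less)
    then have "\<not> sep (J - {j})" using Jmin[of "J - {j}"] by auto
    then obtain w where w: "w \<in> S" "\<forall>i\<in>J - {j}. w $ i = 0" "w \<noteq> 0\<^sub>v e"
      using Je by (auto simp: sep_def)
    then have "w $ j \<noteq> 0" using J by (auto simp: sep_def)
    moreover have "w \<in> carrier_vec e" using w linsubD(1)[OF S] by auto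
    ultimately have "\<forall>i\<in>J. (inverse (w $ j) \<cdot>\<^sub>v w) $ i = (if i = j then 1 else 0)"
      using w(2) Je by auto
    then show ?thesis using linsubD(4)[OF S w(1)] by blast
  qed
  then obtain b where b: "\<And>j. j \<in> J \<Longrightarrow> b j \<in> S"
    "\<And>i j. j \<in> J \<Longrightarrow> i \<in> J \<Longrightarrow> b j $ i = (if i = j then 1 else 0)"
    by metis
  obtain g where g: "\<And>j. j \<in> J \<Longrightarrow> R (b j) (g j)"
    using bchoice[of J "\<lambda>j v. R (b j) v"] ex b(1) by blast
  have partial: "R (colmat e e K b *\<^sub>v w) (colmat d e K g *\<^sub>v w)"
    if w: "w \<in> carrier_vec e" and K: "finite K" "K \<subseteq> J" for w K
    using K
  proof (induction K rule: finite_induct)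
    case empty
    have "colmat e e {} b *\<^sub>v w = 0\<^sub>v e" "colmat d e {} g *\<^sub>v w = 0\<^sub>v d"
      using w by (auto intro!: eq_vecI simp: colmat_mult_index) (auto simp: colmat_def)
    then show ?case using R0 by simp
  next
    case (insert j K)
    have "b j \<in> carrier_vec e" "g j \<in> carrier_vec d"
      using insert.prems car[OF g] b(1) linsubD(1)[OF S] by auto
    then have "colmat e e (insert j K) b *\<^sub>v w = colmat e e K b *\<^sub>v w + w $ j \<cdot>\<^sub>v b j"
      "colmat d e (insert j K) g *\<^sub>v w = colmat d e K g *\<^sub>v w + w $ j \<cdot>\<^sub>v g j"
      using w insert.hyps insert.prems Je by (auto intro!: colmat_insert_mult)
    then show ?case using insert g by (auto intro!: Radd Rsm)
  qed
  have "R w (colmat d e J g *\<^sub>v w)" if w: "w \<in> S" for w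
  proof -
    have wc: "w \<in> carrier_vec e" using w linsubD(1)[OF S] by auto
    let ?w = "colmat e e J b *\<^sub>v w"
    have R: "R ?w (colmat d e J g *\<^sub>v w)" using partial[OF wc fJ] by simp
    \<comment> \<open>The expansion \<open>?w\<close> of \<open>w\<close> in the dual basis agrees
      with \<open>w\<close> on the coordinates in \<open>J\<close>, and these separate the points of
      \<open>S\<close>.\<close>
    have wS: "w - ?w \<in> S" using w car[OF R] linsub_diff[OF S] by auto
    have "(w - ?w) $ i = 0" if i: "i \<in> J" for i
    proof -
      have "?w $ i = (\<Sum>c\<in>J. b c $ i * w $ c)"
        using i Je wc by (intro colmat_mult_index) auto
      also have "\<dots> = (\<Sum>c\<in>J. if c = i then w $ c else 0)"
        using i b(2) by (intro sum.cong) auto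
      also have "\<dots> = w $ i" using i fJ by simp
      finally have "?w $ i = w $ i" .
      then show ?thesis using i Je wc by (auto simp: colmat_def)
    qed
    then have eq0: "w - ?w = 0\<^sub>v e" using J wS by (auto simp: sep_def)
    have "?w = w"
    proof (rule eq_vecI)
      fix i assume i: "i < dim_vec w"
      have "(w - ?w) $ i = 0" using eq0 i wc by simp
      then show "?w $ i = w $ i" using i wc by (simp add: colmat_def)
    qed (use wc in \<open>simp add: colmat_def\<close>)
    with R show ?thesis by simp
  qed
  then show ?thesis by (intro bexI[of _ "colmat d e J g"]) auto
qed

text \<open>The cardinality of this set is the dimension of S.\<close>

definition leads :: "nat \<Rightarrow> complex vec set \<Rightarrow> nat set" where
  "leads d S = {j. j < d \<and> (\<exists>v\<in>S. v $ j \<noteq> 0 \<and> (\<forall>i<j. v $ i = 0))}"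

text \<open>Gaussian elimination: a vector of \<open>T\<close> with leading position
  \<open>j\<close> loses it after subtracting a multiple of a vector of \<open>S\<close> with the
  same leading position. After at most \<open>d\<close> such steps nothing is left.\<close>

lemma leads_eq_imp_eq:
  assumes S: "linsub d S" and T: "linsub d T" and "S \<subseteq> T" and le: "leads d T \<subseteq> leads d S"
  shows "S = T"
proof -
  have main: "v \<in> S" if "v \<in> T" "\<forall>i<j. v $ i = 0" "j \<le> d" for v j
    using that
  proof (induction "d - j" arbitrary: v j)
    case 0
    then have "v = 0\<^sub>v d" using linsubD(1)[OF T] by (auto intro!: eq_vecI)
    then show ?case using linsubD(2)[OF S] by simp
  next
    case (Suc k)
    then have j: "j < d" by simp
    have vc: "v \<in> carrier_vec d" using Suc linsubD(1)[OF T] by auto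
    show ?case
    proof (cases "v $ j = 0")
      case True
      then show ?thesis
        using Suc.hyps(1)[of "Suc j" v] Suc.hyps(2) Suc.prems j by (auto simp: less_Suc_eq)
    next
      case False
      then have "j \<in> leads d S" using Suc.prems j le by (auto simp: leads_def)
      then obtain w where w: "w \<in> S" "w $ j \<noteq> 0" "\<forall>i<j. w $ i = 0" by (auto simp: leads_def)
      have wc: "w \<in> carrier_vec d" using w linsubD(1)[OF S] by auto
      let ?w = "(v $ j / w $ j) \<cdot>\<^sub>v w"
      have wS: "?w \<in> S" using w linsubD(4)[OF S] by auto
      have "v - ?w \<in> T" using wS Suc.prems assms(3) linsub_diff[OF T] by auto
      moreover have "\<forall>i<Suc j. (v - ?w) $ i = 0"
        using Suc.prems w vc wc j by (auto simp: less_Suc_eq)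
      ultimately have "v - ?w \<in> S"
        using Suc.hyps(1)[of "Suc j" "v - ?w"] Suc.hyps(2) j by auto
      then show ?thesis using linsub_diff_mem[OF S] wS vc wc by auto
    qed
  qed
  then show ?thesis using main[of _ 0] assms(3) by auto
qed

text \<open>Provides a strictly increasing numerical measure, on which the existence of finite
  chains of submodules rests.\<close>

lemma card_leads_less:
  assumes "linsub d S" "linsub d T" "S \<subset> T"
  shows "card (leads d S) < card (leads d T)"
proof (rule psubset_card_mono)
  show "finite (leads d T)" by (auto simp: leads_def)
  have "leads d S \<subseteq> leads d T" using assms(3) by (auto simp: leads_def)
  then show "leads d S \<subset> leads d T"
    using leads_eq_imp_eq[OF assms(1,2)] assms(3) by blast
qed

section \<open>Subquotients and Jordan-Hoelder\<close>

text \<open>The operators form a family over an arbitrary index type. This treats the parity and the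
  generators alike and lets an isomorphism match operators of two modules by their index.\<close>

definition invsub :: "nat \<Rightarrow> ('i \<Rightarrow> complex mat) \<Rightarrow> complex vec set \<Rightarrow> bool" where
  "invsub d B S \<longleftrightarrow> linsub d S \<and> (\<forall>i. \<forall>v\<in>S. B i *\<^sub>v v \<in> S)"

definition fam :: "nat \<Rightarrow> ('i \<Rightarrow> complex mat) \<Rightarrow> bool" where
  "fam d B \<longleftrightarrow> (\<forall>i. B i \<in> carrier_mat d d)"

text \<open>The matrix \<open>F\<close> induces an isomorphism from M1/M0 to N1/N0: the last two
  conditions say that the induced map has trivial kernel and is onto. Equivariance is required only
  modulo \<open>N0\<close>.\<close>

definition qiso_by :: "complex mat \<Rightarrow> nat \<Rightarrow> ('i \<Rightarrow> complex mat) \<Rightarrow> complex vec set \<Rightarrow> complex vec set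
     \<Rightarrow> nat \<Rightarrow> ('i \<Rightarrow> complex mat) \<Rightarrow> complex vec set \<Rightarrow> complex vec set \<Rightarrow> bool" where
  "qiso_by F d B M0 M1 e C N0 N1 \<longleftrightarrow> F \<in> carrier_mat e d \<and>
     (\<forall>v\<in>M1. F *\<^sub>v v \<in> N1) \<and>
     (\<forall>i. \<forall>v\<in>M1. F *\<^sub>v (B i *\<^sub>v v) - C i *\<^sub>v (F *\<^sub>v v) \<in> N0) \<and>
     {v\<in>M1. F *\<^sub>v v \<in> N0} = M0 \<and>
     (\<forall>w\<in>N1. \<exists>v\<in>M1. w - F *\<^sub>v v \<in> N0)"

definition qiso where
  "qiso d B M0 M1 e C N0 N1 \<longleftrightarrow> (\<exists>F. qiso_by F d B M0 M1 e C N0 N1)"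

definition subquot :: "nat \<Rightarrow> ('i \<Rightarrow> complex mat) \<Rightarrow> complex vec set \<Rightarrow> complex vec set \<Rightarrow> bool" where
  "subquot d B M0 M1 \<longleftrightarrow> fam d B \<and> invsub d B M0 \<and> invsub d B M1 \<and> M0 \<subseteq> M1"

lemma subquotD:
  assumes "subquot d B M0 M1"
  shows "fam d B" "invsub d B M0" "invsub d B M1" "M0 \<subseteq> M1" "linsub d M0" "linsub d M1"
  using assms by (auto simp: subquot_def invsub_def)

lemma invsubD:
  assumes "invsub d B S"
  shows "linsub d S" "v \<in> S \<Longrightarrow> B i *\<^sub>v v \<in> S" "v \<in> S \<Longrightarrow> v \<in> carrier_vec d"
  using assms by (auto simp: invsub_def linsub_def)

lemma famD: "fam d B \<Longrightarrow> B i \<in> carrier_mat d d"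
  by (simp add: fam_def)

lemma qiso_refl:
  assumes "subquot d B M0 M1"
  shows "qiso d B M0 M1 d B M0 M1"
proof -
  note D = subquotD[OF assms]
  have "qiso_by (1\<^sub>m d) d B M0 M1 d B M0 M1"
    unfolding qiso_by_def
  proof (intro conjI allI ballI)
    show "{v \<in> M1. 1\<^sub>m d *\<^sub>v v \<in> M0} = M0"
      using D(4) linsubD(1)[OF D(6)] by auto
    show "\<exists>v\<in>M1. w - 1\<^sub>m d *\<^sub>v v \<in> M0" if "w \<in> M1" for w
    proof -
      have "w \<in> carrier_vec d" using that linsubD(1)[OF D(6)] by auto
      then show ?thesis using that linsubD(2)[OF D(5)] by (intro bexI[of _ w]) auto
    qed
    show "1\<^sub>m d *\<^sub>v (B i *\<^sub>v v) - B i *\<^sub>v (1\<^sub>m d *\<^sub>v v) \<in> M0" if "v \<in> M1" for v i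
    proof -
      have "v \<in> carrier_vec d" "B i *\<^sub>v v \<in> carrier_vec d"
        using that D(3) by (auto dest: invsubD)
      then show ?thesis using linsubD(2)[OF D(5)] by simp
    qed
  qed (use linsubD(1)[OF D(6)] in auto)
  then show ?thesis by (auto simp: qiso_def)
qed

lemma qiso_trans:
  assumes M: "subquot d B M0 M1" and N: "subquot e C N0 N1" and L: "subquot f D L0 L1"
    and "qiso d B M0 M1 e C N0 N1" "qiso e C N0 N1 f D L0 L1"
  shows "qiso d B M0 M1 f D L0 L1"
proof -
  obtain F G where F: "qiso_by F d B M0 M1 e C N0 N1" and G: "qiso_by G e C N0 N1 f D L0 L1"
    using assms by (auto simp: qiso_def)
  note MD = subquotD[OF M] and ND = subquotD[OF N] and LD = subquotD[OF L]
  have Fc: "F \<in> carrier_mat e d" and Gc: "G \<in> carrier_mat f e"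
    using F G by (auto simp: qiso_by_def)
  have F1: "\<And>v. v \<in> M1 \<Longrightarrow> F *\<^sub>v v \<in> N1" and G1: "\<And>v. v \<in> N1 \<Longrightarrow> G *\<^sub>v v \<in> L1"
    and F3: "{v\<in>M1. F *\<^sub>v v \<in> N0} = M0" and G3: "{v\<in>N1. G *\<^sub>v v \<in> L0} = N0"
    and F2: "\<And>i v. v \<in> M1 \<Longrightarrow> F *\<^sub>v (B i *\<^sub>v v) - C i *\<^sub>v (F *\<^sub>v v) \<in> N0"
    and G2: "\<And>i v. v \<in> N1 \<Longrightarrow> G *\<^sub>v (C i *\<^sub>v v) - D i *\<^sub>v (G *\<^sub>v v) \<in> L0"
    and F4: "\<And>w. w\<in>N1 \<Longrightarrow> \<exists>v\<in>M1. w - F *\<^sub>v v \<in> N0"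
    and G4: "\<And>w. w\<in>L1 \<Longrightarrow> \<exists>v\<in>N1. w - G *\<^sub>v v \<in> L0"
    using F G by (auto simp: qiso_by_def)
  have Mc: "\<And>v. v \<in> M1 \<Longrightarrow> v \<in> carrier_vec d" and Nc: "\<And>v. v \<in> N1 \<Longrightarrow> v \<in> carrier_vec e"
    and Lc: "\<And>v. v \<in> L1 \<Longrightarrow> v \<in> carrier_vec f"
    using linsubD(1) MD ND LD by auto
  have GF: "(G * F) *\<^sub>v v = G *\<^sub>v (F *\<^sub>v v)" if "v \<in> M1" for v
    using Gc Fc Mc[OF that] by simp
  have G0: "G *\<^sub>v v \<in> L0" if "v \<in> N0" for v using that G3 by auto
  have Gd: "G *\<^sub>v v - G *\<^sub>v w \<in> L0" if "v - w \<in> N0" "v \<in> carrier_vec e" "w \<in> carrier_vec e" for v w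
    using G0[OF that(1)] mult_minus_distrib_mat_vec[OF Gc that(2,3)] by simp
  have "qiso_by (G * F) d B M0 M1 f D L0 L1"
    unfolding qiso_by_def
  proof (intro conjI allI ballI)
    show "G * F \<in> carrier_mat f d" using Gc Fc by simp
    show "(G * F) *\<^sub>v v \<in> L1" if "v \<in> M1" for v using that GF F1 G1 by simp
    show "{v \<in> M1. G * F *\<^sub>v v \<in> L0} = M0"
      using GF F1 F3 G3 by auto
    show "\<exists>v\<in>M1. w - G * F *\<^sub>v v \<in> L0" if w: "w \<in> L1" for w
    proof -
      obtain u where u: "u \<in> N1" "w - G *\<^sub>v u \<in> L0" using G4[OF w] by auto
      obtain v where v: "v \<in> M1" "u - F *\<^sub>v v \<in> N0" using F4[OF u(1)] by auto
      have "w - G *\<^sub>v (F *\<^sub>v v) \<in> L0"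
        using linsub_diff_trans[OF LD(5) u(2) Gd[OF v(2)]] u v w F1 G1 Nc Lc by auto
      then show ?thesis using v GF by auto
    qed
    show "G * F *\<^sub>v (B i *\<^sub>v v) - D i *\<^sub>v (G * F *\<^sub>v v) \<in> L0" if v: "v \<in> M1" for i v
    proof -
      have Bv: "B i *\<^sub>v v \<in> M1" using v MD(3) by (auto dest: invsubD)
      have CF: "C i *\<^sub>v (F *\<^sub>v v) \<in> N1" using F1[OF v] ND(3) by (auto dest: invsubD)
      have DG: "D i *\<^sub>v (G *\<^sub>v (F *\<^sub>v v)) \<in> L1" using G1[OF F1[OF v]] LD(3) by (auto dest: invsubD)
      have "G *\<^sub>v (F *\<^sub>v (B i *\<^sub>v v)) - G *\<^sub>v (C i *\<^sub>v (F *\<^sub>v v)) \<in> L0"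
        using Gd[OF F2[OF v]] F1 Bv CF Nc by auto
      then have "G *\<^sub>v (F *\<^sub>v (B i *\<^sub>v v)) - D i *\<^sub>v (G *\<^sub>v (F *\<^sub>v v)) \<in> L0"
        by (rule linsub_diff_trans[OF LD(5) _ G2[OF F1[OF v]]])
          (use Lc G1 F1 Bv CF DG in auto)
      then show ?thesis using GF v Bv by simp
    qed
  qed
  then show ?thesis by (auto simp: qiso_def)
qed

text \<open>\<open>F\<close> itself may be singular. Preimages modulo \<open>N0\<close> are chosen
  linearly by \<open>linear_section\<close>, and the resulting matrix \<open>G\<close> inverts
  \<open>F\<close> modulo the two submodules.\<close>

lemma qiso_sym:
  assumes M: "subquot d B M0 M1" and N: "subquot e C N0 N1"
    and "qiso d B M0 M1 e C N0 N1"
  shows "qiso e C N0 N1 d B M0 M1"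
proof -
  obtain F where F: "qiso_by F d B M0 M1 e C N0 N1"
    using assms by (auto simp: qiso_def)
  note MD = subquotD[OF M] and ND = subquotD[OF N]
  have Fc: "F \<in> carrier_mat e d"
    and F1: "\<And>v. v \<in> M1 \<Longrightarrow> F *\<^sub>v v \<in> N1"
    and F3: "{v\<in>M1. F *\<^sub>v v \<in> N0} = M0"
    and F2: "\<And>i v. v \<in> M1 \<Longrightarrow> F *\<^sub>v (B i *\<^sub>v v) - C i *\<^sub>v (F *\<^sub>v v) \<in> N0"
    and F4: "\<And>w. w\<in>N1 \<Longrightarrow> \<exists>v\<in>M1. w - F *\<^sub>v v \<in> N0"
    using F by (auto simp: qiso_by_def)
  have Mc: "\<And>v. v \<in> M1 \<Longrightarrow> v \<in> carrier_vec d" and Nc: "\<And>v. v \<in> N1 \<Longrightarrow> v \<in> carrier_vec e"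
    using linsubD(1) MD ND by auto
  have "\<exists>G \<in> carrier_mat d e. \<forall>w\<in>N1. w \<in> N1 \<and> G *\<^sub>v w \<in> M1 \<and> w - F *\<^sub>v (G *\<^sub>v w) \<in> N0"
  proof (rule linear_section[where R = "\<lambda>w v. w \<in> N1 \<and> v \<in> M1 \<and> w - F *\<^sub>v v \<in> N0"])
    show "linsub e N1" by (rule ND)
    show "\<exists>v. w \<in> N1 \<and> v \<in> M1 \<and> w - F *\<^sub>v v \<in> N0" if "w \<in> N1" for w using that F4 by auto
    show "0\<^sub>v e \<in> N1 \<and> 0\<^sub>v d \<in> M1 \<and> 0\<^sub>v e - F *\<^sub>v 0\<^sub>v d \<in> N0"
      using linsubD(2) MD ND mult_mat_vec_zero[OF Fc] by auto
    fix w v w' v'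
    assume h: "w \<in> N1 \<and> v \<in> M1 \<and> w - F *\<^sub>v v \<in> N0" "w' \<in> N1 \<and> v' \<in> M1 \<and> w' - F *\<^sub>v v' \<in> N0"
    then have hc: "w \<in> carrier_vec e" "w' \<in> carrier_vec e" "v \<in> carrier_vec d" "v' \<in> carrier_vec d"
      using Mc Nc by auto
    have "(w + w') - F *\<^sub>v (v + v') = (w - F *\<^sub>v v) + (w' - F *\<^sub>v v')"
      using hc Fc by (subst mult_add_distrib_mat_vec[OF Fc]) (auto intro!: eq_vecI)
    then show "w + w' \<in> N1 \<and> v + v' \<in> M1 \<and> (w + w') - F *\<^sub>v (v + v') \<in> N0"
      using h linsubD(3) MD ND by auto
  next
    fix c w v assume h: "w \<in> N1 \<and> v \<in> M1 \<and> w - F *\<^sub>v v \<in> N0"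
    then have hc: "w \<in> carrier_vec e" "v \<in> carrier_vec d"
      using Mc Nc by auto
    have "c \<cdot>\<^sub>v w - F *\<^sub>v (c \<cdot>\<^sub>v v) = c \<cdot>\<^sub>v (w - F *\<^sub>v v)"
      using hc Fc by (subst mult_mat_vec[OF Fc]) (auto intro!: eq_vecI simp: right_diff_distrib)
    then show "c \<cdot>\<^sub>v w \<in> N1 \<and> c \<cdot>\<^sub>v v \<in> M1 \<and> c \<cdot>\<^sub>v w - F *\<^sub>v (c \<cdot>\<^sub>v v) \<in> N0"
      using h linsubD(4) MD ND by auto
  qed (use Mc in auto)
  then obtain G where Gc: "G \<in> carrier_mat d e" and G1: "\<And>w. w \<in> N1 \<Longrightarrow> G *\<^sub>v w \<in> M1"
    and FG: "\<And>w. w \<in> N1 \<Longrightarrow> w - F *\<^sub>v (G *\<^sub>v w) \<in> N0" by auto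
  \<comment> \<open>Injectivity of the induced map: a congruence modulo \<open>M0\<close> may be
    checked after applying \<open>F\<close>. Surjectivity and equivariance of \<open>G\<close> are
    both reduced to \<open>N0\<close> in this way.\<close>
  have lift: "v - u \<in> M0" if "v \<in> M1" "u \<in> M1" "F *\<^sub>v v - F *\<^sub>v u \<in> N0" for v u
  proof -
    have "F *\<^sub>v (v - u) \<in> N0" using that mult_minus_distrib_mat_vec[OF Fc] Mc by auto
    then show ?thesis using F3 linsub_diff[OF MD(6)] that by auto
  qed
  have GF: "F *\<^sub>v (G *\<^sub>v w) - w \<in> N0" if "w \<in> N1" for w
    using linsub_diff_sym[OF ND(5) FG[OF that]] Nc F1 G1 that by auto
  have "qiso_by G e C N0 N1 d B M0 M1"
    unfolding qiso_by_def
  proof (intro conjI allI ballI)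
    show "{w \<in> N1. G *\<^sub>v w \<in> M0} = N0"
    proof -
      have "G *\<^sub>v w \<in> M0 \<longleftrightarrow> w \<in> N0" if w: "w \<in> N1" for w
      proof -
        have "G *\<^sub>v w \<in> M0 \<longleftrightarrow> F *\<^sub>v (G *\<^sub>v w) \<in> N0" using F3 G1[OF w] by auto
        also have "\<dots> \<longleftrightarrow> w \<in> N0"
          using linsub_diff_mem[OF ND(5) GF[OF w]] F1 G1 Nc w by auto
        finally show ?thesis .
      qed
      then show ?thesis using ND(4) by auto
    qed
    show "\<exists>v\<in>N1. w - G *\<^sub>v v \<in> M0" if w: "w \<in> M1" for w
      using lift[OF w G1[OF F1[OF w]] FG[OF F1[OF w]]] F1[OF w] by auto
    show "G *\<^sub>v (C i *\<^sub>v w) - B i *\<^sub>v (G *\<^sub>v w) \<in> M0" if w: "w \<in> N1" for w i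
    proof (rule lift)
      have Cw: "C i *\<^sub>v w \<in> N1" using w ND(3) by (auto dest: invsubD)
      have BG: "B i *\<^sub>v (G *\<^sub>v w) \<in> M1" using G1[OF w] MD(3) by (auto dest: invsubD)
      have CFG: "C i *\<^sub>v (F *\<^sub>v (G *\<^sub>v w)) \<in> N1"
        using F1[OF G1[OF w]] ND(3) by (auto dest: invsubD)
      show "G *\<^sub>v (C i *\<^sub>v w) \<in> M1" using G1[OF Cw] .
      show "B i *\<^sub>v (G *\<^sub>v w) \<in> M1" by fact
      have "C i *\<^sub>v (w - F *\<^sub>v (G *\<^sub>v w)) \<in> N0" using FG[OF w] ND(2) by (auto dest: invsubD)
      then have "C i *\<^sub>v w - C i *\<^sub>v (F *\<^sub>v (G *\<^sub>v w)) \<in> N0"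
        using mult_minus_distrib_mat_vec[OF famD[OF ND(1)]] w F1 G1 Nc by auto
      with GF[OF Cw] have 1: "F *\<^sub>v (G *\<^sub>v (C i *\<^sub>v w)) - C i *\<^sub>v (F *\<^sub>v (G *\<^sub>v w)) \<in> N0"
        by (rule linsub_diff_trans[OF ND(5)]) (use F1 G1 Cw CFG Nc in auto)
      have 2: "C i *\<^sub>v (F *\<^sub>v (G *\<^sub>v w)) - F *\<^sub>v (B i *\<^sub>v (G *\<^sub>v w)) \<in> N0"
        by (rule linsub_diff_sym[OF ND(5) F2]) (use F1 G1 w BG CFG Nc in auto)
      show "F *\<^sub>v (G *\<^sub>v (C i *\<^sub>v w)) - F *\<^sub>v (B i *\<^sub>v (G *\<^sub>v w)) \<in> N0"
        by (rule linsub_diff_trans[OF ND(5) 1 2]) (use F1 G1 w BG CFG Cw Nc in auto)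
    qed
  qed (use Gc G1 in auto)
  then show ?thesis by (auto simp: qiso_def)
qed

section \<open>Sums and intersections of submodules\<close>

lemma invsub_Int:
  assumes "invsub d B M" "invsub d B N"
  shows "invsub d B (M \<inter> N)"
  using assms by (auto simp: invsub_def linsub_def)

definition sumsub :: "complex vec set \<Rightarrow> complex vec set \<Rightarrow> complex vec set" where
  "sumsub M N = {v + w | v w. v \<in> M \<and> w \<in> N}"

lemma invsub_sumsub:
  assumes B: "fam d B" and M: "invsub d B M" and N: "invsub d B N"
  shows "invsub d B (sumsub M N)"
proof -
  note MD = invsubD[OF M] and ND = invsubD[OF N]
  have "linsub d (sumsub M N)"
    unfolding linsub_def
  proof (intro conjI ballI allI)
    show "sumsub M N \<subseteq> carrier_vec d" using MD ND by (auto simp: sumsub_def)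
    have "0\<^sub>v d = 0\<^sub>v d + (0\<^sub>v d :: complex vec)" by simp
    then show "0\<^sub>v d \<in> sumsub M N" using linsubD(2) MD(1) ND(1) unfolding sumsub_def by blast
  next
    fix x y assume "x \<in> sumsub M N" "y \<in> sumsub M N"
    then obtain v w v' w' where h: "x = v + w" "y = v' + w'" "v \<in> M" "w \<in> N" "v' \<in> M" "w' \<in> N"
      by (auto simp: sumsub_def)
    then have "v \<in> carrier_vec d" "v' \<in> carrier_vec d" "w \<in> carrier_vec d" "w' \<in> carrier_vec d"
      using MD ND by auto
    then have "x + y = (v + v') + (w + w')" using h by (auto intro!: eq_vecI)
    then show "x + y \<in> sumsub M N"
      using linsubD(3)[OF MD(1) h(3,5)] linsubD(3)[OF ND(1) h(4,6)] unfolding sumsub_def by blast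
  next
    fix c x assume "x \<in> sumsub M N"
    then obtain v w where h: "x = v + w" "v \<in> M" "w \<in> N" by (auto simp: sumsub_def)
    then have "v \<in> carrier_vec d" "w \<in> carrier_vec d" using MD ND by auto
    then have "c \<cdot>\<^sub>v x = c \<cdot>\<^sub>v v + c \<cdot>\<^sub>v w" using h by (simp add: smult_add_distrib_vec)
    then show "c \<cdot>\<^sub>v x \<in> sumsub M N"
      using linsubD(4)[OF MD(1) h(2)] linsubD(4)[OF ND(1) h(3)] unfolding sumsub_def by blast
  qed
  moreover have "B i *\<^sub>v x \<in> sumsub M N" if x: "x \<in> sumsub M N" for i x
  proof -
    obtain v w where h: "x = v + w" "v \<in> M" "w \<in> N" using x by (auto simp: sumsub_def)
    then have "B i *\<^sub>v x = B i *\<^sub>v v + B i *\<^sub>v w"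
      using mult_add_distrib_mat_vec[OF famD[OF B]] MD ND by auto
    then show ?thesis using MD(2)[OF h(2)] ND(2)[OF h(3)] unfolding sumsub_def by blast
  qed
  ultimately show ?thesis by (simp add: invsub_def)
qed

lemma sumsub_upper:
  assumes "linsub d M" "linsub d N"
  shows "M \<subseteq> sumsub M N" "N \<subseteq> sumsub M N"
proof -
  have "v = v + 0\<^sub>v d" if "v \<in> M" for v using that linsubD(1)[OF assms(1)] by auto
  then show "M \<subseteq> sumsub M N" using linsubD(2)[OF assms(2)] unfolding sumsub_def by blast
  have "v = 0\<^sub>v d + v" if "v \<in> N" for v using that linsubD(1)[OF assms(2)] by auto
  then show "N \<subseteq> sumsub M N" using linsubD(2)[OF assms(1)] unfolding sumsub_def by blast
qed

lemma sumsub_least: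
  assumes "linsub d L" "M \<subseteq> L" "N \<subseteq> L"
  shows "sumsub M N \<subseteq> L"
  using assms by (auto simp: sumsub_def linsub_def subset_iff)

lemma sumsub_commute:
  assumes "linsub d M" "linsub d N"
  shows "sumsub M N = sumsub N M"
proof -
  have "v + w = w + v" if "v \<in> M" "w \<in> N" for v w
    using that assms by (intro comm_add_vec[of _ d]) (auto simp: linsub_def)
  then show ?thesis unfolding sumsub_def by metis
qed

text \<open>The identity matrix already induces the map from N/(M \<inter> N) to (M + N)/M.\<close>

lemma second_isomorphism:
  assumes B: "fam d B" and M: "invsub d B M" and N: "invsub d B N"
  shows "qiso d B (M \<inter> N) N d B M (sumsub M N)"
proof -
  note MD = invsubD[OF M] and ND = invsubD[OF N]
  have id: "1\<^sub>m d *\<^sub>v v = v" if "v \<in> N" for v using that ND by auto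
  have "qiso_by (1\<^sub>m d) d B (M \<inter> N) N d B M (sumsub M N)"
    unfolding qiso_by_def
  proof (intro conjI allI ballI)
    show "1\<^sub>m d *\<^sub>v v \<in> sumsub M N" if "v \<in> N" for v
      using that id sumsub_upper[OF MD(1) ND(1)] by auto
    show "{v \<in> N. 1\<^sub>m d *\<^sub>v v \<in> M} = M \<inter> N" using id by auto
    show "1\<^sub>m d *\<^sub>v (B i *\<^sub>v v) - B i *\<^sub>v (1\<^sub>m d *\<^sub>v v) \<in> M" if v: "v \<in> N" for i v
    proof -
      have "B i *\<^sub>v v \<in> N" using v ND by auto
      then have "B i *\<^sub>v v \<in> carrier_vec d" using ND by auto
      then show ?thesis using id v linsubD(2)[OF MD(1)] by simp
    qed
    show "\<exists>v\<in>N. x - 1\<^sub>m d *\<^sub>v v \<in> M" if x: "x \<in> sumsub M N" for x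
    proof -
      obtain v w where h: "x = v + w" "v \<in> M" "w \<in> N" using x by (auto simp: sumsub_def)
      then have "v \<in> carrier_vec d" "w \<in> carrier_vec d" using MD ND by auto
      then have "x - w = v" using h by (auto intro!: eq_vecI)
      then show ?thesis using h id by (intro bexI[of _ w]) auto
    qed
  qed auto
  then show ?thesis by (auto simp: qiso_def)
qed

section \<open>Simple subquotients and transport along isomorphisms\<close>

definition covers :: "nat \<Rightarrow> ('i \<Rightarrow> complex mat) \<Rightarrow> complex vec set \<Rightarrow> complex vec set \<Rightarrow> bool" where
  "covers d B N L \<longleftrightarrow> invsub d B N \<and> invsub d B L \<and> N \<subset> L \<and>
     \<not> (\<exists>K. invsub d B K \<and> N \<subset> K \<and> K \<subset> L)"

lemma covers_subquot: "fam d B \<Longrightarrow> covers d B N L \<Longrightarrow> subquot d B N L"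
  by (auto simp: covers_def subquot_def)

lemma qiso_by_lift:
  assumes M: "subquot d B M0 M1" and N: "subquot e C N0 N1"
    and F: "qiso_by F d B M0 M1 e C N0 N1"
    and v: "v \<in> M1" "u \<in> M1" "F *\<^sub>v v - F *\<^sub>v u \<in> N0"
  shows "v - u \<in> M0"
proof -
  have Fc: "F \<in> carrier_mat e d" using F by (simp add: qiso_by_def)
  have "v \<in> carrier_vec d" "u \<in> carrier_vec d"
    using v linsubD(1)[OF subquotD(6)[OF M]] by auto
  then have "F *\<^sub>v (v - u) \<in> N0" using v mult_minus_distrib_mat_vec[OF Fc] by auto
  then show ?thesis
    using F linsub_diff[OF subquotD(6)[OF M] v(1,2)] by (auto simp: qiso_by_def)
qed

text \<open>A submodule \<open>K\<close> strictly between \<open>N0\<close> and \<open>N1\<close>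
  pulls back to a submodule between \<open>M0\<close> and \<open>M1\<close>, hence to one of these
  two. Surjectivity modulo \<open>N0\<close> then gives \<open>K = N0\<close> or
  \<open>K = N1\<close>.\<close>

lemma qiso_covers:
  assumes M: "subquot d B M0 M1" and N: "subquot e C N0 N1"
    and q: "qiso d B M0 M1 e C N0 N1" and cov: "covers d B M0 M1"
  shows "covers e C N0 N1"
proof -
  obtain F where F: "qiso_by F d B M0 M1 e C N0 N1"
    using q by (auto simp: qiso_def)
  note MD = subquotD[OF M] and ND = subquotD[OF N]
  have Fc: "F \<in> carrier_mat e d"
    and F1: "\<And>v. v \<in> M1 \<Longrightarrow> F *\<^sub>v v \<in> N1"
    and F3: "{v\<in>M1. F *\<^sub>v v \<in> N0} = M0"
    and F2: "\<And>i v. v \<in> M1 \<Longrightarrow> F *\<^sub>v (B i *\<^sub>v v) - C i *\<^sub>v (F *\<^sub>v v) \<in> N0"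
    and F4: "\<And>w. w\<in>N1 \<Longrightarrow> \<exists>v\<in>M1. w - F *\<^sub>v v \<in> N0"
    using F by (auto simp: qiso_by_def)
  have Mc: "\<And>v. v \<in> M1 \<Longrightarrow> v \<in> carrier_vec d" and Nc: "\<And>v. v \<in> N1 \<Longrightarrow> v \<in> carrier_vec e"
    using linsubD(1) MD ND by auto
  have "N0 \<noteq> N1"
  proof
    assume "N0 = N1"
    then have "M0 = M1" using F3 F1 by auto
    then show False using cov by (auto simp: covers_def)
  qed
  moreover have False if K: "invsub e C K" "N0 \<subset> K" "K \<subset> N1" for K
  proof -
    note KD = invsubD[OF K(1)]
    define L where "L = {v \<in> M1. F *\<^sub>v v \<in> K}"
    have "invsub d B L"
      unfolding invsub_def
    proof (intro conjI allI ballI)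
      show "linsub d L" unfolding L_def by (rule linsub_vimage[OF Fc MD(6) KD(1)])
      fix i v assume "v \<in> L"
      then have v: "v \<in> M1" "F *\<^sub>v v \<in> K" by (auto simp: L_def)
      have Bv: "B i *\<^sub>v v \<in> M1" using v MD(3) by (auto dest: invsubD)
      have CF: "C i *\<^sub>v (F *\<^sub>v v) \<in> K" using v KD by auto
      have "F *\<^sub>v (B i *\<^sub>v v) - C i *\<^sub>v (F *\<^sub>v v) \<in> K" using F2[OF v(1)] K by auto
      then have "F *\<^sub>v (B i *\<^sub>v v) \<in> K"
        using linsub_diff_mem[OF KD(1)] CF Nc[OF F1[OF Bv]] KD(3) by auto
      then show "B i *\<^sub>v v \<in> L" using Bv by (simp add: L_def)
    qed
    moreover have "M0 \<subseteq> L" "L \<subseteq> M1" using F3 K by (auto simp: L_def)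
    ultimately have "L = M0 \<or> L = M1" using cov unfolding covers_def by blast
    then show False
    proof
      assume L: "L = M0"
      have "w \<in> N0" if w: "w \<in> K" for w
      proof -
        have w1: "w \<in> N1" using w K by auto
        obtain v where v: "v \<in> M1" "w - F *\<^sub>v v \<in> N0" using F4[OF w1] by auto
        have "F *\<^sub>v v \<in> K"
          using linsub_diff_mem[OF KD(1), of w "F *\<^sub>v v"] v w K(2) Nc[OF w1] Nc[OF F1[OF v(1)]] by auto
        then have "v \<in> M0" using L v by (auto simp: L_def)
        then have "F *\<^sub>v v \<in> N0" using F3 by auto
        then show ?thesis
          using linsub_diff_mem[OF ND(5) v(2)] Nc[OF w1] Nc[OF F1[OF v(1)]] by auto
      qed
      then show False using K by auto
    next
      assume L: "L = M1"
      have "w \<in> K" if w: "w \<in> N1" for w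
      proof -
        obtain v where v: "v \<in> M1" "w - F *\<^sub>v v \<in> N0" using F4[OF w] by auto
        then have "F *\<^sub>v v \<in> K" using L by (auto simp: L_def)
        then show ?thesis
          using linsub_diff_mem[OF KD(1), of w "F *\<^sub>v v"] v K(2) Nc[OF w] Nc[OF F1[OF v(1)]] by auto
      qed
      then show False using K by auto
    qed
  qed
  ultimately show ?thesis using ND unfolding covers_def by blast
qed

text \<open>This is F(K) + N0 for submodules \<open>K\<close> of \<open>M1\<close>. The summand
  \<open>N0\<close> makes it a submodule, since \<open>F\<close> commutes with the operators only
  modulo \<open>N0\<close>.\<close>

definition push :: "complex mat \<Rightarrow> complex vec set \<Rightarrow> complex vec set \<Rightarrow> complex vec set \<Rightarrow> complex vec set" where
  "push F N0 N1 K = {w \<in> N1. \<exists>v\<in>K. w - F *\<^sub>v v \<in> N0}"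

lemma push_subquot:
  assumes M: "subquot d B M0 M1" and N: "subquot e C N0 N1"
    and F: "qiso_by F d B M0 M1 e C N0 N1"
    and K: "invsub d B K" "M0 \<subseteq> K" "K \<subseteq> M1"
  shows "invsub e C (push F N0 N1 K)" "N0 \<subseteq> push F N0 N1 K"
proof -
  note MD = subquotD[OF M] and ND = subquotD[OF N] and KD = invsubD[OF K(1)]
  have Fc: "F \<in> carrier_mat e d"
    and F1: "\<And>v. v \<in> M1 \<Longrightarrow> F *\<^sub>v v \<in> N1"
    and F2: "\<And>i v. v \<in> M1 \<Longrightarrow> F *\<^sub>v (B i *\<^sub>v v) - C i *\<^sub>v (F *\<^sub>v v) \<in> N0"
    using F by (auto simp: qiso_by_def)
  have Nc: "\<And>v. v \<in> N1 \<Longrightarrow> v \<in> carrier_vec e"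
    using linsubD(1) ND by auto
  have "w - F *\<^sub>v 0\<^sub>v d \<in> N0" if "w \<in> N0" for w
    using that mult_mat_vec_zero[OF Fc] linsub_diff[OF ND(5)] linsubD(2)[OF ND(5)] by auto
  then show N0: "N0 \<subseteq> push F N0 N1 K"
    using ND(4) linsubD(2)[OF KD(1)] unfolding push_def by blast
  have "linsub e (push F N0 N1 K)"
    unfolding linsub_def
  proof (intro conjI ballI allI)
    show "push F N0 N1 K \<subseteq> carrier_vec e" using Nc by (auto simp: push_def)
    show "0\<^sub>v e \<in> push F N0 N1 K" using N0 linsubD(2)[OF ND(5)] by auto
  next
    fix w w' assume "w \<in> push F N0 N1 K" "w' \<in> push F N0 N1 K"
    then obtain v v' where h: "w \<in> N1" "w' \<in> N1" "v \<in> K" "v' \<in> K" "w - F *\<^sub>v v \<in> N0" "w' - F *\<^sub>v v' \<in> N0"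
      by (auto simp: push_def)
    then have hc: "w \<in> carrier_vec e" "w' \<in> carrier_vec e" "v \<in> carrier_vec d" "v' \<in> carrier_vec d"
      using KD Nc by auto
    have "(w + w') - F *\<^sub>v (v + v') = (w - F *\<^sub>v v) + (w' - F *\<^sub>v v')"
      using hc Fc by (subst mult_add_distrib_mat_vec[OF Fc]) (auto intro!: eq_vecI)
    then have "(w + w') - F *\<^sub>v (v + v') \<in> N0" using h linsubD(3)[OF ND(5)] by auto
    then show "w + w' \<in> push F N0 N1 K"
      using h linsubD(3)[OF KD(1)] linsubD(3)[OF ND(6)] unfolding push_def by blast
  next
    fix c w assume "w \<in> push F N0 N1 K"
    then obtain v where h: "w \<in> N1" "v \<in> K" "w - F *\<^sub>v v \<in> N0" by (auto simp: push_def)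
    then have hc: "w \<in> carrier_vec e" "v \<in> carrier_vec d" using KD Nc by auto
    have "c \<cdot>\<^sub>v w - F *\<^sub>v (c \<cdot>\<^sub>v v) = c \<cdot>\<^sub>v (w - F *\<^sub>v v)"
      using hc Fc by (subst mult_mat_vec[OF Fc]) (auto intro!: eq_vecI simp: right_diff_distrib)
    then have "c \<cdot>\<^sub>v w - F *\<^sub>v (c \<cdot>\<^sub>v v) \<in> N0" using h linsubD(4)[OF ND(5)] by auto
    then show "c \<cdot>\<^sub>v w \<in> push F N0 N1 K"
      using h linsubD(4)[OF KD(1)] linsubD(4)[OF ND(6)] unfolding push_def by blast
  qed
  moreover have "C i *\<^sub>v w \<in> push F N0 N1 K" if w: "w \<in> push F N0 N1 K" for i w
  proof -
    obtain v where h: "w \<in> N1" "v \<in> K" "w - F *\<^sub>v v \<in> N0" using w by (auto simp: push_def)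
    have Fv: "F *\<^sub>v v \<in> N1" and Bv: "B i *\<^sub>v v \<in> K" and v1: "v \<in> M1"
      and Cw: "C i *\<^sub>v w \<in> N1"
      using h K F1 KD ND(3) by (auto dest: invsubD)
    have CFv: "C i *\<^sub>v (F *\<^sub>v v) \<in> N1" and FBv: "F *\<^sub>v (B i *\<^sub>v v) \<in> N1"
      using Fv Bv K F1 invsubD(2)[OF ND(3)] by auto
    have "C i *\<^sub>v (w - F *\<^sub>v v) \<in> N0" using h ND(2) by (auto dest: invsubD)
    then have 1: "C i *\<^sub>v w - C i *\<^sub>v (F *\<^sub>v v) \<in> N0"
      using mult_minus_distrib_mat_vec[OF famD[OF ND(1)]] h Fv Nc by auto
    have 2: "C i *\<^sub>v (F *\<^sub>v v) - F *\<^sub>v (B i *\<^sub>v v) \<in> N0"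
      by (rule linsub_diff_sym[OF ND(5) F2]) (use v1 CFv FBv Nc in auto)
    have "C i *\<^sub>v w - F *\<^sub>v (B i *\<^sub>v v) \<in> N0"
      by (rule linsub_diff_trans[OF ND(5) 1 2]) (use Cw CFv FBv Nc in auto)
    then show ?thesis using Cw Bv unfolding push_def by blast
  qed
  ultimately show "invsub e C (push F N0 N1 K)" by (simp add: invsub_def)
qed

lemma push_bounds:
  assumes M: "subquot d B M0 M1" and N: "subquot e C N0 N1"
    and F: "qiso_by F d B M0 M1 e C N0 N1"
  shows "push F N0 N1 M0 = N0" "push F N0 N1 M1 = N1"
proof -
  note MD = subquotD[OF M] and ND = subquotD[OF N]
  have Nc: "\<And>v. v \<in> N1 \<Longrightarrow> v \<in> carrier_vec e"
    using linsubD(1) ND by auto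
  show "push F N0 N1 M1 = N1" using F by (auto simp: push_def qiso_by_def)
  have "w \<in> N0" if w: "w \<in> N1" "v \<in> M0" "w - F *\<^sub>v v \<in> N0" for w v
  proof -
    have "F *\<^sub>v v \<in> N0" using w F by (auto simp: qiso_by_def)
    then show ?thesis using linsub_diff_mem[OF ND(5) w(3)] Nc ND(4) w by auto
  qed
  then show "push F N0 N1 M0 = N0"
    using push_subquot(2)[OF M N F MD(2) _ MD(4)] by (auto simp: push_def)
qed

text \<open>One and the same matrix serves all steps of a chain between \<open>M0\<close> and
  \<open>M1\<close>, so each factor keeps its isomorphism class when the chain is pushed
  forward.\<close>

lemma push_qiso:
  assumes M: "subquot d B M0 M1" and N: "subquot e C N0 N1"
    and F: "qiso_by F d B M0 M1 e C N0 N1"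
    and K: "invsub d B K" "M0 \<subseteq> K" and KK: "K \<subseteq> K'" and K': "invsub d B K'" "K' \<subseteq> M1"
  shows "qiso_by F d B K K' e C (push F N0 N1 K) (push F N0 N1 K')"
proof -
  note MD = subquotD[OF M] and ND = subquotD[OF N] and KD = invsubD[OF K(1)]
  have Fc: "F \<in> carrier_mat e d"
    and F1: "\<And>v. v \<in> M1 \<Longrightarrow> F *\<^sub>v v \<in> N1"
    and F2: "\<And>i v. v \<in> M1 \<Longrightarrow> F *\<^sub>v (B i *\<^sub>v v) - C i *\<^sub>v (F *\<^sub>v v) \<in> N0"
    using F by (auto simp: qiso_by_def)
  have Nc: "\<And>v. v \<in> N1 \<Longrightarrow> v \<in> carrier_vec e" and Mc: "\<And>v. v \<in> M1 \<Longrightarrow> v \<in> carrier_vec d"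
    using linsubD(1) ND MD by auto
  have N0: "N0 \<subseteq> push F N0 N1 K" using push_subquot(2)[OF M N F K] KK K' by auto
  have Fp: "F *\<^sub>v v \<in> push F N0 N1 L" if "v \<in> L" "L \<subseteq> M1" for v L
  proof -
    have "F *\<^sub>v v \<in> N1" using that F1 by auto
    then have "F *\<^sub>v v - F *\<^sub>v v = 0\<^sub>v e" using Nc by auto
    then show ?thesis using linsubD(2)[OF ND(5)] \<open>F *\<^sub>v v \<in> N1\<close> that
      unfolding push_def by (auto intro!: bexI[of _ v])
  qed
  show ?thesis
    unfolding qiso_by_def
  proof (intro conjI allI ballI)
    show "F *\<^sub>v v \<in> push F N0 N1 K'" if "v \<in> K'" for v using Fp that K' by auto
    show "F *\<^sub>v (B i *\<^sub>v v) - C i *\<^sub>v (F *\<^sub>v v) \<in> push F N0 N1 K" if "v \<in> K'" for i v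
      using that F2 K' N0 by auto
    show "\<exists>v\<in>K'. w - F *\<^sub>v v \<in> push F N0 N1 K" if "w \<in> push F N0 N1 K'" for w
      using that N0 by (auto simp: push_def)
    have "v \<in> K" if v: "v \<in> K'" "F *\<^sub>v v \<in> push F N0 N1 K" for v
    proof -
      obtain u where u: "u \<in> K" "F *\<^sub>v v - F *\<^sub>v u \<in> N0" using v by (auto simp: push_def)
      have m: "v \<in> M1" "u \<in> M1" using v u KK K' by auto
      have "v - u \<in> K" using qiso_by_lift[OF M N F m u(2)] K by auto
      then show ?thesis using linsub_diff_mem[OF KD(1), of v u] u Mc m by auto
    qed
    then show "{v \<in> K'. F *\<^sub>v v \<in> push F N0 N1 K} = K" using Fp KK K' by auto
  qed (rule Fc)
qed

section \<open>Isomorphism classes and multisets of factors\<close>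

type_synonym 'i quot = "nat \<times> ('i \<Rightarrow> complex mat) \<times> complex vec set \<times> complex vec set"

text \<open>Turning isomorphism into equality of classes allows the factors of two series, even of
  different modules, to be compared by equality of multisets.\<close>

definition qclass :: "nat \<Rightarrow> ('i \<Rightarrow> complex mat) \<Rightarrow> complex vec set \<Rightarrow> complex vec set \<Rightarrow> 'i quot set" where
  "qclass d B M0 M1 = {(e, C, N0, N1). subquot e C N0 N1 \<and> qiso d B M0 M1 e C N0 N1}"

lemma qclass_eqI:
  assumes M: "subquot d B M0 M1" and N: "subquot e C N0 N1"
    and q: "qiso d B M0 M1 e C N0 N1"
  shows "qclass d B M0 M1 = qclass e C N0 N1"
  using qiso_trans[OF M N _ q] qiso_trans[OF N M _ qiso_sym[OF M N q]]
  by (auto simp: qclass_def)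

lemma qclass_eqD:
  assumes N: "subquot e C N0 N1"
    and eq: "qclass d B M0 M1 = qclass e C N0 N1"
  shows "qiso d B M0 M1 e C N0 N1"
proof -
  have "(e, C, N0, N1) \<in> qclass e C N0 N1" using N qiso_refl[OF N] by (simp add: qclass_def)
  then have "(e, C, N0, N1) \<in> qclass d B M0 M1" using eq by simp
  then show ?thesis by (simp add: qclass_def)
qed

text \<open>Chains are taken between two arbitrary submodules and grow at the top. They can
  therefore be concatenated, and an induction removes the topmost factor.\<close>

inductive jh :: "nat \<Rightarrow> ('i \<Rightarrow> complex mat) \<Rightarrow> complex vec set \<Rightarrow> complex vec set \<Rightarrow> 'i quot set multiset \<Rightarrow> bool"
  for d B where
  jh_refl: "invsub d B M \<Longrightarrow> jh d B M M {#}"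
| jh_step: "jh d B M N ms \<Longrightarrow> covers d B N L \<Longrightarrow> jh d B M L (add_mset (qclass d B N L) ms)"

lemma jh_invsub:
  assumes "jh d B M N ms"
  shows "invsub d B M" "invsub d B N" "M \<subseteq> N"
proof -
  have "invsub d B M \<and> invsub d B N \<and> M \<subseteq> N"
    using assms by induction (auto simp: covers_def)
  then show "invsub d B M" "invsub d B N" "M \<subseteq> N" by auto
qed

lemma jh_append:
  assumes "jh d B N L ns" "jh d B M N ms"
  shows "jh d B M L (ms + ns)"
  using assms
proof induction
  case (jh_step N K ns L)
  then have "jh d B M L (add_mset (qclass d B K L) (ms + ns))"
    by (intro jh.jh_step) auto
  then show ?case by simp
qed simp

text \<open>Induction on the difference of the dimensions: an interval with an inner submodule is
  split there into two shorter ones, and an interval without one is a single simple step.\<close>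

lemma jh_exists:
  assumes "invsub d B M" "invsub d B N" "M \<subseteq> N"
  shows "\<exists>ms. jh d B M N ms"
  using assms
proof (induction "card (leads d N) - card (leads d M)" arbitrary: M N rule: less_induct)
  case less
  have card: "card (leads d S) < card (leads d T)" if "invsub d B S" "invsub d B T" "S \<subset> T" for S T
    using card_leads_less that by (auto simp: invsub_def)
  show ?case
  proof (cases "M = N")
    case True
    then show ?thesis using less jh_refl by blast
  next
    case False
    then have MN: "M \<subset> N" using less by auto
    show ?thesis
    proof (cases "\<exists>K. invsub d B K \<and> M \<subset> K \<and> K \<subset> N")
      case True
      then obtain K where K: "invsub d B K" "M \<subset> K" "K \<subset> N" by auto
      have c: "card (leads d M) < card (leads d K)" "card (leads d K) < card (leads d N)"
        using card K less.prems by auto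
      obtain ms where "jh d B M K ms" using less.hyps[of K M] K less.prems c by (meson diff_less_mono less_imp_le psubset_imp_subset)
      moreover obtain ns where "jh d B K N ns" using less.hyps[of N K] K less.prems c by (meson diff_less_mono2 less_trans psubset_imp_subset)
      ultimately show ?thesis using jh_append by blast
    next
      case False
      then have "covers d B M N" using MN less.prems by (simp add: covers_def)
      then show ?thesis using jh_step[OF jh_refl] less.prems by blast
    qed
  qed
qed

text \<open>Two chains ending in different maximal submodules \<open>N\<close> and \<open>K\<close>
  of \<open>L\<close> are both compared with chains through \<open>N \<inter> K\<close>. By the
  second isomorphism theorem these two have the same two top factors in opposite order.\<close>

theorem jordan_hoelder:
  assumes B: "fam d B" and "jh d B M L ms" "jh d B M L ns"
  shows "ms = ns"
  using assms(2,3)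
proof (induction "size ms" arbitrary: L ms ns rule: less_induct)
  case less
  have self: "ns = {#}" if "jh d B M M ns" for ns
    using that
  proof cases
    case (jh_step N ms')
    then show ?thesis using jh_invsub(3)[OF jh_step(2)] by (auto simp: covers_def)
  qed simp
  from less.prems(1) show ?case
  proof cases
    case jh_refl
    then show ?thesis using self less.prems by auto
  next
    case (jh_step N ms')
    note 1 = jh_step
    from less.prems(2) show ?thesis
    proof cases
      case jh_refl
      then show ?thesis using self less.prems by auto
    next
      case (jh_step K ns')
      note 2 = jh_step
      note inv = jh_invsub(2)[OF 1(2)] jh_invsub(2)[OF 2(2)] jh_invsub(1)[OF 1(2)]
      show ?thesis
      proof (cases "N = K")
        case True
        then show ?thesis using less.hyps[of ms' N ns'] 1 2 by simp
      next
        case False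
        let ?S = "sumsub N K"
        have covN: "covers d B N L" and covK: "covers d B K L" using 1 2 by auto
        have Sinv: "invsub d B ?S" using invsub_sumsub[OF B] inv by auto
        have S: "N \<subseteq> ?S" "K \<subseteq> ?S" using sumsub_upper[OF invsubD(1)[OF inv(1)] invsubD(1)[OF inv(2)]] by auto
        have SL: "?S \<subseteq> L"
        proof (rule sumsub_least)
          show "linsub d L" "N \<subseteq> L" "K \<subseteq> L" using covN covK by (auto simp: covers_def invsub_def)
        qed
        \<comment> \<open>If the sum were smaller than \<open>L\<close>, maximality would force it
          to coincide with \<open>N\<close> and with \<open>K\<close>.\<close>
        have eqL: "?S = L"
        proof (rule ccontr)
          assume "?S \<noteq> L"
          then have lt: "?S \<subset> L" using SL by auto
          have "\<not> N \<subset> ?S" using covN Sinv lt unfolding covers_def by metis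
          moreover have "\<not> K \<subset> ?S" using covK Sinv lt unfolding covers_def by metis
          ultimately have "N = K" using S unfolding psubset_eq by metis
          then show False using False by contradiction
        qed
        have comm: "sumsub K N = ?S"
          using sumsub_commute[OF invsubD(1)[OF inv(2)] invsubD(1)[OF inv(1)]] .
        let ?D = "N \<inter> K"
        have Dinv: "invsub d B ?D" using invsub_Int inv by auto
        have sq: "subquot d B ?D N" "subquot d B ?D K" "subquot d B N L" "subquot d B K L"
          using B Dinv inv covN covK by (auto simp: subquot_def covers_def)
        have qK: "qiso d B ?D K d B N L"
          using second_isomorphism[OF B inv(1,2)] eqL by simp
        have qN: "qiso d B ?D N d B K L"
          using second_isomorphism[OF B inv(2,1)] eqL comm by (simp add: Int_commute)
        have cK: "covers d B ?D K" and cN: "covers d B ?D N"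
          using qiso_covers[OF sq(3) sq(2) qiso_sym[OF sq(2) sq(3) qK] covN]
            qiso_covers[OF sq(4) sq(1) qiso_sym[OF sq(1) sq(4) qN] covK] by auto
        have clK: "qclass d B ?D K = qclass d B N L" and clN: "qclass d B ?D N = qclass d B K L"
          using qclass_eqI[OF sq(2,3) qK] qclass_eqI[OF sq(1,4) qN] by auto
        have "M \<subseteq> ?D" using jh_invsub(3)[OF 1(2)] jh_invsub(3)[OF 2(2)] by auto
        then obtain ks where ks: "jh d B M ?D ks" using jh_exists[OF inv(3) Dinv] by auto
        have jN: "jh d B M N (add_mset (qclass d B ?D N) ks)" using jh.jh_step[OF ks cN] .
        have jK: "jh d B M K (add_mset (qclass d B ?D K) ks)" using jh.jh_step[OF ks cK] .
        have sz: "size ms' < size ms" using 1(1) by simp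
        have ms': "ms' = add_mset (qclass d B ?D N) ks"
          by (rule less.hyps[OF sz 1(2) jN])
        \<comment> \<open>The induction measures only the first multiset. The chain through
          \<open>K\<close> has as many factors as the one through \<open>N\<close>, whose size is
          known from \<open>ms'\<close>, so the hypothesis applies a second time.\<close>
        have "size (add_mset (qclass d B ?D K) ks) < size ms" using sz unfolding ms' by simp
        then have ns': "add_mset (qclass d B ?D K) ks = ns'"
          by (rule less.hyps[OF _ jK 2(2)])
        show ?thesis unfolding 1(1) 2(1) ms' ns'[symmetric] clK clN by (rule add_mset_commute)
      qed
    qed
  qed
qed

text \<open>The chain is pushed forward step by step; \<open>qiso_covers\<close> keeps the steps
  simple and \<open>qclass_eqI\<close> keeps their classes.\<close>

lemma jh_transport:
  assumes M: "subquot d B M0 M1" and N: "subquot e C N0 N1"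
    and q: "qiso d B M0 M1 e C N0 N1" and j: "jh d B M0 M1 ms"
  shows "jh e C N0 N1 ms"
proof -
  obtain F where F: "qiso_by F d B M0 M1 e C N0 N1"
    using q by (auto simp: qiso_def)
  note MD = subquotD[OF M] and ND = subquotD[OF N]
  have "jh e C N0 (push F N0 N1 L) ms" if "jh d B K L ms" "K = M0" "L \<subseteq> M1" for K L ms
    using that
  proof induction
    case (jh_refl K)
    then show ?case using push_bounds(1)[OF M N F] jh.jh_refl[OF ND(2)] by simp
  next
    case (jh_step K L ms L')
    have LL: "invsub d B L" "invsub d B L'" "L \<subseteq> L'" "M0 \<subseteq> L"
      using jh_step jh_invsub[OF jh_step.hyps(1)] by (auto simp: covers_def)
    then have "M0 \<subseteq> L'" "L \<subseteq> M1" using jh_step.prems by auto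
    let ?L = "push F N0 N1 L" and ?L' = "push F N0 N1 L'"
    have sq: "subquot d B L L'" using LL MD(1) by (auto simp: subquot_def)
    have "?L \<subseteq> ?L'" using LL by (auto simp: push_def)
    then have sq': "subquot e C ?L ?L'"
      using push_subquot(1)[OF M N F] LL \<open>M0 \<subseteq> L'\<close> \<open>L \<subseteq> M1\<close> jh_step.prems ND(1)
      by (auto simp: subquot_def)
    have q: "qiso d B L L' e C ?L ?L'"
      using push_qiso[OF M N F LL(1,4,3,2)] jh_step.prems by (auto simp: qiso_def)
    have "jh e C N0 ?L' (add_mset (qclass e C ?L ?L') ms)"
      using jh_step qiso_covers[OF sq sq' q] \<open>L \<subseteq> M1\<close> by (intro jh.jh_step) auto
    then show ?case using qclass_eqI[OF sq sq' q] by simp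
  qed
  from this[OF j] show ?thesis using push_bounds(2)[OF M N F] by simp
qed

section \<open>Modules over the W-algebra\<close>

text \<open>Out-of-range indices are sent to the parity operator, which imposes no further condition.\<close>

definition wfam :: "nat \<Rightarrow> complex mat \<Rightarrow> (nat \<Rightarrow> bool \<Rightarrow> complex mat) \<Rightarrow> (nat \<times> bool) option \<Rightarrow> complex mat" where
  "wfam n P A i = (case i of None \<Rightarrow> P | Some (k, e) \<Rightarrow> if k \<in> {1..n} then A k e else P)"

text \<open>The predicate has two arguments so that the same translation serves invariance (second
  argument ignored), equivariance modulo a submodule and intertwining of two modules.\<close>

lemma all_wfam:
  "(\<forall>i. Q (wfam n P A i) (wfam n P' A' i)) \<longleftrightarrow> Q P P' \<and> (\<forall>k\<in>{1..n}. \<forall>e. Q (A k e) (A' k e))"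
  (is "?l \<longleftrightarrow> ?r")
proof
  assume l: ?l
  have "Q (A k e) (A' k e)" if "k \<in> {1..n}" for k e
    using l[rule_format, of "Some (k, e)"] that by (simp add: wfam_def)
  moreover have "Q P P'" using l[rule_format, of None] by (simp add: wfam_def)
  ultimately show ?r by blast
next
  assume r: ?r
  show ?l
  proof
    fix i
    show "Q (wfam n P A i) (wfam n P' A' i)"
    proof (cases i)
      case None
      then show ?thesis using r by (simp add: wfam_def)
    next
      case (Some ke)
      then show ?thesis using r by (cases ke) (simp add: wfam_def)
    qed
  qed
qed

lemma inv_gsubspace_iff: "inv_gsubspace d P (wops n A) S \<longleftrightarrow> invsub d (wfam n P A) S"
proof -
  have "(\<forall>i. \<forall>v\<in>S. wfam n P A i *\<^sub>v v \<in> S) \<longleftrightarrow>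
      (\<forall>v\<in>S. P *\<^sub>v v \<in> S) \<and> (\<forall>k\<in>{1..n}. \<forall>e. \<forall>v\<in>S. A k e *\<^sub>v v \<in> S)"
    by (rule all_wfam[where Q = "\<lambda>B C. \<forall>v\<in>S. B *\<^sub>v v \<in> S"])
  then show ?thesis
    unfolding inv_gsubspace_def invsub_def linsub_def wops_def by blast
qed

lemma factor_iso_iff:
  "factor_iso n d P A M0 M1 d' P' A' N0 N1 \<longleftrightarrow>
     qiso d (wfam n P A) M0 M1 d' (wfam n P' A') N0 N1"
proof -
  have "(\<forall>i. \<forall>v\<in>M1. F *\<^sub>v (wfam n P A i *\<^sub>v v) - wfam n P' A' i *\<^sub>v (F *\<^sub>v v) \<in> N0) \<longleftrightarrow>
      (\<forall>v\<in>M1. F *\<^sub>v (P *\<^sub>v v) - P' *\<^sub>v (F *\<^sub>v v) \<in> N0) \<and>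
      (\<forall>k\<in>{1..n}. \<forall>e. \<forall>v\<in>M1. F *\<^sub>v (A k e *\<^sub>v v) - A' k e *\<^sub>v (F *\<^sub>v v) \<in> N0)" for F
    by (rule all_wfam[where Q = "\<lambda>B C. \<forall>v\<in>M1. F *\<^sub>v (B *\<^sub>v v) - C *\<^sub>v (F *\<^sub>v v) \<in> N0"])
  moreover have "(\<forall>v\<in>M1. \<forall>k\<in>{1..n}. \<forall>e. R v k e) \<longleftrightarrow> (\<forall>k\<in>{1..n}. \<forall>e. \<forall>v\<in>M1. R v k e)"
    for R :: "complex vec \<Rightarrow> nat \<Rightarrow> bool \<Rightarrow> bool" by blast
  ultimately show ?thesis
    unfolding factor_iso_def qiso_def qiso_by_def Bex_def by (simp only: conj_assoc)
qed

section \<open>Composition series and classes in the Grothendieck group\<close>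

lemma jh_list:
  assumes "jh d B M N ms"
  shows "\<exists>Ms. Ms \<noteq> [] \<and> hd Ms = M \<and> last Ms = N \<and> (\<forall>K\<in>set Ms. invsub d B K) \<and>
    (\<forall>i. Suc i < length Ms \<longrightarrow> covers d B (Ms ! i) (Ms ! Suc i)) \<and>
    mset (map (\<lambda>i. qclass d B (Ms ! i) (Ms ! Suc i)) [0..<length Ms - 1]) = ms"
  using assms
proof induction
  case (jh_refl M)
  then show ?case by (intro exI[of _ "[M]"]) auto
next
  case (jh_step M N ms L)
  then obtain Ms where Ms: "Ms \<noteq> []" "hd Ms = M" "last Ms = N" "\<forall>K\<in>set Ms. invsub d B K"
    "\<And>i. Suc i < length Ms \<Longrightarrow> covers d B (Ms ! i) (Ms ! Suc i)"
    "mset (map (\<lambda>i. qclass d B (Ms ! i) (Ms ! Suc i)) [0..<length Ms - 1]) = ms" by blast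
  obtain l where l: "length Ms = Suc l" using Ms(1) by (cases Ms) auto
  have nth: "(Ms @ [L]) ! i = Ms ! i" if "i \<le> l" for i using that l by (simp add: nth_append)
  have nthl: "(Ms @ [L]) ! Suc l = L" using l by (simp add: nth_append)
  have lN: "Ms ! l = N" using Ms(1,3) l by (simp add: last_conv_nth)
  let ?g = "\<lambda>i. qclass d B ((Ms @ [L]) ! i) ((Ms @ [L]) ! Suc i)"
  have g: "map ?g [0..<l] = map (\<lambda>i. qclass d B (Ms ! i) (Ms ! Suc i)) [0..<l]"
    by (rule map_cong) (auto simp: nth)
  have "map ?g [0..<length (Ms @ [L]) - 1] = map ?g [0..<l] @ [qclass d B N L]"
    using l nth[of l] nthl lN by simp
  then have "mset (map ?g [0..<length (Ms @ [L]) - 1]) = mset (map ?g [0..<l]) + {#qclass d B N L#}"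
    by (simp del: mset_map)
  also have "mset (map ?g [0..<l]) = ms" unfolding g using Ms(6) l by simp
  finally have "mset (map ?g [0..<length (Ms @ [L]) - 1]) = add_mset (qclass d B N L) ms" by simp
  moreover have "covers d B ((Ms @ [L]) ! i) ((Ms @ [L]) ! Suc i)" if "Suc i < length (Ms @ [L])" for i
  proof (cases "i = l")
    case True
    then show ?thesis using nth[of l] nthl lN jh_step by simp
  next
    case False
    then show ?thesis using nth[of i] nth[of "Suc i"] Ms(5)[of i] that l by simp
  qed
  moreover have "invsub d B L" using jh_step by (simp add: covers_def)
  ultimately show ?case using Ms
    by (intro exI[of _ "Ms @ [L]"]) (auto simp: hd_append)
qed

text \<open>Only one pair of chains with equal multisets is demanded. That the multiset is
  independent of the chain is the content of \<open>jordan_hoelder\<close>, which is what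
  transitivity needs for the module in the middle.\<close>

definition same_factors :: "nat \<Rightarrow> ('i \<Rightarrow> complex mat) \<Rightarrow> nat \<Rightarrow> ('i \<Rightarrow> complex mat) \<Rightarrow> bool" where
  "same_factors d B e C \<longleftrightarrow>
     (\<exists>ms. jh d B {0\<^sub>v d} (carrier_vec d) ms \<and> jh e C {0\<^sub>v e} (carrier_vec e) ms)"

lemma invsub_trivial:
  assumes "fam d B"
  shows "invsub d B {0\<^sub>v d}" "invsub d B (carrier_vec d)"
proof -
  have "B i *\<^sub>v 0\<^sub>v d = 0\<^sub>v d" for i using mult_mat_vec_zero[OF famD[OF assms]] .
  moreover have "linsub d {0\<^sub>v d}" "linsub d (carrier_vec d)" by (auto simp: linsub_def)
  moreover have "B i *\<^sub>v v \<in> carrier_vec d" if "v \<in> carrier_vec d" for i v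
    using mult_mat_vec_carrier[OF famD[OF assms] that] .
  ultimately show "invsub d B {0\<^sub>v d}" "invsub d B (carrier_vec d)"
    unfolding invsub_def by blast+
qed

lemma same_factors_refl:
  assumes "fam d B"
  shows "same_factors d B d B"
proof -
  have "{0\<^sub>v d} \<subseteq> (carrier_vec d :: complex vec set)" by simp
  then show ?thesis using jh_exists[OF invsub_trivial[OF assms]] unfolding same_factors_def by blast
qed

lemma same_factors_trans:
  assumes "fam e C" "same_factors d B e C" "same_factors e C f D"
  shows "same_factors d B f D"
proof -
  obtain ms where ms: "jh d B {0\<^sub>v d} (carrier_vec d) ms" "jh e C {0\<^sub>v e} (carrier_vec e) ms"
    using assms(2) by (auto simp: same_factors_def)
  obtain ns where ns: "jh e C {0\<^sub>v e} (carrier_vec e) ns" "jh f D {0\<^sub>v f} (carrier_vec f) ns"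
    using assms(3) by (auto simp: same_factors_def)
  have "ms = ns" using jordan_hoelder[OF assms(1) ms(2) ns(1)] .
  then show ?thesis using ms ns by (auto simp: same_factors_def)
qed

lemma same_K0I:
  assumes B: "fam d (wfam n P A)" and C: "fam d' (wfam n P' A')"
    and "same_factors d (wfam n P A) d' (wfam n P' A')"
  shows "same_K0 n d P A d' P' A'"
proof -
  let ?B = "wfam n P A" and ?C = "wfam n P' A'"
  have comp: "comp_series n d P A Ms"
    if "Ms \<noteq> []" "hd Ms = {0\<^sub>v d}" "last Ms = carrier_vec d" "\<forall>K\<in>set Ms. invsub d (wfam n P A) K"
      "\<And>i. Suc i < length Ms \<Longrightarrow> covers d (wfam n P A) (Ms ! i) (Ms ! Suc i)" for d P A Ms
    using that unfolding comp_series_def inv_gsubspace_iff covers_def by blast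
  obtain ms where ms: "jh d ?B {0\<^sub>v d} (carrier_vec d) ms" "jh d' ?C {0\<^sub>v d'} (carrier_vec d') ms"
    using assms(3) by (auto simp: same_factors_def)
  obtain Ms where Ms: "Ms \<noteq> []" "hd Ms = {0\<^sub>v d}" "last Ms = carrier_vec d" "\<forall>K\<in>set Ms. invsub d ?B K"
    "\<And>i. Suc i < length Ms \<Longrightarrow> covers d ?B (Ms ! i) (Ms ! Suc i)"
    "mset (map (\<lambda>i. qclass d ?B (Ms ! i) (Ms ! Suc i)) [0..<length Ms - 1]) = ms"
    using jh_list[OF ms(1)] by blast
  obtain Ns where Ns: "Ns \<noteq> []" "hd Ns = {0\<^sub>v d'}" "last Ns = carrier_vec d'" "\<forall>K\<in>set Ns. invsub d' ?C K"
    "\<And>i. Suc i < length Ns \<Longrightarrow> covers d' ?C (Ns ! i) (Ns ! Suc i)"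
    "mset (map (\<lambda>i. qclass d' ?C (Ns ! i) (Ns ! Suc i)) [0..<length Ns - 1]) = ms"
    using jh_list[OF ms(2)] by blast
  let ?xs = "map (\<lambda>i. qclass d ?B (Ms ! i) (Ms ! Suc i)) [0..<length Ms - 1]"
  let ?ys = "map (\<lambda>i. qclass d' ?C (Ns ! i) (Ns ! Suc i)) [0..<length Ns - 1]"
  \<comment> \<open>Equal multisets yield a permutation \<open>p\<close> with
    \<open>?xs ! i = ?ys ! p i\<close>, which is the orientation used in
    \<open>same_K0\<close>.\<close>
  have "mset ?xs = mset ?ys" using Ms(6) Ns(6) by simp
  then obtain p where p: "p permutes {..<length ?ys}" "permute_list p ?ys = ?xs"
    by (rule mset_eq_permutation)
  have "length ?ys = length ?xs" using arg_cong[OF p(2), of length] by simp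
  moreover have "0 < length Ms" "0 < length Ns" using Ms(1) Ns(1) by auto
  ultimately have len: "length Ms = length Ns" unfolding length_map length_upt by linarith
  have "factor_iso n d P A (Ms ! i) (Ms ! Suc i) d' P' A' (Ns ! p i) (Ns ! Suc (p i))"
    if i: "i < length Ms - 1" for i
  proof -
    have pi: "p i < length Ns - 1" using permutes_in_image[OF p(1), of i] i len by (simp del: length_greater_0_conv)
    have "?xs ! i = ?ys ! p i"
      using permute_list_nth[OF p(1), of i] p(2) i len by simp
    then have eq: "qclass d ?B (Ms ! i) (Ms ! Suc i) = qclass d' ?C (Ns ! p i) (Ns ! Suc (p i))"
      using i pi by simp
    have "covers d' ?C (Ns ! p i) (Ns ! Suc (p i))" using Ns(5) pi by simp
    then show ?thesis
      unfolding factor_iso_iff using qclass_eqD[OF covers_subquot[OF C] eq] by blast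
  qed
  moreover have "comp_series n d P A Ms" "comp_series n d' P' A' Ns"
    by (rule comp[OF Ms(1-4)], rule Ms(5), assumption, rule comp[OF Ns(1-4)], rule Ns(5), assumption)
  ultimately show ?thesis
    unfolding same_K0_def using len p(1) by (intro exI[of _ Ms] exI[of _ Ns] exI[of _ p]) simp
qed

section \<open>Two sources of equal composition factors\<close>

lemma same_factors_iso:
  assumes B: "fam d B" and C: "fam e C" and F: "F \<in> carrier_mat e d" and G: "G \<in> carrier_mat d e"
    and FG: "F * G = 1\<^sub>m e" "G * F = 1\<^sub>m d" and int: "\<And>i. F * B i = C i * F"
  shows "same_factors d B e C"
proof -
  have FGv: "F *\<^sub>v (G *\<^sub>v w) = w" if "w \<in> carrier_vec e" for w
    using FG(1) assoc_mult_mat_vec[OF F G that] that by simp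
  have GFv: "G *\<^sub>v (F *\<^sub>v w) = w" if "w \<in> carrier_vec d" for w
    using FG(2) assoc_mult_mat_vec[OF G F that] that by simp
  have sq: "subquot d B {0\<^sub>v d} (carrier_vec d)" "subquot e C {0\<^sub>v e} (carrier_vec e)"
    using B C invsub_trivial by (auto simp: subquot_def)
  have "qiso_by F d B {0\<^sub>v d} (carrier_vec d) e C {0\<^sub>v e} (carrier_vec e)"
    unfolding qiso_by_def
  proof (intro conjI allI ballI)
    show "F *\<^sub>v (B i *\<^sub>v v) - C i *\<^sub>v (F *\<^sub>v v) \<in> {0\<^sub>v e}" if v: "v \<in> carrier_vec d" for i v
    proof -
      have "F *\<^sub>v (B i *\<^sub>v v) = C i *\<^sub>v (F *\<^sub>v v)"
        using int[of i] assoc_mult_mat_vec[OF F famD[OF B] v, of i] assoc_mult_mat_vec[OF famD[OF C] F v, of i] by simp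
      moreover have "C i *\<^sub>v (F *\<^sub>v v) \<in> carrier_vec e" using mult_mat_vec_carrier[OF famD[OF C]] mult_mat_vec_carrier[OF F v] by blast
      ultimately show ?thesis by simp
    qed
    show "{v \<in> carrier_vec d. F *\<^sub>v v \<in> {0\<^sub>v e}} = {0\<^sub>v d}"
    proof -
      have "v = 0\<^sub>v d" if "v \<in> carrier_vec d" "F *\<^sub>v v = 0\<^sub>v e" for v
        using GFv[OF that(1)] that(2) mult_mat_vec_zero[OF G] by simp
      then show ?thesis using mult_mat_vec_zero[OF F] by auto
    qed
    show "\<exists>v\<in>carrier_vec d. w - F *\<^sub>v v \<in> {0\<^sub>v e}" if "w \<in> carrier_vec e" for w
      using FGv[OF that] that G by (intro bexI[of _ "G *\<^sub>v w"]) auto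
  qed (use F in auto)
  then have q: "qiso d B {0\<^sub>v d} (carrier_vec d) e C {0\<^sub>v e} (carrier_vec e)"
    by (auto simp: qiso_def)
  obtain ms where "jh d B {0\<^sub>v d} (carrier_vec d) ms"
    using jh_exists[OF invsub_trivial[OF B]] by auto
  then show ?thesis using jh_transport[OF sq q] by (auto simp: same_factors_def)
qed

text \<open>If T exchanges the two structures and has image equal to its kernel K, then V/K for one
  structure is K for the other and vice versa.\<close>

lemma same_factors_exchange:
  assumes B: "fam d B" and C: "fam d C" and T: "T \<in> carrier_mat d d"
    and exact: "\<And>v. v \<in> carrier_vec d \<Longrightarrow> T *\<^sub>v v = 0\<^sub>v d \<longleftrightarrow> (\<exists>u\<in>carrier_vec d. v = T *\<^sub>v u)"
    and TB: "\<And>i. T * B i = C i * T" and TC: "\<And>i. T * C i = B i * T"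
  shows "same_factors d B d C"
proof -
  define K where "K = {v \<in> carrier_vec d. T *\<^sub>v v \<in> {0\<^sub>v d}}"
  have z: "linsub d {0\<^sub>v d}" "linsub d (carrier_vec d)" by (auto simp: linsub_def)
  have linK: "linsub d K" unfolding K_def by (rule linsub_vimage[OF T z(2) z(1)])
  have act: "T *\<^sub>v (B i *\<^sub>v v) = C i *\<^sub>v (T *\<^sub>v v)"
    if "fam d B" "fam d C" "\<And>i. T * B i = C i * T" "v \<in> carrier_vec d" for B C :: "'a \<Rightarrow> complex mat" and i v
    using that(3)[of i] assoc_mult_mat_vec[OF T famD[OF that(1)] that(4), of i]
      assoc_mult_mat_vec[OF famD[OF that(2)] T that(4), of i] by simp
  have invK: "invsub d B K"
    if f: "fam d B" "fam d C" "\<And>i. T * B i = C i * T" for B C :: "'a \<Rightarrow> complex mat"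
  proof -
    have "B i *\<^sub>v v \<in> K" if v: "v \<in> K" for i v
    proof -
      have "v \<in> carrier_vec d" "T *\<^sub>v v = 0\<^sub>v d" using v by (auto simp: K_def)
      then have "T *\<^sub>v (B i *\<^sub>v v) = 0\<^sub>v d"
        using act[OF f] mult_mat_vec_zero[OF famD[OF f(2)]] by simp
      then show ?thesis
        using mult_mat_vec_carrier[OF famD[OF f(1)]] \<open>v \<in> carrier_vec d\<close> by (auto simp: K_def)
    qed
    then show ?thesis using linK by (simp add: invsub_def)
  qed
  \<comment> \<open>Stated for arbitrary families because it is used twice, with the roles of
    \<open>B\<close> and \<open>C\<close> exchanged.\<close>
  have move: "\<exists>ms. jh d B K (carrier_vec d) ms \<and> jh d C {0\<^sub>v d} K ms"
    if f: "fam d B" "fam d C" "\<And>i. T * B i = C i * T" "\<And>i. T * C i = B i * T" for B C :: "'a \<Rightarrow> complex mat"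
  proof -
    have sq: "subquot d B K (carrier_vec d)" "subquot d C {0\<^sub>v d} K"
      using f invK[OF f(1,2,3)] invK[OF f(2,1,4)] invsub_trivial[OF f(1)] invsub_trivial[OF f(2)]
        linsubD(2)[OF linK] by (auto simp: subquot_def K_def)
    have "qiso_by T d B K (carrier_vec d) d C {0\<^sub>v d} K"
      unfolding qiso_by_def
    proof (intro conjI allI ballI)
      show "T *\<^sub>v v \<in> K" if "v \<in> carrier_vec d" for v
        using exact[of "T *\<^sub>v v"] T that by (auto simp: K_def)
      show "T *\<^sub>v (B i *\<^sub>v v) - C i *\<^sub>v (T *\<^sub>v v) \<in> {0\<^sub>v d}" if v: "v \<in> carrier_vec d" for i v
      proof -
        have "C i *\<^sub>v (T *\<^sub>v v) \<in> carrier_vec d" using mult_mat_vec_carrier[OF famD[OF f(2)]] mult_mat_vec_carrier[OF T v] by blast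
        then show ?thesis using act[OF f(1-3) v] by simp
      qed
      show "\<exists>v\<in>carrier_vec d. w - T *\<^sub>v v \<in> {0\<^sub>v d}" if "w \<in> K" for w
      proof -
        have "w \<in> carrier_vec d" "T *\<^sub>v w = 0\<^sub>v d" using that by (auto simp: K_def)
        then obtain u where "u \<in> carrier_vec d" "w = T *\<^sub>v u" using exact[of w] by auto
        then show ?thesis using \<open>w \<in> carrier_vec d\<close> by (intro bexI[of _ u]) auto
      qed
    qed (use T in \<open>auto simp: K_def\<close>)
    then have q: "qiso d B K (carrier_vec d) d C {0\<^sub>v d} K" by (auto simp: qiso_def)
    obtain ms where "jh d B K (carrier_vec d) ms"
      using jh_exists[OF subquotD(2,3,4)[OF sq(1)]] by auto
    then show ?thesis using jh_transport[OF sq q] by auto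
  qed
  obtain ms where ms: "jh d B K (carrier_vec d) ms" "jh d C {0\<^sub>v d} K ms"
    using move[OF B C TB TC] by auto
  obtain ns where ns: "jh d C K (carrier_vec d) ns" "jh d B {0\<^sub>v d} K ns"
    using move[OF C B TC TB] by auto
  have "jh d B {0\<^sub>v d} (carrier_vec d) (ns + ms)" "jh d C {0\<^sub>v d} (carrier_vec d) (ms + ns)"
    using jh_append[OF ms(1) ns(2)] jh_append[OF ns(1) ms(2)] .
  then show ?thesis unfolding same_factors_def by (metis add.commute)
qed

section \<open>The recursion for the generators\<close>

text \<open>The sign that the part of parity \<open>e\<close> of an ordered product picks up when
  all its odd factors are negated.\<close>

definition psgn :: "bool \<Rightarrow> complex" where
  "psgn e = (if e then -1 else 1)"

lemma psgn_simps [simp]: "psgn e * psgn e = 1" "psgn (\<not> e) = - psgn e" "psgn e * (psgn e * x) = x"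
  by (auto simp: psgn_def)

text \<open>With side conditions on dimensions (rather than membership in a carrier) these rules
  have no unbound variables in their premises, so the simplifier can discharge them.\<close>

lemma mat_arith:
  fixes A B C :: "complex mat"
  shows "dim_col A = dim_row B \<Longrightarrow> dim_col B = dim_row C \<Longrightarrow> A * B * C = A * (B * C)"
    "dim_col A = dim_row B \<Longrightarrow> dim_row B = dim_row C \<Longrightarrow> dim_col B = dim_col C \<Longrightarrow> A * (B + C) = A * B + A * C"
    "dim_col A = dim_row C \<Longrightarrow> dim_row A = dim_row B \<Longrightarrow> dim_col A = dim_col B \<Longrightarrow> (A + B) * C = A * C + B * C"
    "dim_col A = dim_row B \<Longrightarrow> dim_row B = dim_row C \<Longrightarrow> dim_col B = dim_col C \<Longrightarrow> A * (B - C) = A * B - A * C"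
    "dim_col A = dim_row C \<Longrightarrow> dim_row A = dim_row B \<Longrightarrow> dim_col A = dim_col B \<Longrightarrow> (A - B) * C = A * C - B * C"
    "dim_col A = dim_row B \<Longrightarrow> A * (k \<cdot>\<^sub>m B) = k \<cdot>\<^sub>m (A * B)"
    "dim_col A = dim_row B \<Longrightarrow> (k \<cdot>\<^sub>m A) * B = k \<cdot>\<^sub>m (A * B)"
    "dim_col A = dim_row B \<Longrightarrow> A * (- B) = (-1) \<cdot>\<^sub>m (A * B)"
    "dim_col A = dim_row B \<Longrightarrow> (- A) * B = (-1) \<cdot>\<^sub>m (A * B)"
    "k \<cdot>\<^sub>m (l \<cdot>\<^sub>m A) = (k * l) \<cdot>\<^sub>m A"
    "dim_row A = dim_row B \<Longrightarrow> dim_col A = dim_col B \<Longrightarrow> k \<cdot>\<^sub>m (A + B) = k \<cdot>\<^sub>m A + k \<cdot>\<^sub>m B"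
    "dim_row A = dim_row B \<Longrightarrow> dim_col A = dim_col B \<Longrightarrow> k \<cdot>\<^sub>m (A - B) = k \<cdot>\<^sub>m A - k \<cdot>\<^sub>m B"
    "1 \<cdot>\<^sub>m A = A" "dim_col A = n \<Longrightarrow> A * 1\<^sub>m n = A" "dim_row A = n \<Longrightarrow> 1\<^sub>m n * A = A"
    "dim_col A = n \<Longrightarrow> A * 0\<^sub>m n m = 0\<^sub>m (dim_row A) m" "dim_row A = n \<Longrightarrow> 0\<^sub>m m n * A = 0\<^sub>m m (dim_col A)"
  subgoal by (rule assoc_mult_mat[of A "dim_row A" "dim_col A" B "dim_col B" C "dim_col C"]) auto
  subgoal by (rule mult_add_distrib_mat[of A "dim_row A" "dim_col A" B "dim_col B" C]) auto
  subgoal by (rule add_mult_distrib_mat[of A "dim_row A" "dim_col A" B C "dim_col C"]) auto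
  subgoal by (rule mult_minus_distrib_mat[of A "dim_row A" "dim_col A" B "dim_col B" C]) auto
  subgoal by (rule minus_mult_distrib_mat[of A "dim_row A" "dim_col A" B C "dim_col C"]) auto
  subgoal by (rule mult_smult_distrib[of A "dim_row A" "dim_col A" B "dim_col B"]) auto
  subgoal by (rule mult_smult_assoc_mat[of A "dim_row A" "dim_col A" B "dim_col B"]) auto
  subgoal by (rule eq_matI) auto
  subgoal by (rule eq_matI) auto
  subgoal by (rule eq_matI) auto
  subgoal by (rule eq_matI) (auto simp: distrib_left)
  subgoal by (rule eq_matI) (auto simp: right_diff_distrib)
  subgoal by (rule eq_matI) auto
  subgoal by (rule right_mult_one_mat') auto
  subgoal by (rule left_mult_one_mat') auto
  subgoal by (rule eq_matI) auto
  subgoal by (rule eq_matI) auto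
  done

section \<open>Ordered products split by parity\<close>

lemma pexp_carrier:
  assumes "\<And>a B. (a, B) \<in> set l \<Longrightarrow> B \<in> carrier_mat d d"
  shows "pexp d l e \<in> carrier_mat d d"
  using assms
proof (induction l arbitrary: e)
  case (Cons x l)
  obtain a B where x: "x = (a, B)" by force
  have "B \<in> carrier_mat d d" using Cons.prems x by auto
  moreover have "pexp d l e' \<in> carrier_mat d d" for e' using Cons by auto
  ultimately show ?case unfolding x pexp.simps by (meson add_carrier_mat mult_carrier_mat)
qed simp

text \<open>\<open>pexp\<close> peels off factors on the left, whereas the largest index of a
  subset, on which the recursion in \<open>n\<close> acts, stands at the right end of the
  product.\<close>

lemma pexp_snoc:
  assumes "\<And>a B. (a, B) \<in> set l \<Longrightarrow> B \<in> carrier_mat d d" and B: "B \<in> carrier_mat d d"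
  shows "pexp d (l @ [(a, B)]) e = a \<cdot>\<^sub>m pexp d l e + pexp d l (\<not> e) * B"
  using assms(1)
proof (induction l arbitrary: e)
  case Nil
  then show ?case using B by auto
next
  case (Cons x l)
  obtain b C where x: "x = (b, C)" by force
  have C: "dim_row C = d" "dim_col C = d" using Cons.prems x by auto
  have "pexp d l e' \<in> carrier_mat d d" for e' using pexp_carrier[of l d e'] Cons.prems by auto
  then have p: "dim_row (pexp d l e') = d" "dim_col (pexp d l e') = d" for e' by auto
  have B': "dim_row B = d" "dim_col B = d" using B by auto
  have IH: "pexp d (l @ [(a, B)]) e' = a \<cdot>\<^sub>m pexp d l e' + pexp d l (\<not> e') * B" for e'
    using Cons by auto
  show ?case
    unfolding x append_Cons pexp.simps IH
    by (intro eq_matI)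
      (simp_all add: mat_arith C p B' algebra_simps del: index_mult_mat(1))
qed

lemma pexp_neg:
  assumes "\<And>a B. (a, B) \<in> set l \<Longrightarrow> B \<in> carrier_mat d d"
  shows "pexp d (map (\<lambda>(a, B). (a, (-1) \<cdot>\<^sub>m B)) l) e = psgn e \<cdot>\<^sub>m pexp d l e"
  using assms
proof (induction l arbitrary: e)
  case Nil
  then show ?case by (auto simp: psgn_def)
next
  case (Cons x l)
  obtain b C where x: "x = (b, C)" by force
  have C: "dim_row C = d" "dim_col C = d" using Cons.prems x by auto
  have "pexp d l e' \<in> carrier_mat d d" for e' using pexp_carrier[of l d e'] Cons.prems by auto
  then have p: "dim_row (pexp d l e') = d" "dim_col (pexp d l e') = d" for e' by auto
  have IH: "pexp d (map (\<lambda>(a, B). (a, (-1) \<cdot>\<^sub>m B)) l) e' = psgn e' \<cdot>\<^sub>m pexp d l e'" for e'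
    using Cons by auto
  show ?case
    unfolding x list.map prod.case pexp.simps IH
    by (intro eq_matI) (simp_all add: mat_arith C p algebra_simps del: index_mult_mat(1))
qed

section \<open>Recursion in the number of generators\<close>

definition wterm :: "nat \<Rightarrow> (nat \<Rightarrow> complex) \<Rightarrow> (nat \<Rightarrow> complex mat) \<Rightarrow> nat \<Rightarrow> nat set \<Rightarrow> bool \<Rightarrow> complex mat" where
  "wterm d s X k I e = pexp d (map (\<lambda>(j, i). (s i, ((-1) ^ (k - j)) \<cdot>\<^sub>m X i))
                   (zip [1..<k+1] (sorted_list_of_set I))) e"

lemma wact_wterm:
  "wact n d s X k e = mat d d (\<lambda>(r, c). \<Sum>I\<in>{I. I \<subseteq> {..<n} \<and> card I = k}. wterm d s X k I e $$ (r, c))"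
  by (simp add: wact_def wterm_def)

lemma wact_carrier [simp]: "wact n d s X k e \<in> carrier_mat d d"
  by (simp add: wact_def)

lemma sorted_list_of_set_insert_upper:
  assumes "I \<subseteq> {..<n :: nat}"
  shows "sorted_list_of_set (insert n I) = sorted_list_of_set I @ [n]"
proof -
  have fin: "finite I" using assms finite_subset by blast
  have "I - {n} = I" using assms by auto
  moreover have "\<forall>x\<in>set (sorted_list_of_set I). x \<le> n" using assms fin by auto
  ultimately show ?thesis using fin by (simp add: sorted_insort_is_snoc)
qed

lemma wterm_list_carrier:
  assumes "\<forall>i\<in>I. X i \<in> carrier_mat d d" "finite I"
    "(a, B) \<in> set (map (\<lambda>(j, i). (s i, (f j) \<cdot>\<^sub>m X i)) (zip js (sorted_list_of_set I)))"
  shows "B \<in> carrier_mat d d"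
proof -
  obtain j i where ji: "(j, i) \<in> set (zip js (sorted_list_of_set I))" "B = f j \<cdot>\<^sub>m X i"
    using assms(3) by auto
  have "i \<in> I" using set_zip_rightD[OF ji(1)] assms(2) by simp
  then show ?thesis using assms(1) ji(2) by simp
qed

lemma wterm_carrier:
  assumes "\<forall>i\<in>I. X i \<in> carrier_mat d d" "finite I"
  shows "wterm d s X k I e \<in> carrier_mat d d"
  unfolding wterm_def
proof (rule pexp_carrier)
  fix a B
  assume "(a, B) \<in> set (map (\<lambda>(j, i). (s i, ((-1) ^ (k - j)) \<cdot>\<^sub>m X i)) (zip [1..<k+1] (sorted_list_of_set I)))"
  then show "B \<in> carrier_mat d d" by (rule wterm_list_carrier[OF assms])
qed

text \<open>The new factor stands at position \<open>k + 1\<close> and has sign +1, while every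
  earlier exponent \<open>k - j\<close> grows by one. So all earlier odd factors are negated, which
  costs \<open>psgn\<close> of the parity of the earlier part.\<close>

lemma wterm_insert:
  assumes X: "\<And>i. i < Suc n \<Longrightarrow> X i \<in> carrier_mat d d" and I: "I \<subseteq> {..<n}" "card I = k"
  shows "wterm d s X (Suc k) (insert n I) e =
     (psgn e * s n) \<cdot>\<^sub>m wterm d s X k I e + psgn (\<not> e) \<cdot>\<^sub>m (wterm d s X k I (\<not> e) * X n)"
proof -
  have fin: "finite I" using I finite_subset by blast
  let ?l = "\<lambda>k. map (\<lambda>(j, i). (s i, ((-1) ^ (k - j)) \<cdot>\<^sub>m X i)) (zip [1..<k+1] (sorted_list_of_set I))"
  let ?l' = "map (\<lambda>(j, i). (s i, ((-1) ^ (Suc k - j)) \<cdot>\<^sub>m X i)) (zip [1..<k+1] (sorted_list_of_set I))"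
  have XI: "\<forall>i\<in>I. X i \<in> carrier_mat d d" using X I by auto
  have len: "length (sorted_list_of_set I) = k" using fin I by simp
  have "zip [1..<Suc k + 1] (sorted_list_of_set (insert n I)) =
      zip [1..<k+1] (sorted_list_of_set I) @ [(Suc k, n)]"
    unfolding sorted_list_of_set_insert_upper[OF I(1)] using len by (simp add: zip_append1)
  then have "wterm d s X (Suc k) (insert n I) e = pexp d (?l' @ [(s n, X n)]) e"
    unfolding wterm_def by (simp add: mat_arith)
  also have "\<dots> = s n \<cdot>\<^sub>m pexp d ?l' e + pexp d ?l' (\<not> e) * X n"
  proof (rule pexp_snoc)
    show "B \<in> carrier_mat d d" if "(a, B) \<in> set ?l'" for a B using wterm_list_carrier[OF XI fin that] .
    show "X n \<in> carrier_mat d d" using X by simp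
  qed
  finally have eq0: "wterm d s X (Suc k) (insert n I) e = s n \<cdot>\<^sub>m pexp d ?l' e + pexp d ?l' (\<not> e) * X n" .
  \<comment> \<open>The truncated subtraction does no harm: the earlier positions satisfy
    \<open>j \<le> k\<close>, hence \<open>Suc k - j = Suc (k - j)\<close>.\<close>
  have "?l' = map (\<lambda>(a, B). (a, (-1) \<cdot>\<^sub>m B)) (?l k)"
    by (auto simp: mat_arith Suc_diff_le dest!: set_zip_leftD)
  moreover have "pexp d (map (\<lambda>(a, B). (a, (-1) \<cdot>\<^sub>m B)) (?l k)) e' = psgn e' \<cdot>\<^sub>m pexp d (?l k) e'" for e'
    by (rule pexp_neg) (rule wterm_list_carrier[OF XI fin])
  ultimately have l': "pexp d ?l' e' = psgn e' \<cdot>\<^sub>m wterm d s X k I e'" for e'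
    by (simp only: wterm_def)
  note eq = eq0[unfolded l']
  have "wterm d s X k I e' \<in> carrier_mat d d" for e' using wterm_carrier[OF XI fin] .
  then have "dim_col (wterm d s X k I e') = d" for e' by auto
  moreover have "dim_row (X n) = d" using X[of n] by simp
  ultimately show ?thesis unfolding eq by (simp add: mat_arith mult.commute)
qed

text \<open>The element u_0 = 1 is not one of the generators, but the recursion for u_1 descends to
  it.\<close>

lemma wact_0: "wact n d s X 0 e = (if e then 0\<^sub>m d d else 1\<^sub>m d)"
proof -
  have "{I. I \<subseteq> {..<n} \<and> card I = 0} = {{}}" using finite_subset by fastforce
  then have "wact n d s X 0 e = mat d d (\<lambda>(r, c). pexp d [] e $$ (r, c))"
    unfolding wact_def by simp
  also have "\<dots> = pexp d [] e" by (cases e) (auto intro!: eq_matI)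
  finally show ?thesis by simp
qed

lemma wact_empty: "wact 0 d s X (Suc k) e = 0\<^sub>m d d"
proof -
  have "{I. I \<subseteq> {..<0::nat} \<and> card I = Suc k} = {}" by auto
  then show ?thesis unfolding wact_def by (intro eq_matI) simp_all
qed

text \<open>The subsets of size \<open>k + 1\<close> are sorted by whether they contain the largest
  index \<open>n\<close>; those that do contribute through \<open>wterm_insert\<close>.\<close>

lemma wact_Suc:
  assumes X: "\<And>i. i < Suc n \<Longrightarrow> X i \<in> carrier_mat d d"
  shows "wact (Suc n) d s X (Suc k) e =
     wact n d s X (Suc k) e + (psgn e * s n) \<cdot>\<^sub>m wact n d s X k e
       + psgn (\<not> e) \<cdot>\<^sub>m (wact n d s X k (\<not> e) * X n)"
proof -
  let ?S = "\<lambda>(n::nat) k. {I. I \<subseteq> {..<n} \<and> card I = k}"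
  have fin: "finite (?S n k)" for n k by (rule finite_subset[of _ "Pow {..<n}"]) auto
  have finI: "finite I" if "I \<subseteq> {..<n}" for I using that finite_subset by blast
  have split: "?S (Suc n) (Suc k) = ?S n (Suc k) \<union> insert n ` ?S n k"
  proof (rule equalityI; rule subsetI)
    fix I assume I: "I \<in> ?S (Suc n) (Suc k)"
    show "I \<in> ?S n (Suc k) \<union> insert n ` ?S n k"
    proof (cases "n \<in> I")
      case True
      then have "I = insert n (I - {n})" "I - {n} \<in> ?S n k"
        using I by (auto simp: less_Suc_eq)
      then show ?thesis by blast
    next
      case False
      then have "I \<subseteq> {..<n}" using I less_Suc_eq by auto
      then show ?thesis using I by auto
    qed
  next
    fix I assume "I \<in> ?S n (Suc k) \<union> insert n ` ?S n k"
    then show "I \<in> ?S (Suc n) (Suc k)"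
    proof
      assume "I \<in> insert n ` ?S n k"
      then obtain J where J: "J \<subseteq> {..<n}" "card J = k" "I = insert n J" by auto
      then have "n \<notin> J" by auto
      then show ?thesis using J finI[OF J(1)] by (auto simp: less_Suc_eq)
    qed (auto simp: less_Suc_eq)
  qed
  have inj: "inj_on (insert n) (?S n k)"
    by (rule inj_onI) (metis (mono_tags, lifting) Diff_insert_absorb lessThan_iff less_irrefl mem_Collect_eq subsetD)
  have disj: "?S n (Suc k) \<inter> insert n ` ?S n k = {}" by auto
  have wc: "wterm d s X k I e' \<in> carrier_mat d d" if "I \<in> ?S n k" for I e'
    using that by (intro wterm_carrier) (auto intro!: X finI simp: subset_iff less_SucI)
  have Xn: "X n \<in> carrier_mat d d" using X by simp
  have entry: "wact n d s X k e $$ (r, c) = (\<Sum>I\<in>?S n k. wterm d s X k I e $$ (r, c))"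
    if "r < d" "c < d" for n k e r c
    using that by (simp add: wact_wterm)
  show ?thesis
  proof (rule eq_matI)
    fix r c assume "r < dim_row (wact n d s X (Suc k) e + (psgn e * s n) \<cdot>\<^sub>m wact n d s X k e
       + psgn (\<not> e) \<cdot>\<^sub>m (wact n d s X k (\<not> e) * X n))" "c < dim_col (wact n d s X (Suc k) e + (psgn e * s n) \<cdot>\<^sub>m wact n d s X k e
       + psgn (\<not> e) \<cdot>\<^sub>m (wact n d s X k (\<not> e) * X n))"
    then have r: "r < d" and c: "c < d" using Xn by (auto simp: wact_def)
    have prod: "(M * X n) $$ (r, c) = (\<Sum>l = 0..<d. M $$ (r, l) * X n $$ (l, c))"
      if "M \<in> carrier_mat d d" for M
      using that r c Xn by (auto simp: scalar_prod_def)
    \<comment> \<open>\<open>wact\<close> sums matrix entries, so right multiplication by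
      \<open>X n\<close> is pulled out of the sum over subsets by exchanging two finite
      sums.\<close>
    have "(\<Sum>I\<in>?S n k. (wterm d s X k I (\<not> e) * X n) $$ (r, c)) =
        (\<Sum>I\<in>?S n k. \<Sum>l = 0..<d. wterm d s X k I (\<not> e) $$ (r, l) * X n $$ (l, c))"
      using wc by (intro sum.cong prod) auto
    also have "\<dots> = (\<Sum>l = 0..<d. \<Sum>I\<in>?S n k. wterm d s X k I (\<not> e) $$ (r, l) * X n $$ (l, c))"
      by (rule sum.swap)
    also have "\<dots> = (\<Sum>l = 0..<d. wact n d s X k (\<not> e) $$ (r, l) * X n $$ (l, c))"
      using r by (intro sum.cong) (auto simp: entry sum_distrib_right)
    also have "\<dots> = (wact n d s X k (\<not> e) * X n) $$ (r, c)"
      by (rule prod[symmetric]) simp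
    finally have last: "(\<Sum>I\<in>?S n k. (wterm d s X k I (\<not> e) * X n) $$ (r, c)) =
      (wact n d s X k (\<not> e) * X n) $$ (r, c)" .
    have "wact (Suc n) d s X (Suc k) e $$ (r, c) =
        (\<Sum>I\<in>?S n (Suc k) \<union> insert n ` ?S n k. wterm d s X (Suc k) I e $$ (r, c))"
      unfolding entry[OF r c] split ..
    also have "\<dots> = (\<Sum>I\<in>?S n (Suc k). wterm d s X (Suc k) I e $$ (r, c)) +
        (\<Sum>I\<in>insert n ` ?S n k. wterm d s X (Suc k) I e $$ (r, c))"
      by (rule sum.union_disjoint) (use fin disj in auto)
    also have "(\<Sum>I\<in>insert n ` ?S n k. wterm d s X (Suc k) I e $$ (r, c)) =
        (\<Sum>I\<in>?S n k. wterm d s X (Suc k) (insert n I) e $$ (r, c))"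
      using inj by (simp add: sum.reindex)
    also have "\<dots> = (\<Sum>I\<in>?S n k. psgn e * s n * wterm d s X k I e $$ (r, c)
        + psgn (\<not> e) * (wterm d s X k I (\<not> e) * X n) $$ (r, c))"
    proof (rule sum.cong[OF refl])
      fix I assume I: "I \<in> ?S n k"
      have w: "wterm d s X (Suc k) (insert n I) e =
        (psgn e * s n) \<cdot>\<^sub>m wterm d s X k I e + psgn (\<not> e) \<cdot>\<^sub>m (wterm d s X k I (\<not> e) * X n)"
        using I by (intro wterm_insert X) auto
      show "wterm d s X (Suc k) (insert n I) e $$ (r, c) = psgn e * s n * wterm d s X k I e $$ (r, c)
        + psgn (\<not> e) * (wterm d s X k I (\<not> e) * X n) $$ (r, c)"
        unfolding w using wc[OF I, of e] wc[OF I, of "\<not> e"] Xn r c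
        by (simp del: index_mult_mat(1))
    qed
    also have "\<dots> = psgn e * s n * wact n d s X k e $$ (r, c)
        + psgn (\<not> e) * (wact n d s X k (\<not> e) * X n) $$ (r, c)"
      unfolding sum.distrib sum_distrib_left[symmetric] last entry[OF r c] ..
    finally show "wact (Suc n) d s X (Suc k) e $$ (r, c) = (wact n d s X (Suc k) e + (psgn e * s n) \<cdot>\<^sub>m wact n d s X k e
       + psgn (\<not> e) \<cdot>\<^sub>m (wact n d s X k (\<not> e) * X n)) $$ (r, c)"
      using r c Xn carrier_matD[OF wact_carrier[of n d s X k e]] carrier_matD[OF wact_carrier[of n d s X k "\<not> e"]]
        carrier_matD[OF wact_carrier[of n d s X "Suc k" e]]
      by (simp add: entry[OF r c] del: index_mult_mat(1))
  qed (use Xn in \<open>auto simp: wact_def\<close>)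
qed

section \<open>Maps commuting with the W-algebra\<close>

lemma dim_wact [simp]: "dim_row (wact n d s X k e) = d" "dim_col (wact n d s X k e) = d"
  by (simp_all add: wact_def)

text \<open>How the first \<open>p\<close> generators came to be intertwined does not matter: the
  recursion uses only their elements u_k(e), for all \<open>k\<close> and \<open>e\<close>, and then
  each further generator by itself. The case \<open>p = 0\<close> starts from nothing.\<close>

lemma wact_intertwine_ext:
  assumes F: "F \<in> carrier_mat d' d" and "p \<le> n"
    and X: "\<And>i. i < n \<Longrightarrow> X i \<in> carrier_mat d d" and X': "\<And>i. i < n \<Longrightarrow> X' i \<in> carrier_mat d' d'"
    and base: "\<And>k e. F * wact p d s X k e = wact p d' s' X' k e * F"
    and int: "\<And>i. p \<le> i \<Longrightarrow> i < n \<Longrightarrow> s i = s' i \<and> F * X i = X' i * F"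
  shows "F * wact n d s X k e = wact n d' s' X' k e * F"
  using assms(2) X X' int
proof (induction n arbitrary: k e rule: dec_induct)
  case base
  then show ?case using assms(5) by simp
next
  case (step n)
  have Fd: "dim_row F = d'" "dim_col F = d" using F by auto
  have Xd: "dim_row (X n) = d" "dim_col (X n) = d" "dim_row (X' n) = d'" "dim_col (X' n) = d'"
    using step.prems(1)[of n] step.prems(2)[of n] by auto
  have IH: "F * wact n d s X k e = wact n d' s' X' k e * F" for k e
    using step.IH step.prems by simp
  have sn: "s n = s' n" "F * X n = X' n * F" using step by auto
  show ?case
  proof (cases k)
    case 0
    then show ?thesis using Fd by (simp add: wact_0)
  next
    case (Suc k')
    have "F * (wact n d s X k e * X n) = wact n d' s' X' k e * (X' n * F)" for k e
    proof -
      have "F * (wact n d s X k e * X n) = F * wact n d s X k e * X n"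
        using Fd Xd by (simp add: mat_arith)
      also have "\<dots> = wact n d' s' X' k e * (F * X n)"
        unfolding IH using Fd Xd by (simp add: mat_arith)
      finally show ?thesis using sn by simp
    qed
    moreover have "wact (Suc n) d s X (Suc k') e = wact n d s X (Suc k') e
        + (psgn e * s n) \<cdot>\<^sub>m wact n d s X k' e + psgn (\<not> e) \<cdot>\<^sub>m (wact n d s X k' (\<not> e) * X n)"
      using step.prems(1) by (intro wact_Suc) auto
    moreover have "wact (Suc n) d' s' X' (Suc k') e = wact n d' s' X' (Suc k') e
        + (psgn e * s' n) \<cdot>\<^sub>m wact n d' s' X' k' e + psgn (\<not> e) \<cdot>\<^sub>m (wact n d' s' X' k' (\<not> e) * X' n)"
      using step.prems(2) by (intro wact_Suc) auto
    ultimately show ?thesis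
      using Suc Fd Xd IH sn by (simp add: mat_arith)
  qed
qed

text \<open>The recursion applied twice, sorted by how many indices of the pair are used. One index
  contributes x_m + x_{m+1} and xi_m + xi_{m+1}. Two contribute the parts x_m x_{m+1} - xi_m
  xi_{m+1} and x_m xi_{m+1} - x_{m+1} xi_m of (x_m - xi_m)(x_{m+1} + xi_{m+1}), without a sign
  because the lower factors are negated twice. For k = 1 the two-index terms are absent.\<close>

lemma wact_pair:
  assumes X: "\<forall>i<Suc (Suc m). X i \<in> carrier_mat d d"
  shows "wact (Suc (Suc m)) d s X (Suc (Suc k)) e =
      wact m d s X (Suc (Suc k)) e + (psgn e * (s m + s (Suc m))) \<cdot>\<^sub>m wact m d s X (Suc k) e
      + psgn (\<not> e) \<cdot>\<^sub>m (wact m d s X (Suc k) (\<not> e) * (X m + X (Suc m)))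
      + ((s m * s (Suc m)) \<cdot>\<^sub>m wact m d s X k e - wact m d s X k e * (X m * X (Suc m)))
      + wact m d s X k (\<not> e) * (s m \<cdot>\<^sub>m X (Suc m) - s (Suc m) \<cdot>\<^sub>m X m)"
    "wact (Suc (Suc m)) d s X (Suc 0) e =
      wact m d s X (Suc 0) e + (psgn e * (s m + s (Suc m))) \<cdot>\<^sub>m wact m d s X 0 e
      + psgn (\<not> e) \<cdot>\<^sub>m (wact m d s X 0 (\<not> e) * (X m + X (Suc m)))"
proof -
  have Xd: "dim_row (X m) = d" "dim_col (X m) = d" "dim_row (X (Suc m)) = d" "dim_col (X (Suc m)) = d"
    using X[rule_format, of m] X[rule_format, of "Suc m"] by auto
  have 1: "wact (Suc (Suc m)) d s X (Suc k) e =
     wact (Suc m) d s X (Suc k) e + (psgn e * s (Suc m)) \<cdot>\<^sub>m wact (Suc m) d s X k e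
       + psgn (\<not> e) \<cdot>\<^sub>m (wact (Suc m) d s X k (\<not> e) * X (Suc m))" for k e
    using X by (intro wact_Suc) auto
  have 2: "wact (Suc m) d s X (Suc k) e =
     wact m d s X (Suc k) e + (psgn e * s m) \<cdot>\<^sub>m wact m d s X k e
       + psgn (\<not> e) \<cdot>\<^sub>m (wact m d s X k (\<not> e) * X m)" for k e
    using X by (intro wact_Suc) auto
  show "wact (Suc (Suc m)) d s X (Suc (Suc k)) e =
      wact m d s X (Suc (Suc k)) e + (psgn e * (s m + s (Suc m))) \<cdot>\<^sub>m wact m d s X (Suc k) e
      + psgn (\<not> e) \<cdot>\<^sub>m (wact m d s X (Suc k) (\<not> e) * (X m + X (Suc m)))
      + ((s m * s (Suc m)) \<cdot>\<^sub>m wact m d s X k e - wact m d s X k e * (X m * X (Suc m)))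
      + wact m d s X k (\<not> e) * (s m \<cdot>\<^sub>m X (Suc m) - s (Suc m) \<cdot>\<^sub>m X m)"
    unfolding 1 2
    by (cases e) (intro eq_matI;
      simp add: mat_arith Xd psgn_def algebra_simps del: index_mult_mat(1))+
  have 0: "wact (Suc m) d s X 0 e = wact m d s X 0 e" for e by (simp add: wact_0)
  show "wact (Suc (Suc m)) d s X (Suc 0) e =
      wact m d s X (Suc 0) e + (psgn e * (s m + s (Suc m))) \<cdot>\<^sub>m wact m d s X 0 e
      + psgn (\<not> e) \<cdot>\<^sub>m (wact m d s X 0 (\<not> e) * (X m + X (Suc m)))"
    unfolding 1 2 0
    by (intro eq_matI; simp add: mat_arith Xd algebra_simps del: index_mult_mat(1))
qed

text \<open>Outside the pair the operators enter individually; the pair itself enters only through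
  the generators of the W-algebra of rank two.\<close>

lemma wact_intertwine:
  assumes F: "F \<in> carrier_mat d' d" and m: "Suc m < n"
    and X: "\<And>i. i < n \<Longrightarrow> X i \<in> carrier_mat d d" and X': "\<And>i. i < n \<Longrightarrow> X' i \<in> carrier_mat d' d'"
    and int: "\<And>i. i < n \<Longrightarrow> i \<noteq> m \<Longrightarrow> i \<noteq> Suc m \<Longrightarrow> s i = s' i \<and> F * X i = X' i * F"
    and s1: "s m + s (Suc m) = s' m + s' (Suc m)" and s2: "s m * s (Suc m) = s' m * s' (Suc m)"
    and u1: "F * (X m + X (Suc m)) = (X' m + X' (Suc m)) * F"
    and u20: "F * (X m * X (Suc m)) = (X' m * X' (Suc m)) * F"
    and u21: "F * (s m \<cdot>\<^sub>m X (Suc m) - s (Suc m) \<cdot>\<^sub>m X m) = (s' m \<cdot>\<^sub>m X' (Suc m) - s' (Suc m) \<cdot>\<^sub>m X' m) * F"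
  shows "F * wact n d s X k e = wact n d' s' X' k e * F"
proof -
  have Fd: "dim_row F = d'" "dim_col F = d" using F by auto
  have Xd: "dim_row (X i) = d" "dim_col (X i) = d" "dim_row (X' i) = d'" "dim_col (X' i) = d'"
    if "i < n" for i
    using X[OF that] X'[OF that] by auto
  have mn: "m < n" using m by simp
  note dims = Fd Xd[OF m] Xd[OF mn]
  have low: "F * wact m d s X k e = wact m d' s' X' k e * F" for k e
  proof (rule wact_intertwine_ext[OF F, where p = 0])
    show "F * wact 0 d s X k e = wact 0 d' s' X' k e * F" for k e
      using Fd by (cases k) (simp_all add: wact_0 wact_empty)
  qed (use X X' int m in auto)
  have move: "F * (wact m d s X k e * Z) = wact m d' s' X' k e * (Z' * F)"
    if "F * Z = Z' * F" "Z \<in> carrier_mat d d" "Z' \<in> carrier_mat d' d'" for k e Z Z'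
  proof -
    have Z: "dim_row Z = d" "dim_col Z = d" "dim_row Z' = d'" "dim_col Z' = d'" using that by auto
    have "F * (wact m d s X k e * Z) = F * wact m d s X k e * Z"
      using Fd Z by (simp add: mat_arith)
    also have "\<dots> = wact m d' s' X' k e * (F * Z)"
      unfolding low using Fd Z by (simp add: mat_arith)
    finally show ?thesis using that by simp
  qed
  have c: "X m \<in> carrier_mat d d" "X (Suc m) \<in> carrier_mat d d"
    "X' m \<in> carrier_mat d' d'" "X' (Suc m) \<in> carrier_mat d' d'"
    using X X' m by auto
  have c': "X m + X (Suc m) \<in> carrier_mat d d" "X' m + X' (Suc m) \<in> carrier_mat d' d'"
    "X m * X (Suc m) \<in> carrier_mat d d" "X' m * X' (Suc m) \<in> carrier_mat d' d'"
    "s m \<cdot>\<^sub>m X (Suc m) - s (Suc m) \<cdot>\<^sub>m X m \<in> carrier_mat d d"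
    "s' m \<cdot>\<^sub>m X' (Suc m) - s' (Suc m) \<cdot>\<^sub>m X' m \<in> carrier_mat d' d'"
    using c by (auto intro: mult_carrier_mat)
  note mv = move[OF u1 c'(1,2)] move[OF u20 c'(3,4)] move[OF u21 c'(5,6)]
  \<comment> \<open>Both sides are brought to a common shape in which \<open>F\<close> stands
    directly to the right of a lower \<open>wact\<close> or of a rank-two generator.
    \<open>expand\<close> distributes \<open>F\<close> from the left, \<open>mv\<close> moves it
    through, and \<open>collect\<close> does the same from the right.\<close>
  have expand: "F * (A1 + x \<cdot>\<^sub>m A2 + y \<cdot>\<^sub>m A3 + (z \<cdot>\<^sub>m A4 - A5) + A6) =
      F * A1 + x \<cdot>\<^sub>m (F * A2) + y \<cdot>\<^sub>m (F * A3) + (z \<cdot>\<^sub>m (F * A4) - F * A5) + F * A6"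
    "F * (A1 + x \<cdot>\<^sub>m A2 + y \<cdot>\<^sub>m A3) = F * A1 + x \<cdot>\<^sub>m (F * A2) + y \<cdot>\<^sub>m (F * A3)"
    if "A1 \<in> carrier_mat d d" "A2 \<in> carrier_mat d d" "A3 \<in> carrier_mat d d"
      "A4 \<in> carrier_mat d d" "A5 \<in> carrier_mat d d" "A6 \<in> carrier_mat d d" for A1 A2 A3 A4 A5 A6 x y z
    using that Fd by (auto simp: mat_arith)
  have collect: "(A1 + x \<cdot>\<^sub>m A2 + y \<cdot>\<^sub>m (A3 * Z3) + (z \<cdot>\<^sub>m A4 - A4 * Z5) + A6 * Z6) * F =
      A1 * F + x \<cdot>\<^sub>m (A2 * F) + y \<cdot>\<^sub>m (A3 * (Z3 * F)) + (z \<cdot>\<^sub>m (A4 * F) - A4 * (Z5 * F)) + A6 * (Z6 * F)"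
    "(A1 + x \<cdot>\<^sub>m A2 + y \<cdot>\<^sub>m (A3 * Z3)) * F = A1 * F + x \<cdot>\<^sub>m (A2 * F) + y \<cdot>\<^sub>m (A3 * (Z3 * F))"
    if "A1 \<in> carrier_mat d' d'" "A2 \<in> carrier_mat d' d'" "A3 \<in> carrier_mat d' d'"
      "A4 \<in> carrier_mat d' d'" "A6 \<in> carrier_mat d' d'" "Z3 \<in> carrier_mat d' d'"
      "Z5 \<in> carrier_mat d' d'" "Z6 \<in> carrier_mat d' d'" for A1 A2 A3 A4 A6 Z3 Z5 Z6 x y z
    using that Fd by (auto simp: mat_arith)
  have X2: "\<forall>i<Suc (Suc m). X i \<in> carrier_mat d d"
    and X2': "\<forall>i<Suc (Suc m). X' i \<in> carrier_mat d' d'"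
    using X X' m by auto
  have cw: "A * Z \<in> carrier_mat q q" if "A \<in> carrier_mat q q" "Z \<in> carrier_mat q q"
    for A Z :: "complex mat" and q using that by simp
  have mid: "F * wact (Suc (Suc m)) d s X k e = wact (Suc (Suc m)) d' s' X' k e * F" for k e
  proof (cases k)
    case 0
    then show ?thesis using Fd by (simp add: wact_0)
  next
    case (Suc k1)
    show ?thesis
    proof (cases k1)
      case 0
      show ?thesis
        unfolding Suc 0 wact_pair(2)[OF X2] wact_pair(2)[OF X2']
        by (subst expand(2), (rule wact_carrier cw c')+, subst collect(2), (rule wact_carrier c')+)
          (simp only: mv low s1)
    next
      case (Suc k2)
      show ?thesis
        unfolding \<open>k = Suc k1\<close> Suc wact_pair(1)[OF X2] wact_pair(1)[OF X2']
        by (subst expand(1), (rule wact_carrier cw c')+, subst collect(1), (rule wact_carrier c')+)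
          (simp only: mv low s1 s2)
    qed
  qed
  show ?thesis
    by (rule wact_intertwine_ext[OF F _ X X' mid]) (use m int in auto)
qed

section \<open>Exchanging neighbouring parameters\<close>

text \<open>The relations are oriented as rewrite rules with an explicit scalar -1, the form in
  which the rules \<open>mat_arith\<close> collect signs.\<close>

lemma hmodD:
  assumes "hmod n s d P X"
  shows "P \<in> carrier_mat d d" "P * P = 1\<^sub>m d"
    "i < n \<Longrightarrow> X i \<in> carrier_mat d d" "i < n \<Longrightarrow> X i * P = (-1) \<cdot>\<^sub>m (P * X i)"
    "i < n \<Longrightarrow> X i * X i = s i \<cdot>\<^sub>m 1\<^sub>m d"
    "i < n \<Longrightarrow> j < n \<Longrightarrow> i \<noteq> j \<Longrightarrow> X i * X j = (-1) \<cdot>\<^sub>m (X j * X i)"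
proof -
  have um: "- A = (-1) \<cdot>\<^sub>m A" for A :: "complex mat" by (rule eq_matI) auto
  show "P \<in> carrier_mat d d" "P * P = 1\<^sub>m d"
    "i < n \<Longrightarrow> X i \<in> carrier_mat d d" "i < n \<Longrightarrow> X i * X i = s i \<cdot>\<^sub>m 1\<^sub>m d"
    using assms by (auto simp: hmod_def)
  show "i < n \<Longrightarrow> X i * P = (-1) \<cdot>\<^sub>m (P * X i)"
    using assms um unfolding hmod_def by metis
  assume ij: "i < n" "j < n" "i \<noteq> j"
  then have eq: "X i * X j + X j * X i = 0\<^sub>m d d" using assms by (auto simp: hmod_def)
  have c: "X i \<in> carrier_mat d d" "X j \<in> carrier_mat d d" using assms ij by (auto simp: hmod_def)
  show "X i * X j = (-1) \<cdot>\<^sub>m (X j * X i)"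
  proof (rule eq_matI)
    fix r c' assume "r < dim_row ((-1) \<cdot>\<^sub>m (X j * X i))" "c' < dim_col ((-1) \<cdot>\<^sub>m (X j * X i))"
    then have rc: "r < d" "c' < d" using c by auto
    have "(X i * X j + X j * X i) $$ (r, c') = 0" using eq rc by simp
    then show "(X i * X j) $$ (r, c') = ((-1) \<cdot>\<^sub>m (X j * X i)) $$ (r, c')"
      using c rc by (simp add: eq_neg_iff_add_eq_0 del: index_mult_mat(1))
  qed (use c in auto)
qed

lemma hmodI:
  assumes "P \<in> carrier_mat d d" "P * P = 1\<^sub>m d"
    and X: "\<And>i. i < n \<Longrightarrow> X i \<in> carrier_mat d d" and XP: "\<And>i. i < n \<Longrightarrow> X i * P = (-1) \<cdot>\<^sub>m (P * X i)"
    and "\<And>i. i < n \<Longrightarrow> X i * X i = s i \<cdot>\<^sub>m 1\<^sub>m d"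
    and anti: "\<And>i j. i < n \<Longrightarrow> j < n \<Longrightarrow> i < j \<Longrightarrow> X i * X j = (-1) \<cdot>\<^sub>m (X j * X i)"
  shows "hmod n s d P X"
proof -
  have um: "(-1) \<cdot>\<^sub>m A = - A" for A :: "complex mat" by (rule eq_matI) auto
  have "X i * X j + X j * X i = 0\<^sub>m d d" if ij: "i < n" "j < n" "i \<noteq> j" for i j
  proof -
    note c = X[OF ij(1)] X[OF ij(2)]
    have "X i * X j = (-1) \<cdot>\<^sub>m (X j * X i) \<or> X j * X i = (-1) \<cdot>\<^sub>m (X i * X j)"
      using anti ij by (cases "i < j") auto
    then show ?thesis
      using c by (auto intro!: eq_matI simp del: index_mult_mat(1))
  qed
  then show ?thesis using assms um unfolding hmod_def by metis
qed

lemma simple_hmodD: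
  assumes "simple_hmod n s d P X"
  shows "hmod n s d P X" "d > 0"
    "inv_gsubspace d P (X ` {..<n}) S \<Longrightarrow> S = {0\<^sub>v d} \<or> S = carrier_vec d"
  using assms by (auto simp: simple_hmod_def)

lemma inv_gsubspace_linsub:
  "inv_gsubspace d P Ops S \<longleftrightarrow> linsub d S \<and> (\<forall>v\<in>S. P *\<^sub>v v \<in> S) \<and> (\<forall>B\<in>Ops. \<forall>v\<in>S. B *\<^sub>v v \<in> S)"
  unfolding inv_gsubspace_def linsub_def by blast

text \<open>If the old operators can be recovered from the new ones, every new graded submodule is
  an old one, so simplicity is inherited.\<close>

lemma simple_hmod_transfer:
  assumes "simple_hmod n s d P X" "hmod n s' d P' X'"
    and "\<And>S v. linsub d S \<Longrightarrow> (\<And>u. u \<in> S \<Longrightarrow> P' *\<^sub>v u \<in> S) \<Longrightarrow> (\<And>i u. i < n \<Longrightarrow> u \<in> S \<Longrightarrow> X' i *\<^sub>v u \<in> S) \<Longrightarrow>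
        v \<in> S \<Longrightarrow> P *\<^sub>v v \<in> S \<and> (\<forall>i<n. X i *\<^sub>v v \<in> S)"
  shows "simple_hmod n s' d P' X'"
proof -
  have "S = {0\<^sub>v d} \<or> S = carrier_vec d" if S: "inv_gsubspace d P' (X' ` {..<n}) S" for S
  proof (rule simple_hmodD(3)[OF assms(1)])
    have S': "linsub d S" "\<And>u. u \<in> S \<Longrightarrow> P' *\<^sub>v u \<in> S" "\<And>i u. i < n \<Longrightarrow> u \<in> S \<Longrightarrow> X' i *\<^sub>v u \<in> S"
      using S unfolding inv_gsubspace_linsub by auto
    show "inv_gsubspace d P (X ` {..<n}) S"
      unfolding inv_gsubspace_linsub using S'(1) assms(3)[OF S'] by auto
  qed
  then show ?thesis using assms simple_hmodD(2)[OF assms(1)] by (simp add: simple_hmod_def)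
qed

section \<open>Entries with nonzero sum\<close>

lemma smult_mult_mat_vec:
  fixes A :: "complex mat"
  assumes "A \<in> carrier_mat nr nc" "v \<in> carrier_vec nc"
  shows "(k \<cdot>\<^sub>m A) *\<^sub>v v = k \<cdot>\<^sub>v (A *\<^sub>v v)"
  using assms by (intro eq_vecI) auto

text \<open>Multiplication in the Clifford algebra of a plane: the scalar part is the bilinear form
  with diagonal (a, b), and the coefficient of \<open>X * Y\<close> is the determinant of the
  coefficients.\<close>

lemma anticommuting_lincomb_mult:
  fixes X Y :: "complex mat"
  assumes X: "X \<in> carrier_mat d d" and Y: "Y \<in> carrier_mat d d"
    and XX: "X * X = a \<cdot>\<^sub>m 1\<^sub>m d" and YY: "Y * Y = b \<cdot>\<^sub>m 1\<^sub>m d" and YX: "Y * X = (-1) \<cdot>\<^sub>m (X * Y)"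
  shows "(\<alpha> \<cdot>\<^sub>m X + \<beta> \<cdot>\<^sub>m Y) * (\<gamma> \<cdot>\<^sub>m X + \<delta> \<cdot>\<^sub>m Y) =
    (\<alpha> * \<gamma> * a + \<beta> * \<delta> * b) \<cdot>\<^sub>m 1\<^sub>m d + (\<alpha> * \<delta> - \<beta> * \<gamma>) \<cdot>\<^sub>m (X * Y)"
proof -
  have D: "dim_row X = d" "dim_col X = d" "dim_row Y = d" "dim_col Y = d" using X Y by auto
  show ?thesis
    by (intro eq_matI) (simp_all add: mat_arith D XX YY YX algebra_simps del: index_mult_mat(1))
qed

text \<open>The three equations say that the new vectors have exchanged squares and are orthogonal.
  The relations with \<open>P\<close> and with the other generators are linear in the pair and hold
  automatically.\<close>

lemma hmod_lincomb:
  assumes h: "hmod n s d P X" and m: "Suc m < n"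
    and eqs: "\<alpha>\<^sup>2 * s m + \<beta>\<^sup>2 * s (Suc m) = s (Suc m)" "\<gamma>\<^sup>2 * s m + \<delta>\<^sup>2 * s (Suc m) = s m"
      "\<alpha> * \<gamma> * s m + \<beta> * \<delta> * s (Suc m) = 0"
  shows "hmod n (s \<circ> Transposition.transpose m (Suc m)) d P
    (X(m := \<alpha> \<cdot>\<^sub>m X m + \<beta> \<cdot>\<^sub>m X (Suc m), Suc m := \<gamma> \<cdot>\<^sub>m X m + \<delta> \<cdot>\<^sub>m X (Suc m)))" (is "hmod n ?s d P ?X")
proof (rule hmodI)
  note D = hmodD[OF h]
  have mn: "m < n" using m by simp
  have c: "X m \<in> carrier_mat d d" "X (Suc m) \<in> carrier_mat d d" using D m by auto
  have dm: "dim_row (X i) = d" "dim_col (X i) = d" if "i < n" for i using D(3)[OF that] by auto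
  note dims = dm[OF mn] dm[OF m] carrier_matD[OF D(1)]
  note LC = anticommuting_lincomb_mult[OF c D(5)[OF mn] D(5)[OF m] D(6)[OF m mn]]
  show "P \<in> carrier_mat d d" "P * P = 1\<^sub>m d" by (rule D)+
  show Xc: "?X i \<in> carrier_mat d d" if "i < n" for i using D(3)[OF that] c by auto
  show "?X i * P = (-1) \<cdot>\<^sub>m (P * ?X i)" if "i < n" for i
    using D(4)[OF that] D(4)[OF m] D(4)[OF mn] dims
    by (auto simp: mat_arith mult.commute)
  show "?X i * ?X i = ?s i \<cdot>\<^sub>m 1\<^sub>m d" if "i < n" for i
  proof -
    have z: "c1 \<cdot>\<^sub>m 1\<^sub>m d + 0 \<cdot>\<^sub>m (X m * X (Suc m)) = c1 \<cdot>\<^sub>m 1\<^sub>m d" for c1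
      using dims by (intro eq_matI) (simp_all del: index_mult_mat(1))
    show ?thesis
      using eqs D(5)[OF that] z
      by (auto simp: LC power2_eq_square transpose_def mult.commute)
  qed
  show "?X i * ?X j = (-1) \<cdot>\<^sub>m (?X j * ?X i)" if ij: "i < n" "j < n" "i < j" for i j
  proof (cases "i = m \<and> j = Suc m")
    case True
    have "\<alpha> * \<gamma> * s m + \<beta> * \<delta> * s (Suc m) = 0" "\<gamma> * \<alpha> * s m + \<delta> * \<beta> * s (Suc m) = 0"
      using eqs by (auto simp: mult.commute)
    then show ?thesis
      using True dims by (simp add: LC) (intro eq_matI; simp add: algebra_simps del: index_mult_mat(1))
  next
    case False
    have an: "X k * X l = (-1) \<cdot>\<^sub>m (X l * X k)" if "k < n" "l < n" "k \<noteq> l" for k l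
      using D(6)[OF that] .
    consider "i \<noteq> m" "i \<noteq> Suc m" "j \<noteq> m" "j \<noteq> Suc m" | "i \<noteq> m" "i \<noteq> Suc m" "j = m"
      | "i \<noteq> m" "i \<noteq> Suc m" "j = Suc m" | "i = m" "j \<noteq> m" "j \<noteq> Suc m" | "i = Suc m" "j \<noteq> m" "j \<noteq> Suc m"
      using False ij by (metis less_irrefl less_Suc_eq not_less_eq)
    then show ?thesis
    proof cases
      case 1
      then show ?thesis using an[OF ij(1,2)] ij by simp
    next
      case 2
      then show ?thesis using an[OF ij(1) mn] an[OF ij(1) m] dims dm[OF ij(1)]
        by (simp add: mat_arith mult.commute)
    next
      case 3
      then show ?thesis using an[OF ij(1) mn] an[OF ij(1) m] dims dm[OF ij(1)]
        by (simp add: mat_arith mult.commute)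
    next
      case 4
      then show ?thesis using an[OF mn ij(2)] an[OF m ij(2)] dims dm[OF ij(2)]
        by (simp add: mat_arith mult.commute)
    next
      case 5
      then show ?thesis using an[OF mn ij(2)] an[OF m ij(2)] dims dm[OF ij(2)]
        by (simp add: mat_arith mult.commute)
    qed
  qed
qed

text \<open>If the two entries do not cancel, the reflection below permutes them without changing the
  action of the rank-two generators.\<close>

lemma swap_typical:
  assumes simple: "simple_hmod n s d P X" and m: "Suc m < n" and nz0: "s m + s (Suc m) \<noteq> 0"
  shows "\<exists>X'. simple_hmod n (s \<circ> Transposition.transpose m (Suc m)) d P X' \<and>
    (\<forall>k e. wact n d (s \<circ> Transposition.transpose m (Suc m)) X' k e = wact n d s X k e)"
proof -
  note h = simple_hmodD(1)[OF simple]
  note D = hmodD[OF h]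
  have mn: "m < n" using m by simp
  have c: "X m \<in> carrier_mat d d" "X (Suc m) \<in> carrier_mat d d" using D m by auto
  note dims = carrier_matD[OF c(1)] carrier_matD[OF c(2)]
  define a b where "a = s m" and "b = s (Suc m)"
  define t where "t = inverse (a + b)"
  have t: "t * (a + b) = 1" using nz0 by (simp add: t_def a_def b_def)
  \<comment> \<open>With theta = xi_m + xi_{m+1}, the reflection fixing theta sends xi_{m+1} to (2b
    / (a+b)) theta - xi_{m+1} and xi_m to (2a / (a+b)) theta - xi_m. Their coordinates are
    (\<alpha>, \<beta>) and (\<gamma>, \<delta>); the images are listed in exchanged order, which
    turns determinant -1 into 1.\<close>
  define \<alpha> \<beta> \<gamma> \<delta> where "\<alpha> = 2 * b * t" and "\<beta> = (b - a) * t"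
    and "\<gamma> = (a - b) * t" and "\<delta> = 2 * a * t"
  \<comment> \<open>Each identity holds as a polynomial identity in a, b, t as long as
    \<open>t * (a + b)\<close> is kept as a factor; only afterwards is it replaced by 1.\<close>
  have e1: "\<alpha>\<^sup>2 * a + \<beta>\<^sup>2 * b = b" and e2: "\<gamma>\<^sup>2 * a + \<delta>\<^sup>2 * b = a"
    and e3: "\<alpha> * \<gamma> * a + \<beta> * \<delta> * b = 0" and det: "\<alpha> * \<delta> - \<beta> * \<gamma> = 1"
    and f1: "\<alpha> + \<gamma> = 1" and f2: "\<beta> + \<delta> = 1" and g1: "b * \<gamma> - a * \<alpha> = - b" and g2: "b * \<delta> - a * \<beta> = a"
  proof -
    have "\<alpha>\<^sup>2 * a + \<beta>\<^sup>2 * b = b * (t * (a + b))\<^sup>2" "\<gamma>\<^sup>2 * a + \<delta>\<^sup>2 * b = a * (t * (a + b))\<^sup>2"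
      "\<alpha> * \<delta> - \<beta> * \<gamma> = (t * (a + b))\<^sup>2" "\<alpha> + \<gamma> = t * (a + b)" "\<beta> + \<delta> = t * (a + b)"
      "b * \<gamma> - a * \<alpha> = - b * (t * (a + b))" "b * \<delta> - a * \<beta> = a * (t * (a + b))"
      "\<alpha> * \<gamma> * a + \<beta> * \<delta> * b = 0"
      unfolding \<alpha>_def \<beta>_def \<gamma>_def \<delta>_def power2_eq_square by (simp_all add: algebra_simps)
    then show "\<alpha>\<^sup>2 * a + \<beta>\<^sup>2 * b = b" "\<gamma>\<^sup>2 * a + \<delta>\<^sup>2 * b = a"
      "\<alpha> * \<gamma> * a + \<beta> * \<delta> * b = 0" "\<alpha> * \<delta> - \<beta> * \<gamma> = 1"
      "\<alpha> + \<gamma> = 1" "\<beta> + \<delta> = 1" "b * \<gamma> - a * \<alpha> = - b" "b * \<delta> - a * \<beta> = a"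
      by (simp_all add: t)
  qed
  define X' where "X' = X(m := \<alpha> \<cdot>\<^sub>m X m + \<beta> \<cdot>\<^sub>m X (Suc m), Suc m := \<gamma> \<cdot>\<^sub>m X m + \<delta> \<cdot>\<^sub>m X (Suc m))"
  let ?s = "s \<circ> Transposition.transpose m (Suc m)"
  have h': "hmod n ?s d P X'"
    unfolding X'_def by (rule hmod_lincomb[OF h m]) (use e1 e2 e3 in \<open>auto simp: a_def b_def\<close>)
  have Xm: "X' m = \<alpha> \<cdot>\<^sub>m X m + \<beta> \<cdot>\<^sub>m X (Suc m)" "X' (Suc m) = \<gamma> \<cdot>\<^sub>m X m + \<delta> \<cdot>\<^sub>m X (Suc m)"
    and Xi: "\<And>i. i \<noteq> m \<Longrightarrow> i \<noteq> Suc m \<Longrightarrow> X' i = X i"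
    by (auto simp: X'_def)
  have c': "X' m \<in> carrier_mat d d" "X' (Suc m) \<in> carrier_mat d d" using hmodD[OF h'] m by auto
  \<comment> \<open>The matrix of coefficients has determinant 1, so its inverse is the
    adjugate.\<close>
  have recover: "X m = \<delta> \<cdot>\<^sub>m X' m + (-\<beta>) \<cdot>\<^sub>m X' (Suc m)" "X (Suc m) = (-\<gamma>) \<cdot>\<^sub>m X' m + \<alpha> \<cdot>\<^sub>m X' (Suc m)"
  proof -
    have q1: "\<delta> * \<alpha> - \<beta> * \<gamma> = 1" "\<alpha> * \<delta> - \<gamma> * \<beta> = 1" using det by (auto simp: mult.commute)
    have "\<delta> * (\<alpha> * x + \<beta> * y) - \<beta> * (\<gamma> * x + \<delta> * y) = x" for x y
    proof -
      have "\<delta> * (\<alpha> * x + \<beta> * y) - \<beta> * (\<gamma> * x + \<delta> * y) = (\<delta> * \<alpha> - \<beta> * \<gamma>) * x" by (simp add: algebra_simps)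
      then show ?thesis using q1 by simp
    qed
    then show "X m = \<delta> \<cdot>\<^sub>m X' m + (-\<beta>) \<cdot>\<^sub>m X' (Suc m)"
      unfolding Xm using dims by (intro eq_matI) auto
    have "\<alpha> * (\<gamma> * x + \<delta> * y) - \<gamma> * (\<alpha> * x + \<beta> * y) = y" for x y
    proof -
      have "\<alpha> * (\<gamma> * x + \<delta> * y) - \<gamma> * (\<alpha> * x + \<beta> * y) = (\<alpha> * \<delta> - \<gamma> * \<beta>) * y" by (simp add: algebra_simps)
      then show ?thesis using q1 by simp
    qed
    then show "X (Suc m) = (-\<gamma>) \<cdot>\<^sub>m X' m + \<alpha> \<cdot>\<^sub>m X' (Suc m)"
      unfolding Xm using dims by (intro eq_matI) auto
  qed
  have "simple_hmod n ?s d P X'"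
  proof (rule simple_hmod_transfer[OF simple h'])
    fix S v assume S: "linsub d S" "\<And>u. u \<in> S \<Longrightarrow> P *\<^sub>v u \<in> S" "\<And>i u. i < n \<Longrightarrow> u \<in> S \<Longrightarrow> X' i *\<^sub>v u \<in> S"
      and v: "v \<in> S"
    have vc: "v \<in> carrier_vec d" using v linsubD(1)[OF S(1)] by auto
    have comb: "(x \<cdot>\<^sub>m X' m + y \<cdot>\<^sub>m X' (Suc m)) *\<^sub>v v \<in> S" for x y
    proof -
      have "(x \<cdot>\<^sub>m X' m + y \<cdot>\<^sub>m X' (Suc m)) *\<^sub>v v = x \<cdot>\<^sub>v (X' m *\<^sub>v v) + y \<cdot>\<^sub>v (X' (Suc m) *\<^sub>v v)"
        using c' vc by (simp add: add_mult_distrib_mat_vec[of _ d d] smult_mult_mat_vec)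
      then show ?thesis using S(3)[OF m v] S(3)[OF mn v] linsubD(3,4)[OF S(1)] by simp
    qed
    have "X i *\<^sub>v v \<in> S" if "i < n" for i
    proof (cases "i = m \<or> i = Suc m")
      case True
      then show ?thesis using comb recover by metis
    next
      case False
      then show ?thesis using S(3)[OF that v] Xi by simp
    qed
    then show "P *\<^sub>v v \<in> S \<and> (\<forall>i<n. X i *\<^sub>v v \<in> S)" using S(2) v by simp
  qed
  moreover have "wact n d ?s X' k e = wact n d s X k e" for k e
  proof -
    have "1\<^sub>m d * wact n d s X k e = wact n d ?s X' k e * 1\<^sub>m d"
    proof (rule wact_intertwine[OF _ m])
      show "1\<^sub>m d * (X m + X (Suc m)) = (X' m + X' (Suc m)) * 1\<^sub>m d"
      proof -
        have "(\<alpha> * x + \<beta> * y) + (\<gamma> * x + \<delta> * y) = (\<alpha> + \<gamma>) * x + (\<beta> + \<delta>) * y" for x y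
          by (simp add: algebra_simps)
        then have "X' m + X' (Suc m) = X m + X (Suc m)"
          unfolding Xm using dims by (intro eq_matI) (simp_all add: f1 f2)
        then show ?thesis using dims by simp
      qed
      show "1\<^sub>m d * (X m * X (Suc m)) = (X' m * X' (Suc m)) * 1\<^sub>m d"
      proof -
        \<comment> \<open>Orthogonality removes the scalar part, and determinant 1 preserves the
          product.\<close>
        have "X' m * X' (Suc m) = 0 \<cdot>\<^sub>m 1\<^sub>m d + 1 \<cdot>\<^sub>m (X m * X (Suc m))"
          unfolding Xm anticommuting_lincomb_mult[OF c D(5)[OF mn] D(5)[OF m] D(6)[OF m mn, simplified]]
          using e3 det by (simp add: a_def b_def)
        also have "\<dots> = X m * X (Suc m)"
          using dims by (intro eq_matI) (simp_all del: index_mult_mat(1))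
        finally show ?thesis using dims by simp
      qed
      show "1\<^sub>m d * (s m \<cdot>\<^sub>m X (Suc m) - s (Suc m) \<cdot>\<^sub>m X m) = (?s m \<cdot>\<^sub>m X' (Suc m) - ?s (Suc m) \<cdot>\<^sub>m X' m) * 1\<^sub>m d"
      proof -
        have "b * (\<gamma> * x + \<delta> * y) - a * (\<alpha> * x + \<beta> * y) = (b * \<gamma> - a * \<alpha>) * x + (b * \<delta> - a * \<beta>) * y" for x y
          by (simp add: algebra_simps)
        then have "b \<cdot>\<^sub>m X' (Suc m) - a \<cdot>\<^sub>m X' m = a \<cdot>\<^sub>m X (Suc m) - b \<cdot>\<^sub>m X m"
          unfolding Xm using dims by (intro eq_matI) (simp_all add: g1 g2)
        then show ?thesis using dims by (simp add: a_def b_def)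
      qed
      show "s i = ?s i \<and> 1\<^sub>m d * X i = X' i * 1\<^sub>m d" if "i < n" "i \<noteq> m" "i \<noteq> Suc m" for i
        using D(3)[OF that(1)] Xi[OF that(2,3)] that by (auto simp: transpose_def)
    qed (use D(3) hmodD(3)[OF h'] in auto)
    then show ?thesis by (simp add: mat_arith)
  qed
  ultimately show ?thesis by blast
qed


section \<open>Entries that cancel\<close>

lemma fam_wfam:
  assumes "P \<in> carrier_mat d d"
  shows "fam d (wfam n P (wact n d s X))"
  using assms by (auto simp: fam_def wfam_def split: option.split)

lemma add_mat_commute:
  fixes A B :: "complex mat"
  assumes "A \<in> carrier_mat d d" "B \<in> carrier_mat d d"
  shows "A + B = B + A"
  using assms by (intro eq_matI) auto

text \<open>theta = xi_m + xi_{m+1} is odd, so it anticommutes with \<open>P\<close> and the other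
  xi_i; the signs in \<open>P'\<close> and \<open>X'\<close> compensate this. On the pair, with b =
  -a: theta xi_m xi_{m+1} and xi_{m+1} xi_m theta both equal a theta. The odd generator a xi_{m+1} -
  b xi_m is a multiple of theta, and so is its exchanged version, so both products with theta vanish
  by theta^2 = 0.\<close>

lemma swap_atypical_intertwine:
  assumes h: "hmod n s d P X" and h': "hmod n s' d P' X'" and m: "Suc m < n"
    and s0: "s m + s (Suc m) = 0"
    and s': "s' m = s (Suc m)" "s' (Suc m) = s m" "\<And>i. i \<noteq> m \<Longrightarrow> i \<noteq> Suc m \<Longrightarrow> s' i = s i"
    and X': "X' m = X (Suc m)" "X' (Suc m) = X m"
      "\<And>i. i < n \<Longrightarrow> i \<noteq> m \<Longrightarrow> i \<noteq> Suc m \<Longrightarrow> X' i = (-1) \<cdot>\<^sub>m X i"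
    and P': "P' = (-1) \<cdot>\<^sub>m P"
  shows "(X m + X (Suc m)) * wfam n P (wact n d s X) i = wfam n P' (wact n d s' X') i * (X m + X (Suc m))"
proof -
  note D = hmodD[OF h]
  have mn: "m < n" using m by simp
  let ?X = "X m" and ?Y = "X (Suc m)"
  let ?T = "?X + ?Y"
  have c: "?X \<in> carrier_mat d d" "?Y \<in> carrier_mat d d" using D m by auto
  note dims = carrier_matD[OF c(1)] carrier_matD[OF c(2)] carrier_matD[OF D(1)]
  have YX: "?Y * ?X = (-1) \<cdot>\<^sub>m (?X * ?Y)" using D(6)[OF m mn] by simp
  note XX = D(5)[OF mn] and YY = D(5)[OF m]
  have b: "s (Suc m) = - s m" using s0 by (simp add: eq_neg_iff_add_eq_0 add.commute)
  have TT: "?T * ?T = 0\<^sub>m d d"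
    using dims by (intro eq_matI) (simp_all add: mat_arith XX YY YX b del: index_mult_mat(1))
  have TP: "?T * P = P' * ?T"
    using dims D(4)[OF m] D(4)[OF mn] by (simp add: P' mat_arith)
  have "?T * wact n d s X k e = wact n d s' X' k e * ?T" for k e
  proof (rule wact_intertwine[OF _ m])
    show "?T \<in> carrier_mat d d" using c by simp
    show "X i \<in> carrier_mat d d" "X' i \<in> carrier_mat d d" if "i < n" for i
      using that D(3) hmodD(3)[OF h'] by auto
    show "s i = s' i \<and> ?T * X i = X' i * ?T" if i: "i < n" "i \<noteq> m" "i \<noteq> Suc m" for i
    proof -
      have "dim_row (X i) = d" "dim_col (X i) = d" using D(3)[OF i(1)] by auto
      moreover have "X m * X i = (-1) \<cdot>\<^sub>m (X i * X m)" "X (Suc m) * X i = (-1) \<cdot>\<^sub>m (X i * X (Suc m))"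
        using D(6)[OF mn i(1)] D(6)[OF m i(1)] i by auto
      ultimately show ?thesis using dims i by (simp add: s' X' mat_arith)
    qed
    show "s m + s (Suc m) = s' m + s' (Suc m)" "s m * s (Suc m) = s' m * s' (Suc m)"
      by (simp_all add: s')
    show "?T * ?T = (X' m + X' (Suc m)) * ?T"
      using add_mat_commute[OF c] by (simp add: X')
    show "?T * (?X * ?Y) = X' m * X' (Suc m) * ?T"
    proof -
      have "?X * (?X * ?Y) = s m \<cdot>\<^sub>m ?Y"
        using XX dims mat_arith(1)[of ?X ?X ?Y] by (simp add: mat_arith)
      moreover have "?Y * (?X * ?Y) = (- s (Suc m)) \<cdot>\<^sub>m ?X"
      proof -
        have "?Y * (?X * ?Y) = ?Y * ?X * ?Y" using dims by (simp add: mat_arith(1))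
        also have "\<dots> = (-1) \<cdot>\<^sub>m (?X * (?Y * ?Y))" using dims by (simp add: YX mat_arith)
        also have "\<dots> = (- s (Suc m)) \<cdot>\<^sub>m ?X" using dims by (simp add: YY mat_arith)
        finally show ?thesis .
      qed
      moreover have "?Y * (?X * ?X) = s m \<cdot>\<^sub>m ?Y" using XX dims by (simp add: mat_arith)
      ultimately show ?thesis
        using dims by (simp add: X' mat_arith)
    qed
    show "?T * (s m \<cdot>\<^sub>m ?Y - s (Suc m) \<cdot>\<^sub>m ?X) = (s' m \<cdot>\<^sub>m X' (Suc m) - s' (Suc m) \<cdot>\<^sub>m X' m) * ?T"
    proof -
      have "s m \<cdot>\<^sub>m ?Y - s (Suc m) \<cdot>\<^sub>m ?X = s m \<cdot>\<^sub>m ?T"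
        using dims by (intro eq_matI) (simp_all add: b algebra_simps)
      moreover have "s' m \<cdot>\<^sub>m X' (Suc m) - s' (Suc m) \<cdot>\<^sub>m X' m = (- s m) \<cdot>\<^sub>m ?T"
        using dims by (intro eq_matI) (simp_all add: s' X' b algebra_simps)
      moreover have "?T * (x \<cdot>\<^sub>m ?T) = 0\<^sub>m d d" "(x \<cdot>\<^sub>m ?T) * ?T = 0\<^sub>m d d" for x
        using TT dims mat_arith(6)[of ?T ?T x] mat_arith(7)[of ?T ?T x] by simp_all
      ultimately show ?thesis by simp
    qed
  qed
  then show ?thesis
    using TP all_wfam[where Q = "\<lambda>B C. ?T * B = C * ?T", of n P "wact n d s X" P' "wact n d s' X'"] by blast
qed

lemma swap_atypical:
  assumes simple: "simple_hmod n s d P X" and m: "Suc m < n" and s0: "s m + s (Suc m) = 0"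
    and nz: "s m \<noteq> 0"
  shows "\<exists>P' X'. simple_hmod n (s \<circ> Transposition.transpose m (Suc m)) d P' X' \<and>
    same_factors d (wfam n P (wact n d s X)) d
      (wfam n P' (wact n d (s \<circ> Transposition.transpose m (Suc m)) X'))"
proof -
  note h = simple_hmodD(1)[OF simple]
  note D = hmodD[OF h]
  have mn: "m < n" using m by simp
  let ?X = "X m" and ?Y = "X (Suc m)"
  let ?T = "?X + ?Y"
  have c: "?X \<in> carrier_mat d d" "?Y \<in> carrier_mat d d" using D m by auto
  note dims = carrier_matD[OF c(1)] carrier_matD[OF c(2)] carrier_matD[OF D(1)]
  have YX: "?Y * ?X = (-1) \<cdot>\<^sub>m (?X * ?Y)" using D(6)[OF m mn] by simp
  note XX = D(5)[OF mn] and YY = D(5)[OF m]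
  have b: "s (Suc m) = - s m" using s0 by (simp add: eq_neg_iff_add_eq_0 add.commute)
  let ?s = "s \<circ> Transposition.transpose m (Suc m)"
  define P' where "P' = (-1) \<cdot>\<^sub>m P"
  define X' where "X' = (\<lambda>i. if i = m then ?Y else if i = Suc m then ?X else (-1) \<cdot>\<^sub>m X i)"
  have s': "?s m = s (Suc m)" "?s (Suc m) = s m" "\<And>i. i \<noteq> m \<Longrightarrow> i \<noteq> Suc m \<Longrightarrow> ?s i = s i"
    by (auto simp: transpose_def)
  have X': "X' m = ?Y" "X' (Suc m) = ?X" "\<And>i. i \<noteq> m \<Longrightarrow> i \<noteq> Suc m \<Longrightarrow> X' i = (-1) \<cdot>\<^sub>m X i"
    by (auto simp: X'_def)
  \<comment> \<open>Up to a sign, the new operators are the old ones with permuted indices. All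
    Clifford relations are therefore inherited without treating the pair separately.\<close>
  have X'X: "\<exists>j<n. \<exists>\<epsilon>. (\<epsilon> = 1 \<or> \<epsilon> = -1) \<and> j = Transposition.transpose m (Suc m) i \<and> X' i = \<epsilon> \<cdot>\<^sub>m X j" if "i < n" for i
  proof -
    have "X' i = (if i = m \<or> i = Suc m then 1 else -1) \<cdot>\<^sub>m X (Transposition.transpose m (Suc m) i)"
      by (auto simp: X'_def transpose_def mat_arith)
    moreover have "Transposition.transpose m (Suc m) i < n" using that m by (auto simp: transpose_def)
    ultimately show ?thesis by metis
  qed
  have h': "hmod n ?s d P' X'"
  proof (rule hmodI)
    show "P' \<in> carrier_mat d d" using D(1) by (simp add: P'_def)
    show "P' * P' = 1\<^sub>m d" using dims D(2) by (simp add: P'_def mat_arith)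
  next
    fix i assume i: "i < n"
    obtain j \<epsilon> where j: "j < n" "\<epsilon> = 1 \<or> \<epsilon> = (-1::complex)" "j = Transposition.transpose m (Suc m) i" "X' i = \<epsilon> \<cdot>\<^sub>m X j"
      using X'X[OF i] by auto
    have dj: "dim_row (X j) = d" "dim_col (X j) = d" using D(3)[OF j(1)] by auto
    show "X' i \<in> carrier_mat d d" using j D(3) by auto
    show "X' i * P' = (-1) \<cdot>\<^sub>m (P' * X' i)"
      using j(4) dj dims D(4)[OF j(1)] by (simp add: P'_def mat_arith mult.commute)
    have "\<epsilon> * \<epsilon> = 1" using j(2) by auto
    then show "X' i * X' i = ?s i \<cdot>\<^sub>m 1\<^sub>m d"
      using j(3,4) dj D(5)[OF j(1)] by (simp add: mat_arith mult.assoc[symmetric])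
  next
    fix i i' assume i: "i < n" "i' < n" "i < i'"
    obtain j \<epsilon> where j: "j < n" "j = Transposition.transpose m (Suc m) i" "X' i = \<epsilon> \<cdot>\<^sub>m X j"
      using X'X[OF i(1)] by auto
    obtain j' \<epsilon>' where j': "j' < n" "j' = Transposition.transpose m (Suc m) i'" "X' i' = \<epsilon>' \<cdot>\<^sub>m X j'"
      using X'X[OF i(2)] by auto
    have "j \<noteq> j'" using i j j' by (metis less_irrefl transpose_eq_iff)
    moreover have "dim_row (X j) = d" "dim_col (X j) = d" "dim_row (X j') = d" "dim_col (X j') = d"
      using D(3)[OF j(1)] D(3)[OF j'(1)] by auto
    ultimately show "X' i * X' i' = (-1) \<cdot>\<^sub>m (X' i' * X' i)"
      using j(3) j'(3) D(6)[OF j(1) j'(1)] by (simp add: mat_arith mult.commute)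
  qed
  have "simple_hmod n ?s d P' X'"
  proof (rule simple_hmod_transfer[OF simple h'])
    fix S v assume S: "linsub d S" "\<And>u. u \<in> S \<Longrightarrow> P' *\<^sub>v u \<in> S" "\<And>i u. i < n \<Longrightarrow> u \<in> S \<Longrightarrow> X' i *\<^sub>v u \<in> S"
      and v: "v \<in> S"
    have vc: "v \<in> carrier_vec d" using v linsubD(1)[OF S(1)] by auto
    have neg: "A *\<^sub>v v \<in> S" if "((-1) \<cdot>\<^sub>m A) *\<^sub>v v \<in> S" "A \<in> carrier_mat d d" for A
    proof -
      have "A *\<^sub>v v = (-1) \<cdot>\<^sub>v (((-1) \<cdot>\<^sub>m A) *\<^sub>v v)"
        using smult_mult_mat_vec[OF that(2) vc] by (simp add: smult_smult_assoc)
      then show ?thesis using linsubD(4)[OF S(1) that(1)] by metis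
    qed
    have "X i *\<^sub>v v \<in> S" if i: "i < n" for i
    proof -
      consider "i = m" | "i = Suc m" | "i \<noteq> m" "i \<noteq> Suc m" by auto
      then show ?thesis
      proof cases
        case 1
        then show ?thesis using S(3)[OF m v] X' by simp
      next
        case 2
        then show ?thesis using S(3)[OF mn v] X' by simp
      next
        case 3
        then show ?thesis using S(3)[OF i v] X'(3) neg D(3)[OF i] by simp
      qed
    qed
    moreover have "P *\<^sub>v v \<in> S" using neg[OF _ D(1)] S(2)[OF v] by (simp add: P'_def)
    ultimately show "P *\<^sub>v v \<in> S \<and> (\<forall>i<n. X i *\<^sub>v v \<in> S)" by simp
  qed
  moreover have "same_factors d (wfam n P (wact n d s X)) d (wfam n P' (wact n d ?s X'))"
  proof (rule same_factors_exchange)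
    show "fam d (wfam n P (wact n d s X))" "fam d (wfam n P' (wact n d ?s X'))"
      using D(1) hmodD(1)[OF h'] by (auto intro: fam_wfam)
    show T: "?T \<in> carrier_mat d d" using c by simp
    show "?T * wfam n P (wact n d s X) i = wfam n P' (wact n d ?s X') i * ?T" for i
      by (rule swap_atypical_intertwine[OF h h' m s0 s' X'(1,2)]) (use X'(3) P'_def in auto)
    show "?T * wfam n P' (wact n d ?s X') i = wfam n P (wact n d s X) i * ?T" for i
    proof -
      \<comment> \<open>The construction is an involution, so the opposite direction is the same
        lemma with the two modules interchanged.\<close>
      have "(X' m + X' (Suc m)) * wfam n P' (wact n d ?s X') i = wfam n P (wact n d s X) i * (X' m + X' (Suc m))"
        by (rule swap_atypical_intertwine[OF h' h m])
          (use s0 s' X' P'_def in \<open>auto simp: mat_arith add.commute\<close>)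
      then show ?thesis using add_mat_commute[OF c] by (simp add: X'(1,2))
    qed
    fix v :: "complex vec" assume v: "v \<in> carrier_vec d"
    have TT: "?T * ?T = 0\<^sub>m d d"
      using dims by (intro eq_matI) (simp_all add: mat_arith XX YY YX b del: index_mult_mat(1))
    \<comment> \<open>xi_m / (2a) is a contracting homotopy for theta: if theta v = 0, this relation
      gives v = theta (xi_m v) / (2a), so the kernel lies in the image.\<close>
    have TX: "?T * ?X + ?X * ?T = (2 * s m) \<cdot>\<^sub>m 1\<^sub>m d"
      using dims by (intro eq_matI) (simp_all add: mat_arith XX YX del: index_mult_mat(1))
    show "?T *\<^sub>v v = 0\<^sub>v d \<longleftrightarrow> (\<exists>u\<in>carrier_vec d. v = ?T *\<^sub>v u)"
    proof
      assume "\<exists>u\<in>carrier_vec d. v = ?T *\<^sub>v u"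
      then obtain u where u: "u \<in> carrier_vec d" "v = ?T *\<^sub>v u" by blast
      then have "?T *\<^sub>v v = (?T * ?T) *\<^sub>v u" using assoc_mult_mat_vec[OF T T u(1)] by simp
      then show "?T *\<^sub>v v = 0\<^sub>v d" unfolding TT using u(1) by (auto intro!: eq_vecI)
    next
      assume T0: "?T *\<^sub>v v = 0\<^sub>v d"
      have "(?T * ?X + ?X * ?T) *\<^sub>v v = (?T * ?X) *\<^sub>v v + (?X * ?T) *\<^sub>v v"
        using c T v by (intro add_mult_distrib_mat_vec[of _ d d]) auto
      also have "(?T * ?X) *\<^sub>v v = ?T *\<^sub>v (?X *\<^sub>v v)" by (rule assoc_mult_mat_vec[OF T c(1) v])
      also have "(?X * ?T) *\<^sub>v v = ?X *\<^sub>v (?T *\<^sub>v v)" by (rule assoc_mult_mat_vec[OF c(1) T v])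
      also have "\<dots> = 0\<^sub>v d" unfolding T0 by (rule mult_mat_vec_zero[OF c(1)])
      also have "?T *\<^sub>v (?X *\<^sub>v v) + 0\<^sub>v d = ?T *\<^sub>v (?X *\<^sub>v v)"
        using T c(1) v by (meson mult_mat_vec_carrier right_zero_vec)
      finally have "?T *\<^sub>v (?X *\<^sub>v v) = (2 * s m) \<cdot>\<^sub>v v"
        unfolding TX using v smult_mult_mat_vec[OF one_carrier_mat v] by simp
      then have "?T *\<^sub>v (inverse (2 * s m) \<cdot>\<^sub>v (?X *\<^sub>v v)) = inverse (2 * s m) \<cdot>\<^sub>v ((2 * s m) \<cdot>\<^sub>v v)"
        using mult_mat_vec[OF T] mult_mat_vec_carrier[OF c(1) v] by simp
      also have "\<dots> = v" using nz by (simp add: smult_smult_assoc)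
      finally have "v = ?T *\<^sub>v (inverse (2 * s m) \<cdot>\<^sub>v (?X *\<^sub>v v))" ..
      then show "\<exists>u\<in>carrier_vec d. v = ?T *\<^sub>v u"
        using mult_mat_vec_carrier[OF c(1) v] by (intro bexI[of _ "inverse (2 * s m) \<cdot>\<^sub>v (?X *\<^sub>v v)"]) simp_all
    qed
  qed
  ultimately show ?thesis by blast
qed

section \<open>Uniqueness of simple modules\<close>

lemma mat_eq_by_vec:
  fixes A B :: "complex mat"
  assumes "A \<in> carrier_mat nr nc" "B \<in> carrier_mat nr nc"
    and eq: "\<And>v. v \<in> carrier_vec nc \<Longrightarrow> A *\<^sub>v v = B *\<^sub>v v"
  shows "A = B"
proof (rule eq_matI)
  fix i j assume "i < dim_row B" "j < dim_col B"
  then have ij: "i < nr" "j < nc" using assms by auto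
  have u: "(C *\<^sub>v unit_vec nc j) $ i = C $$ (i, j)" if "C \<in> carrier_mat nr nc" for C :: "complex mat"
    using that ij by simp
  show "A $$ (i, j) = B $$ (i, j)"
    unfolding u[OF assms(1), symmetric] u[OF assms(2), symmetric] by (simp only: eq unit_vec_carrier)
qed (use assms in auto)

text \<open>The traces of \<open>T * G\<close> and \<open>G * T\<close> agree, and they are
  \<open>e\<close> and \<open>d\<close>.\<close>

lemma inverse_imp_square:
  fixes T G :: "complex mat"
  assumes T: "T \<in> carrier_mat e d" and G: "G \<in> carrier_mat d e"
    and TG: "T * G = 1\<^sub>m e" and GT: "G * T = 1\<^sub>m d"
  shows "e = d"
proof -
  have "(\<Sum>i<e. (T * G) $$ (i, i)) = (\<Sum>i<e. \<Sum>j<d. T $$ (i, j) * G $$ (j, i))"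
    using T G by (intro sum.cong) (auto simp: scalar_prod_def lessThan_atLeast0)
  also have "\<dots> = (\<Sum>j<d. \<Sum>i<e. T $$ (i, j) * G $$ (j, i))" by (rule sum.swap)
  also have "\<dots> = (\<Sum>j<d. (G * T) $$ (j, j))"
    using T G by (intro sum.cong) (auto simp: scalar_prod_def lessThan_atLeast0 mult.commute intro!: sum.cong)
  finally have "of_nat e = (of_nat d :: complex)" unfolding TG GT by simp
  then show ?thesis by simp
qed

text \<open>The kernel of \<open>X i\<close> is a graded submodule because \<open>X i\<close>
  commutes up to sign with all operators. It is nonzero since \<open>X i\<close> squares to zero on
  a nonzero space, so it is everything. This removes the degenerate part of the Clifford
  algebra.\<close>

lemma simple_hmod_zero:
  assumes simple: "simple_hmod n s d P X" and i: "i < n" and s0: "s i = 0"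
  shows "X i = 0\<^sub>m d d"
proof -
  note D = hmodD[OF simple_hmodD(1)[OF simple]]
  have Xi: "X i \<in> carrier_mat d d" using D(3)[OF i] .
  define S where "S = {v \<in> carrier_vec d. X i *\<^sub>v v \<in> {0\<^sub>v d}}"
  have lin: "linsub d S"
    unfolding S_def by (rule linsub_vimage[OF Xi]) (auto simp: linsub_def)
  have stable: "B *\<^sub>v v \<in> S"
    if v: "v \<in> S" and B: "B \<in> carrier_mat d d" and XB: "X i * B = c \<cdot>\<^sub>m (B * X i)" for v B c
  proof -
    have vc: "v \<in> carrier_vec d" "X i *\<^sub>v v = 0\<^sub>v d" using v by (auto simp: S_def)
    have "X i *\<^sub>v (B *\<^sub>v v) = (X i * B) *\<^sub>v v" using assoc_mult_mat_vec[OF Xi B vc(1)] by simp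
    also have "\<dots> = c \<cdot>\<^sub>v ((B * X i) *\<^sub>v v)"
      unfolding XB using B Xi vc by (intro smult_mult_mat_vec[of _ d d]) auto
    also have "(B * X i) *\<^sub>v v = 0\<^sub>v d"
      using assoc_mult_mat_vec[OF B Xi vc(1)] vc(2) mult_mat_vec_zero[OF B] by simp
    finally have "X i *\<^sub>v (B *\<^sub>v v) = 0\<^sub>v d" by (auto intro!: eq_vecI)
    then show ?thesis using mult_mat_vec_carrier[OF B vc(1)] by (simp add: S_def)
  qed
  have "inv_gsubspace d P (X ` {..<n}) S"
    unfolding inv_gsubspace_linsub
  proof (intro conjI ballI)
    show "P *\<^sub>v v \<in> S" if "v \<in> S" for v using stable[OF that D(1) D(4)[OF i]] .
    fix B v assume B: "B \<in> X ` {..<n}" and v: "v \<in> S"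
    obtain j where j: "j < n" "B = X j" using B by auto
    show "B *\<^sub>v v \<in> S"
    proof (cases "j = i")
      case True
      have "X i * X i = 1 \<cdot>\<^sub>m (X i * X i)" by (simp add: mat_arith)
      then show ?thesis using stable[OF v Xi] True j by simp
    next
      case False
      then show ?thesis using stable[OF v D(3)[OF j(1)] D(6)[OF i j(1)]] j by simp
    qed
  qed (rule lin)
  then have "S = {0\<^sub>v d} \<or> S = carrier_vec d" by (rule simple_hmodD(3)[OF simple])
  moreover have "v = 0\<^sub>v d" if S: "S = {0\<^sub>v d}" and v: "v \<in> carrier_vec d" for v :: "complex vec"
  proof -
    have Xv: "X i *\<^sub>v v \<in> carrier_vec d" using mult_mat_vec_carrier[OF Xi v] .
    have "X i *\<^sub>v (X i *\<^sub>v v) = (X i * X i) *\<^sub>v v" using assoc_mult_mat_vec[OF Xi Xi v] by simp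
    also have "\<dots> = 0\<^sub>v d" unfolding D(5)[OF i] s0 using v by (auto intro!: eq_vecI)
    finally have "X i *\<^sub>v v \<in> S" using Xv by (simp add: S_def)
    then have "X i *\<^sub>v v = 0\<^sub>v d" using S by simp
    then have "v \<in> S" using v by (simp add: S_def)
    then show ?thesis using S by simp
  qed
  moreover have "unit_vec d 0 \<noteq> (0\<^sub>v d :: complex vec)"
    using simple_hmodD(2)[OF simple] by (metis index_unit_vec(1) index_zero_vec(1) zero_neq_one)
  ultimately have "S = carrier_vec d" using unit_vec_carrier by metis
  have "X i *\<^sub>v v = 0\<^sub>m d d *\<^sub>v v" if v: "v \<in> carrier_vec d" for v
  proof -
    have "v \<in> S" using v \<open>S = carrier_vec d\<close> by simp
    then have "X i *\<^sub>v v = 0\<^sub>v d" by (simp add: S_def)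
    then show ?thesis using v by (auto intro!: eq_vecI)
  qed
  then show ?thesis by (intro mat_eq_by_vec[OF Xi]) auto
qed

text \<open>The parity change of a simple module; it turns an odd intertwiner into an even one, to
  which Schur's lemma applies.\<close>

lemma simple_hmod_uminus:
  assumes "simple_hmod n s d P X"
  shows "simple_hmod n s d (- P) X"
proof (rule simple_hmod_transfer[OF assms])
  note D = hmodD[OF simple_hmodD(1)[OF assms]]
  note Pd = carrier_matD[OF D(1)]
  show "hmod n s d (- P) X"
  proof (rule hmodI)
    show "- P * - P = 1\<^sub>m d" using D(2) Pd by (simp add: mat_arith)
    fix i assume i: "i < n"
    have "dim_row (X i) = d" "dim_col (X i) = d" using D(3)[OF i] by auto
    then show "X i * - P = (-1) \<cdot>\<^sub>m (- P * X i)" using D(4)[OF i] Pd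
      by (intro eq_matI) (simp_all add: mat_arith del: index_mult_mat(1))
    show "X i \<in> carrier_mat d d" "X i * X i = s i \<cdot>\<^sub>m 1\<^sub>m d" using D(3,5)[OF i] .
    show "X i * X j = (-1) \<cdot>\<^sub>m (X j * X i)" if "j < n" "i < j" for j using D(6)[OF i that(1)] that by simp
  qed (use D(1) in auto)
  fix S v assume S: "linsub d S" "\<And>u. u \<in> S \<Longrightarrow> - P *\<^sub>v u \<in> S" "\<And>i u. i < n \<Longrightarrow> u \<in> S \<Longrightarrow> X i *\<^sub>v u \<in> S"
    and v: "v \<in> S"
  have "v \<in> carrier_vec d" using v linsubD(1)[OF S(1)] by auto
  then have "P *\<^sub>v v = (-1) \<cdot>\<^sub>v (- P *\<^sub>v v)" using D(1) by (intro eq_vecI) auto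
  then have "P *\<^sub>v v \<in> S" using linsubD(4)[OF S(1) S(2)[OF v]] by metis
  then show "P *\<^sub>v v \<in> S \<and> (\<forall>i<n. X i *\<^sub>v v \<in> S)" using S(3) v by simp
qed

text \<open>The kernel is a proper graded submodule, hence zero; the image is a nonzero one, hence
  everything. A linear choice of preimages then is a two-sided inverse.\<close>

lemma schur_hmod:
  assumes V: "simple_hmod n s d P X" and W: "simple_hmod n s d' P' X'"
    and T: "T \<in> carrier_mat d' d" and nz: "T \<noteq> 0\<^sub>m d' d" and TP: "T * P = P' * T"
    and TX: "\<And>i. i < n \<Longrightarrow> T * X i = X' i * T"
  shows "d' = d \<and> (\<exists>G \<in> carrier_mat d d'. T * G = 1\<^sub>m d' \<and> G * T = 1\<^sub>m d)"
proof -
  note D = hmodD[OF simple_hmodD(1)[OF V]] and D' = hmodD[OF simple_hmodD(1)[OF W]]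
  have lin: "linsub q {0\<^sub>v q}" "linsub q (carrier_vec q)" for q by (auto simp: linsub_def)
  have act: "T *\<^sub>v (B *\<^sub>v v) = B' *\<^sub>v (T *\<^sub>v v)"
    if "T * B = B' * T" "B \<in> carrier_mat d d" "B' \<in> carrier_mat d' d'" "v \<in> carrier_vec d" for B B' v
    using that(1) assoc_mult_mat_vec[OF T that(2,4)] assoc_mult_mat_vec[OF that(3) T that(4)] by simp
  define K where "K = {v \<in> carrier_vec d. T *\<^sub>v v \<in> {0\<^sub>v d'}}"
  have Kst: "B *\<^sub>v v \<in> K"
    if "v \<in> K" "T * B = B' * T" "B \<in> carrier_mat d d" "B' \<in> carrier_mat d' d'" for B B' v
    using that act[OF that(2-4), of v] mult_mat_vec_zero[OF that(4)] mult_mat_vec_carrier[OF that(3)]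
    by (auto simp: K_def)
  have "inv_gsubspace d P (X ` {..<n}) K"
    unfolding inv_gsubspace_linsub
  proof (intro conjI ballI)
    show "linsub d K" unfolding K_def by (rule linsub_vimage[OF T lin(2,1)])
    show "P *\<^sub>v v \<in> K" if "v \<in> K" for v using Kst[OF that TP D(1) D'(1)] .
    show "B *\<^sub>v v \<in> K" if "B \<in> X ` {..<n}" "v \<in> K" for B v
      using that Kst[OF that(2) TX D(3) D'(3)] by auto
  qed
  then have "K = {0\<^sub>v d} \<or> K = carrier_vec d" by (rule simple_hmodD(3)[OF V])
  moreover have "K \<noteq> carrier_vec d"
  proof
    assume K: "K = carrier_vec d"
    have "T *\<^sub>v v = 0\<^sub>m d' d *\<^sub>v v" if "v \<in> carrier_vec d" for v
    proof -
      have "v \<in> K" using that K by simp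
      then have "T *\<^sub>v v = 0\<^sub>v d'" by (simp add: K_def)
      then show ?thesis using that by (auto intro!: eq_vecI)
    qed
    then have "T = 0\<^sub>m d' d" by (intro mat_eq_by_vec[OF T]) auto
    then show False using nz by simp
  qed
  ultimately have K0: "K = {0\<^sub>v d}" by simp
  define R where "R = {w. \<exists>v\<in>carrier_vec d. w = T *\<^sub>v v}"
  have linR: "linsub d' R"
    unfolding linsub_def
  proof (intro conjI ballI allI)
    show "R \<subseteq> carrier_vec d'" using mult_mat_vec_carrier[OF T] by (auto simp: R_def)
    show "0\<^sub>v d' \<in> R" unfolding R_def using mult_mat_vec_zero[OF T, symmetric] zero_carrier_vec by blast
    show "v + w \<in> R" if "v \<in> R" "w \<in> R" for v w
    proof -
      obtain v' w' where "v' \<in> carrier_vec d" "w' \<in> carrier_vec d" "v = T *\<^sub>v v'" "w = T *\<^sub>v w'"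
        using \<open>v \<in> R\<close> \<open>w \<in> R\<close> by (auto simp: R_def)
      then have "v + w = T *\<^sub>v (v' + w')" "v' + w' \<in> carrier_vec d"
        using mult_add_distrib_mat_vec[OF T] by auto
      then show ?thesis unfolding R_def by blast
    qed
    show "c \<cdot>\<^sub>v v \<in> R" if "v \<in> R" for c v
    proof -
      obtain v' where "v' \<in> carrier_vec d" "v = T *\<^sub>v v'" using \<open>v \<in> R\<close> by (auto simp: R_def)
      then have "c \<cdot>\<^sub>v v = T *\<^sub>v (c \<cdot>\<^sub>v v')" "c \<cdot>\<^sub>v v' \<in> carrier_vec d"
        using mult_mat_vec[OF T] by auto
      then show ?thesis unfolding R_def by blast
    qed
  qed
  have Rst: "B' *\<^sub>v w \<in> R"
    if "w \<in> R" "T * B = B' * T" "B \<in> carrier_mat d d" "B' \<in> carrier_mat d' d'" for B B' w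
  proof -
    obtain v where v: "v \<in> carrier_vec d" "w = T *\<^sub>v v" using \<open>w \<in> R\<close> by (auto simp: R_def)
    then have "B' *\<^sub>v w = T *\<^sub>v (B *\<^sub>v v)" using act[OF that(2-4)] by simp
    then show ?thesis using mult_mat_vec_carrier[OF that(3) v(1)] unfolding R_def by blast
  qed
  have "inv_gsubspace d' P' (X' ` {..<n}) R"
    unfolding inv_gsubspace_linsub
  proof (intro conjI ballI)
    show "P' *\<^sub>v v \<in> R" if "v \<in> R" for v using Rst[OF that TP D(1) D'(1)] .
    show "B *\<^sub>v v \<in> R" if "B \<in> X' ` {..<n}" "v \<in> R" for B v
      using that Rst[OF that(2) TX D(3) D'(3)] by auto
  qed (rule linR)
  then have "R = {0\<^sub>v d'} \<or> R = carrier_vec d'" by (rule simple_hmodD(3)[OF W])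
  moreover have "R \<noteq> {0\<^sub>v d'}"
  proof
    assume R0: "R = {0\<^sub>v d'}"
    then have "carrier_vec d \<subseteq> K" unfolding K_def R_def by blast
    then show False using \<open>K \<noteq> carrier_vec d\<close> unfolding K_def by blast
  qed
  ultimately have R1: "R = carrier_vec d'" by simp
  have "\<exists>G\<in>carrier_mat d d'. \<forall>w\<in>carrier_vec d'. w \<in> carrier_vec d' \<and> G *\<^sub>v w \<in> carrier_vec d \<and> w = T *\<^sub>v (G *\<^sub>v w)"
  proof (rule linear_section[where R = "\<lambda>w v. w \<in> carrier_vec d' \<and> v \<in> carrier_vec d \<and> w = T *\<^sub>v v"])
    show "linsub d' (carrier_vec d')" by (rule lin)
    show "\<exists>v. w \<in> carrier_vec d' \<and> v \<in> carrier_vec d \<and> w = T *\<^sub>v v" if "w \<in> carrier_vec d'" for w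
      using that R1 by (auto simp: R_def)
    show "0\<^sub>v d' \<in> carrier_vec d' \<and> 0\<^sub>v d \<in> carrier_vec d \<and> 0\<^sub>v d' = T *\<^sub>v 0\<^sub>v d"
      using mult_mat_vec_zero[OF T] by simp
  qed (use mult_add_distrib_mat_vec[OF T] mult_mat_vec[OF T] in auto)
  then obtain G where G: "G \<in> carrier_mat d d'" and TG: "\<And>w. w \<in> carrier_vec d' \<Longrightarrow> T *\<^sub>v (G *\<^sub>v w) = w"
    by metis
  have "T * G = 1\<^sub>m d'"
    by (rule mat_eq_by_vec[of _ d' d']) (use T G TG in \<open>auto simp: assoc_mult_mat_vec[OF T G]\<close>)
  moreover have "G * T = 1\<^sub>m d"
  proof (rule mat_eq_by_vec[of _ d d])
    fix v :: "complex vec" assume v: "v \<in> carrier_vec d"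
    have Tv: "T *\<^sub>v v \<in> carrier_vec d'" using mult_mat_vec_carrier[OF T v] .
    have Gv: "G *\<^sub>v (T *\<^sub>v v) \<in> carrier_vec d" using mult_mat_vec_carrier[OF G Tv] .
    have "T *\<^sub>v (G *\<^sub>v (T *\<^sub>v v) - v) = T *\<^sub>v v - T *\<^sub>v v"
      using mult_minus_distrib_mat_vec[OF T Gv v] TG[OF Tv] by simp
    also have "\<dots> = 0\<^sub>v d'" using Tv by simp
    finally have "G *\<^sub>v (T *\<^sub>v v) - v \<in> K" using Gv v by (simp add: K_def)
    then have 0: "G *\<^sub>v (T *\<^sub>v v) - v = 0\<^sub>v d" using K0 by simp
    have "G *\<^sub>v (T *\<^sub>v v) = v"
    proof (rule eq_vecI)
      fix i assume i: "i < dim_vec v"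
      have "(G *\<^sub>v (T *\<^sub>v v) - v) $ i = 0" using 0 i v by simp
      then show "(G *\<^sub>v (T *\<^sub>v v)) $ i = v $ i" using i by simp
    qed (use G v in simp)
    then show "(G * T) *\<^sub>v v = 1\<^sub>m d *\<^sub>v v" using assoc_mult_mat_vec[OF G T v] v by simp
  qed (use G T in auto)
  ultimately show ?thesis using inverse_imp_square[OF T G] G by blast
qed

text \<open>The maps sending T to E' i * T * E i / t i are commuting involutions of Hom(V, W), hence
  have a common eigenvector, with eigenvalues 1 or -1.\<close>

lemma clifford_common_eigenvector:
  fixes E E' :: "'i \<Rightarrow> complex mat"
  assumes "finite J" "d > 0" "d' > 0"
    and E: "\<forall>i\<in>J. E i \<in> carrier_mat d d \<and> E' i \<in> carrier_mat d' d' \<and> t i \<noteq> 0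
        \<and> E i * E i = t i \<cdot>\<^sub>m 1\<^sub>m d \<and> E' i * E' i = t i \<cdot>\<^sub>m 1\<^sub>m d'"
    and anti: "\<forall>i\<in>J. \<forall>j\<in>J. i \<noteq> j \<longrightarrow> E i * E j = (-1) \<cdot>\<^sub>m (E j * E i) \<and> E' i * E' j = (-1) \<cdot>\<^sub>m (E' j * E' i)"
  shows "\<exists>T\<in>carrier_mat d' d. T \<noteq> 0\<^sub>m d' d \<and> (\<forall>i\<in>J. \<exists>\<epsilon>\<in>{1,-1}. E' i * T = \<epsilon> \<cdot>\<^sub>m (T * E i))"
  using assms(1) E anti
proof (induction J rule: finite_induct)
  case empty
  let ?T = "mat d' d (\<lambda>_. 1) :: complex mat"
  have "?T $$ (0, 0) \<noteq> 0\<^sub>m d' d $$ (0, 0)" using assms(2,3) by simp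
  then have "?T \<noteq> 0\<^sub>m d' d" by metis
  then show ?case by (intro bexI[of _ ?T]) auto
next
  case (insert i J)
  have "\<exists>T\<in>carrier_mat d' d. T \<noteq> 0\<^sub>m d' d \<and> (\<forall>i\<in>J. \<exists>\<epsilon>\<in>{1,-1}. E' i * T = \<epsilon> \<cdot>\<^sub>m (T * E i))"
    by (rule insert.IH) (use insert.prems in blast)+
  then obtain T where T: "T \<in> carrier_mat d' d" "T \<noteq> 0\<^sub>m d' d"
    and eig: "\<And>j. j \<in> J \<Longrightarrow> \<exists>\<epsilon>\<in>{1,-1}. E' j * T = \<epsilon> \<cdot>\<^sub>m (T * E j)" by blast
  have dim: "dim_row (E j) = d" "dim_col (E j) = d" "dim_row (E' j) = d'" "dim_col (E' j) = d'"
    if "j \<in> insert i J" for j using insert.prems(1) that by auto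
  note di = dim[OF insertI1] and dT = carrier_matD[OF T(1)]
  have ti: "t i \<noteq> 0" "E i * E i = t i \<cdot>\<^sub>m 1\<^sub>m d" "E' i * E' i = t i \<cdot>\<^sub>m 1\<^sub>m d'" using insert.prems(1) by auto
  \<comment> \<open>\<open>U\<close> is the image of \<open>T\<close> under the involution belonging
    to \<open>i\<close>. For \<eta> = 1 and \<eta> = -1 the matrix \<open>T + \<eta> U\<close> is
    zero or an eigenvector with eigenvalue \<eta>, and both cannot vanish because their sum is
    \<open>2 T\<close>.\<close>
  define U where "U = inverse (t i) \<cdot>\<^sub>m (E' i * T * E i)"
  have U: "dim_row U = d'" "dim_col U = d" using di by (simp_all add: U_def)
  have EU: "E' i * U = T * E i"
  proof -
    have "E' i * (E' i * (T * E i)) = t i \<cdot>\<^sub>m (T * E i)"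
      using mat_arith(1)[of "E' i" "E' i" "T * E i"] di dT ti(3) by (simp add: mat_arith)
    then show ?thesis using di dT ti(1) by (simp add: U_def mat_arith)
  qed
  have UE: "U * E i = E' i * T"
    using di dT ti by (simp add: U_def mat_arith)
  have main: "\<exists>\<epsilon>\<in>{1,-1}. E' j * (T + \<eta> \<cdot>\<^sub>m U) = \<epsilon> \<cdot>\<^sub>m ((T + \<eta> \<cdot>\<^sub>m U) * E j)"
    if \<eta>: "\<eta> \<in> {1,-1}" and j: "j \<in> insert i J" for \<eta> j
  proof (cases "j = i")
    case True
    have "E' i * (T + \<eta> \<cdot>\<^sub>m U) = E' i * T + \<eta> \<cdot>\<^sub>m (T * E i)" using di dT U EU by (simp add: mat_arith)
    also have "\<dots> = \<eta> \<cdot>\<^sub>m ((T + \<eta> \<cdot>\<^sub>m U) * E i)"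
      using \<eta> di dT U UE by (auto simp: mat_arith)
    finally show ?thesis using True \<eta> by auto
  next
    case False
    then have jJ: "j \<in> J" using j by simp
    note dj = dim[OF j]
    obtain \<epsilon> where \<epsilon>: "\<epsilon> \<in> {1,-1}" "E' j * T = \<epsilon> \<cdot>\<^sub>m (T * E j)" using eig[OF jJ] by auto
    \<comment> \<open>Moving \<open>E' j\<close> past \<open>E' i\<close> and \<open>E j\<close>
      past \<open>E i\<close> costs two signs, which cancel. So the involutions commute and the
      eigenvalue at \<open>j\<close> survives the passage to \<open>T + \<eta> U\<close>.\<close>
    have a: "E' j * E' i = (-1) \<cdot>\<^sub>m (E' i * E' j)" "E j * E i = (-1) \<cdot>\<^sub>m (E i * E j)"
      using insert.prems(2) j False by blast+
    have "E' j * (E' i * (T * E i)) = E' j * E' i * (T * E i)" using di dj dT by (simp add: mat_arith)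
    also have "\<dots> = (-1) \<cdot>\<^sub>m (E' i * (E' j * T * E i))" unfolding a using di dj dT by (simp add: mat_arith)
    also have "\<dots> = (- \<epsilon>) \<cdot>\<^sub>m (E' i * (T * (E j * E i)))" unfolding \<epsilon>(2) using di dj dT by (simp add: mat_arith)
    also have "\<dots> = \<epsilon> \<cdot>\<^sub>m (E' i * (T * (E i * E j)))" unfolding a using di dj dT by (simp add: mat_arith)
    finally have "E' j * U = \<epsilon> \<cdot>\<^sub>m (U * E j)"
      using di dj dT by (simp add: U_def mat_arith mult.commute)
    then have "E' j * (T + \<eta> \<cdot>\<^sub>m U) = \<epsilon> \<cdot>\<^sub>m ((T + \<eta> \<cdot>\<^sub>m U) * E j)"
      using \<epsilon>(2) dj dT U by (simp add: mat_arith mult.commute)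
    then show ?thesis using \<epsilon>(1) by blast
  qed
  have "\<exists>\<eta>\<in>{1,-1}. T + \<eta> \<cdot>\<^sub>m U \<noteq> 0\<^sub>m d' d"
  proof (rule ccontr)
    assume "\<not> ?thesis"
    then have z: "T + 1 \<cdot>\<^sub>m U = 0\<^sub>m d' d" "T + (-1) \<cdot>\<^sub>m U = 0\<^sub>m d' d" by auto
    have "T = 0\<^sub>m d' d"
    proof (rule eq_matI)
      fix r c assume "r < dim_row (0\<^sub>m d' d :: complex mat)" "c < dim_col (0\<^sub>m d' d :: complex mat)"
      then have rc: "r < d'" "c < d" by auto
      have "(T + 1 \<cdot>\<^sub>m U) $$ (r, c) = 0" "(T + (-1) \<cdot>\<^sub>m U) $$ (r, c) = 0" using z rc by simp_all
      then show "T $$ (r, c) = 0\<^sub>m d' d $$ (r, c)" using rc dT U by simp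
    qed (use dT in auto)
    then show False using T by simp
  qed
  then obtain \<eta> where \<eta>: "\<eta> \<in> {1,-1}" "T + \<eta> \<cdot>\<^sub>m U \<noteq> 0\<^sub>m d' d" by blast
  show ?case
  proof (intro bexI[of _ "T + \<eta> \<cdot>\<^sub>m U"] conjI ballI)
    show "T + \<eta> \<cdot>\<^sub>m U \<in> carrier_mat d' d" using U by (intro carrier_matI) simp_all
  qed (rule \<eta>(2), rule main[OF \<eta>(1)])
qed

text \<open>Right multiplication by E j * E z flips the eigenvalues at j and z only.\<close>

lemma clifford_intertwiner:
  fixes E E' :: "'i \<Rightarrow> complex mat"
  assumes "finite J" "d > 0" "d' > 0" and z: "z \<in> J"
    and E: "\<forall>i\<in>J. E i \<in> carrier_mat d d \<and> E' i \<in> carrier_mat d' d' \<and> t i \<noteq> 0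
        \<and> E i * E i = t i \<cdot>\<^sub>m 1\<^sub>m d \<and> E' i * E' i = t i \<cdot>\<^sub>m 1\<^sub>m d'"
    and anti: "\<forall>i\<in>J. \<forall>j\<in>J. i \<noteq> j \<longrightarrow> E i * E j = (-1) \<cdot>\<^sub>m (E j * E i) \<and> E' i * E' j = (-1) \<cdot>\<^sub>m (E' j * E' i)"
  shows "\<exists>T\<in>carrier_mat d' d. T \<noteq> 0\<^sub>m d' d \<and> (\<forall>i\<in>J - {z}. E' i * T = T * E i)
     \<and> (\<exists>\<epsilon>\<in>{1,-1}. E' z * T = \<epsilon> \<cdot>\<^sub>m (T * E z))"
proof -
  have "\<exists>T\<in>carrier_mat d' d. T \<noteq> 0\<^sub>m d' d \<and> (\<forall>i\<in>J. \<exists>\<epsilon>\<in>{1,-1}. E' i * T = \<epsilon> \<cdot>\<^sub>m (T * E i)) \<and>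
      (\<forall>i\<in>K. E' i * T = T * E i)" if "finite K" "K \<subseteq> J - {z}" for K
    using that
  proof (induction K rule: finite_induct)
    case empty
    then show ?case using clifford_common_eigenvector[OF assms(1-3) E anti] by simp
  next
    case (insert j K)
    have "K \<subseteq> J - {z}" using insert.prems by blast
    from insert.IH[OF this] obtain T where T: "T \<in> carrier_mat d' d" "T \<noteq> 0\<^sub>m d' d"
      and eig: "\<And>i. i \<in> J \<Longrightarrow> \<exists>\<epsilon>\<in>{1,-1}. E' i * T = \<epsilon> \<cdot>\<^sub>m (T * E i)"
      and one: "\<And>i. i \<in> K \<Longrightarrow> E' i * T = T * E i" by blast
    have j: "j \<in> J" "j \<noteq> z" using insert.prems by auto
    obtain \<epsilon> where \<epsilon>: "\<epsilon> \<in> {1,-1}" "E' j * T = \<epsilon> \<cdot>\<^sub>m (T * E j)" using eig[OF j(1)] by auto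
    show ?case
    proof (cases "\<epsilon> = 1")
      case True
      then have "\<forall>i\<in>insert j K. E' i * T = T * E i" using \<epsilon>(2) one by (auto simp: mat_arith)
      then show ?thesis using T eig by blast
    next
      case False
      then have neg: "E' j * T = (-1) \<cdot>\<^sub>m (T * E j)" using \<epsilon> by auto
      have dim: "dim_row (E i) = d" "dim_col (E i) = d" "dim_row (E' i) = d'" "dim_col (E' i) = d'"
        if "i \<in> J" for i using E that by auto
      note dj = dim[OF j(1)] and dz = dim[OF z] and dT = carrier_matD[OF T(1)]
      have a: "E i * E k = (-1) \<cdot>\<^sub>m (E k * E i)" if "i \<in> J" "k \<in> J" "i \<noteq> k" for i k
        using anti that by blast
      have sq: "E i * E i = t i \<cdot>\<^sub>m 1\<^sub>m d" "t i \<noteq> 0" if "i \<in> J" for i using E that by auto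
      \<comment> \<open>Right multiplication by \<open>E j\<close> alone would flip all eigenvalues
        except the one at \<open>j\<close>. The second factor \<open>E z\<close> undoes this
        everywhere but at \<open>j\<close> and \<open>z\<close>; index \<open>z\<close> absorbs the
        surplus sign.\<close>
      let ?F = "E j * E z"
      have cF: "?F \<in> carrier_mat d d" using E j z by (intro mult_carrier_mat[of _ d d]) blast+
      have left: "E' i * (T * ?F) = \<epsilon> \<cdot>\<^sub>m (T * (E i * ?F))"
        if "i \<in> J" "E' i * T = \<epsilon> \<cdot>\<^sub>m (T * E i)" for i \<epsilon>
      proof -
        have "E' i * (T * ?F) = E' i * T * ?F" using dim[OF that(1)] dj dz dT by (simp add: mat_arith)
        then show ?thesis unfolding that(2) using dim[OF that(1)] dj dz dT by (simp add: mat_arith)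
      qed
      have comm: "E i * ?F = ?F * E i" if "i \<in> J" "i \<noteq> j" "i \<noteq> z" for i
      proof -
        note dd = dim[OF that(1)] dj dz
        have "E i * (E j * E z) = E i * E j * E z" using dd by (simp add: mat_arith)
        also have "\<dots> = (-1) \<cdot>\<^sub>m (E j * (E i * E z))"
          unfolding a[OF that(1) j(1) that(2)] using dd by (simp add: mat_arith)
        also have "\<dots> = E j * (E z * E i)"
          unfolding a[OF that(1) z that(3)] using dd by (simp add: mat_arith)
        finally show ?thesis using dd by (simp add: mat_arith)
      qed
      have commj: "E j * ?F = (-1) \<cdot>\<^sub>m (?F * E j)"
        using dj dz a[OF z j(1)] j by (simp add: mat_arith)
      have commz: "E z * ?F = (-1) \<cdot>\<^sub>m (?F * E z)"
      proof -
        have "E z * (E j * E z) = E z * E j * E z" using dj dz by (simp add: mat_arith)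
        also have "\<dots> = (-1) \<cdot>\<^sub>m (E j * (E z * E z))"
          unfolding a[OF z j(1) j(2)[symmetric]] using dj dz by (simp add: mat_arith)
        finally show ?thesis using dj dz by (simp add: mat_arith)
      qed
      have "E' i * (T * ?F) = T * ?F * E i" if "i \<in> insert j K" for i
      proof (cases "i = j")
        case True
        then show ?thesis using left[OF j(1) neg] commj dj dz dT by (simp add: mat_arith)
      next
        case False
        then have iK: "i \<in> K" "i \<in> J" "i \<noteq> z" using that insert.prems by auto
        have "E' i * T = 1 \<cdot>\<^sub>m (T * E i)" using one[OF iK(1)] by (simp add: mat_arith)
        from left[OF iK(2) this] show ?thesis
          using comm[OF iK(2) False iK(3)] dim[OF iK(2)] dj dz dT by (simp add: mat_arith)
      qed
      moreover have "\<exists>\<epsilon>\<in>{1,-1}. E' i * (T * ?F) = \<epsilon> \<cdot>\<^sub>m (T * ?F * E i)" if i: "i \<in> J" for i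
      proof -
        obtain \<epsilon> where e: "\<epsilon> \<in> {1,-1}" "E' i * T = \<epsilon> \<cdot>\<^sub>m (T * E i)" using eig[OF i] by auto
        have "\<exists>\<eta>\<in>{1,-1}. E i * ?F = \<eta> \<cdot>\<^sub>m (?F * E i)"
        proof (cases "i = j \<or> i = z")
          case True
          then show ?thesis using commj commz by (intro bexI[of _ "-1"]) auto
        next
          case False
          then show ?thesis using comm[OF i] by (intro bexI[of _ 1]) (auto simp: mat_arith)
        qed
        then obtain \<eta> where \<eta>: "\<eta> \<in> {1,-1}" "E i * ?F = \<eta> \<cdot>\<^sub>m (?F * E i)" by blast
        have "E' i * (T * ?F) = (\<epsilon> * \<eta>) \<cdot>\<^sub>m (T * ?F * E i)"
          unfolding left[OF i e(2)] \<eta>(2) using dim[OF i] dj dz dT by (simp add: mat_arith)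
        moreover have "\<epsilon> * \<eta> \<in> {1,-1}" using e(1) \<eta>(1) by auto
        ultimately show ?thesis by blast
      qed
      moreover have "T * ?F \<noteq> 0\<^sub>m d' d"
      proof
        assume 0: "T * ?F = 0\<^sub>m d' d"
        \<comment> \<open>\<open>?F\<close> is invertible up to the nonzero scalar
          \<open>t z * t j\<close>, so multiplying by it cannot annihilate \<open>T\<close>.\<close>
        have "?F * (E z * E j) = (t z * t j) \<cdot>\<^sub>m 1\<^sub>m d"
        proof -
          have "?F * (E z * E j) = E j * (E z * E z * E j)" using dj dz by (simp add: mat_arith)
          then show ?thesis using sq[OF z] sq[OF j(1)] dj dz by (simp add: mat_arith)
        qed
        then have "T * (?F * (E z * E j)) = (t z * t j) \<cdot>\<^sub>m T" using dT by (simp add: mat_arith)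
        moreover have "T * (?F * (E z * E j)) = T * ?F * (E z * E j)" using dj dz dT by (simp add: mat_arith(1))
        ultimately have "(t z * t j) \<cdot>\<^sub>m T = 0\<^sub>m d' d" using 0 dj dz by (simp add: mat_arith)
        then have "inverse (t z * t j) \<cdot>\<^sub>m ((t z * t j) \<cdot>\<^sub>m T) = 0\<^sub>m d' d" by simp
        moreover have "inverse (t z * t j) * (t z * t j) = 1" using sq(2)[OF z] sq(2)[OF j(1)] by (intro left_inverse) simp
        ultimately have "T = 0\<^sub>m d' d" by (simp only: mat_arith(10,13))
        then show False using T by simp
      qed
      moreover have "T * ?F \<in> carrier_mat d' d" using T(1) cF by simp
      ultimately show ?thesis by (intro bexI[of _ "T * ?F"] conjI ballI)
    qed
  qed
  from this[of "J - {z}"] obtain T where "T \<in> carrier_mat d' d" "T \<noteq> 0\<^sub>m d' d"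
    "\<forall>i\<in>J. \<exists>\<epsilon>\<in>{1,-1}. E' i * T = \<epsilon> \<cdot>\<^sub>m (T * E i)" "\<forall>i\<in>J - {z}. E' i * T = T * E i"
    using assms(1) by auto
  then show ?thesis using z by blast
qed

text \<open>The parity operator joins the xi_i as one more Clifford generator, of square 1 and index
  \<open>None\<close>. Taken as the index \<open>z\<close> whose sign stays uncorrected, it accounts
  exactly for the ambiguity between a module and its parity change. Generators with
  \<open>s i = 0\<close> are left out of \<open>J\<close>, as they act by zero on both
  sides.\<close>

lemma simple_hmod_unique:
  assumes V: "simple_hmod n s d P X" and W: "simple_hmod n s d' P' X'"
  shows "d' = d \<and> (\<exists>T\<in>carrier_mat d' d. \<exists>G\<in>carrier_mat d d'. T * G = 1\<^sub>m d' \<and> G * T = 1\<^sub>m d \<and>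
     (\<forall>i<n. T * X i = X' i * T) \<and> (T * P = P' * T \<or> T * P = - P' * T))"
proof -
  note D = hmodD[OF simple_hmodD(1)[OF V]] and D' = hmodD[OF simple_hmodD(1)[OF W]]
  define J where "J = insert None (Some ` {i. i < n \<and> s i \<noteq> 0})"
  let ?E = "\<lambda>P X i. case i of None \<Rightarrow> P :: complex mat | Some i \<Rightarrow> X i"
  let ?t = "\<lambda>i. case i of None \<Rightarrow> 1 | Some i \<Rightarrow> s i"
  have flip: "A = (-1) \<cdot>\<^sub>m B" if "B = (-1) \<cdot>\<^sub>m A" for A B :: "complex mat"
    using that by (simp add: mat_arith)
  have one: "P * P = 1 \<cdot>\<^sub>m 1\<^sub>m d" "P' * P' = 1 \<cdot>\<^sub>m 1\<^sub>m d'" using D(2) D'(2) by (simp_all add: mat_arith)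
  have "\<exists>T\<in>carrier_mat d' d. T \<noteq> 0\<^sub>m d' d \<and> (\<forall>i\<in>J - {None}. ?E P' X' i * T = T * ?E P X i)
     \<and> (\<exists>\<epsilon>\<in>{1,-1}. ?E P' X' None * T = \<epsilon> \<cdot>\<^sub>m (T * ?E P X None))"
  proof (rule clifford_intertwiner[where t = ?t])
    show "finite J" "None \<in> J" by (auto simp: J_def)
    show "d > 0" "d' > 0" using simple_hmodD(2) V W by auto
    show "\<forall>i\<in>J. ?E P X i \<in> carrier_mat d d \<and> ?E P' X' i \<in> carrier_mat d' d' \<and> ?t i \<noteq> 0
        \<and> ?E P X i * ?E P X i = ?t i \<cdot>\<^sub>m 1\<^sub>m d \<and> ?E P' X' i * ?E P' X' i = ?t i \<cdot>\<^sub>m 1\<^sub>m d'"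
      using D(1,3,5) D'(1,3,5) one by (auto simp: J_def)
    show "\<forall>i\<in>J. \<forall>j\<in>J. i \<noteq> j \<longrightarrow> ?E P X i * ?E P X j = (-1) \<cdot>\<^sub>m (?E P X j * ?E P X i) \<and>
        ?E P' X' i * ?E P' X' j = (-1) \<cdot>\<^sub>m (?E P' X' j * ?E P' X' i)"
    proof (intro ballI impI)
      fix i j assume "i \<in> J" "j \<in> J" "i \<noteq> j"
      then consider k where "i = None" "j = Some k" "k < n" | k where "i = Some k" "j = None" "k < n"
        | k l where "i = Some k" "j = Some l" "k < n" "l < n" "k \<noteq> l"
        by (auto simp: J_def)
      then show "?E P X i * ?E P X j = (-1) \<cdot>\<^sub>m (?E P X j * ?E P X i) \<and>
        ?E P' X' i * ?E P' X' j = (-1) \<cdot>\<^sub>m (?E P' X' j * ?E P' X' i)"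
      proof cases
        case (1 k)
        show ?thesis unfolding 1 option.case using flip[OF D(4)[OF 1(3)]] flip[OF D'(4)[OF 1(3)]] by blast
      next
        case (2 k)
        show ?thesis unfolding 2 option.case using D(4)[OF 2(3)] D'(4)[OF 2(3)] by blast
      next
        case (3 k l)
        show ?thesis unfolding 3 option.case using D(6)[OF 3(3-5)] D'(6)[OF 3(3-5)] by blast
      qed
    qed
  qed
  then obtain T \<epsilon> where T: "T \<in> carrier_mat d' d" "T \<noteq> 0\<^sub>m d' d"
    and TX: "\<forall>i\<in>J - {None}. ?E P' X' i * T = T * ?E P X i" and \<epsilon>: "\<epsilon> \<in> {1,-1}" "P' * T = \<epsilon> \<cdot>\<^sub>m (T * P)"
    by auto
  note dT = carrier_matD[OF T(1)] and dP = carrier_matD[OF D(1)] carrier_matD[OF D'(1)]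
  have TX: "T * X i = X' i * T" if i: "i < n" for i
  proof (cases "s i = 0")
    case True
    then show ?thesis using simple_hmod_zero[OF V i] simple_hmod_zero[OF W i] dT by (simp add: mat_arith)
  next
    case False
    then show ?thesis using TX[rule_format, of "Some i"] i by (auto simp: J_def)
  qed
  show ?thesis
  proof (cases "\<epsilon> = 1")
    case True
    then have TP: "T * P = P' * T" using \<epsilon>(2) by (simp add: mat_arith)
    show ?thesis using schur_hmod[OF V W T TP TX] T(1) TP TX by blast
  next
    case False
    then have "P' * T = (-1) \<cdot>\<^sub>m (T * P)" using \<epsilon> by auto
    moreover have "- P' * T = (-1) \<cdot>\<^sub>m (P' * T)" using dT dP by (intro mat_arith(9)) simp
    ultimately have TP: "T * P = - P' * T" by (simp add: mat_arith)
    show ?thesis using schur_hmod[OF V simple_hmod_uminus[OF W] T TP TX] T(1) TP TX by blast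
  qed
qed

section \<open>Permuting the parameters\<close>

lemma wact_intertwine_all:
  assumes F: "F \<in> carrier_mat d' d"
    and X: "\<And>i. i < n \<Longrightarrow> X i \<in> carrier_mat d d" and X': "\<And>i. i < n \<Longrightarrow> X' i \<in> carrier_mat d' d'"
    and int: "\<And>i. i < n \<Longrightarrow> F * X i = X' i * F"
  shows "F * wact n d s X k e = wact n d' s X' k e * F"
proof (rule wact_intertwine_ext[OF F, where p = 0])
  show "F * wact 0 d s X k e = wact 0 d' s X' k e * F" for k e
    using carrier_matD[OF F] by (cases k) (simp_all add: wact_0 wact_empty)
qed (use X X' int in auto)

text \<open>A transposition (a, b+1) is (b, b+1)(a, b)(b, b+1), so neighbouring swaps suffice. They
  are composed on the right and thus act on positions: \<open>s \<circ> p\<close> changes by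
  exchanging two neighbouring entries.\<close>

lemma permutes_adjacent_induct [consumes 1, case_names id swap]:
  fixes n :: nat
  assumes p: "p permutes {..<n}" and id: "Q id"
    and step: "\<And>p i. p permutes {..<n} \<Longrightarrow> Q p \<Longrightarrow> Suc i < n \<Longrightarrow> Q (p \<circ> Transposition.transpose i (Suc i))"
  shows "Q p"
proof -
  have adj: "Transposition.transpose i (Suc i) permutes {..<n}" if "Suc i < n" for i
    using that by (intro permutes_swap_id) auto
  have tr: "Q (p \<circ> Transposition.transpose a b)" if "a < b" "b < n" "p permutes {..<n}" "Q p" for a b p
    using that
  proof (induction b arbitrary: p)
    case (Suc b)
    show ?case
    proof (cases "a = b")
      case True
      show ?thesis unfolding True by (rule step[OF Suc.prems(3,4,2)])
    next
      case False
      let ?t = "Transposition.transpose b (Suc b)" and ?u = "Transposition.transpose a b"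
      have ab: "a < b" "b < n" using False Suc.prems by auto
      have t: "?t permutes {..<n}" and u: "?u permutes {..<n}"
        using adj Suc.prems ab by (auto intro: permutes_swap_id)
      have p1: "p \<circ> ?t permutes {..<n}" "Q (p \<circ> ?t)"
        using permutes_compose[OF t Suc.prems(3)] step[OF Suc.prems(3,4,2)] .
      have p2: "p \<circ> ?t \<circ> ?u permutes {..<n}" "Q (p \<circ> ?t \<circ> ?u)"
        using permutes_compose[OF u p1(1)] Suc.IH[OF ab p1] .
      have "Q (p \<circ> ?t \<circ> ?u \<circ> ?t)" using step[OF p2 Suc.prems(2)] .
      moreover have "p \<circ> ?t \<circ> ?u \<circ> ?t = p \<circ> Transposition.transpose a (Suc b)"
        using ab by (auto simp: fun_eq_iff transpose_def)
      ultimately show ?thesis by metis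
    qed
  qed simp
  show ?thesis
  proof (rule permutes_rev_induct[OF finite_lessThan p])
    fix a b q assume h: "a \<in> {..<n}" "b \<in> {..<n}" "a \<noteq> b" "Q q" "q permutes {..<n}"
    show "Q (q \<circ> Transposition.transpose a b)"
    proof (cases "a < b")
      case True
      then show ?thesis using tr[OF _ _ h(5,4)] h(2) by blast
    next
      case False
      then have "b < a" "a < n" using h by auto
      from tr[OF this h(5,4)] show ?thesis unfolding transpose_commute[of b a] .
    qed
  qed (rule id)
qed

theorem theorem4p4:
  fixes n :: nat and s :: "nat \<Rightarrow> complex" and \<sigma> :: "nat \<Rightarrow> nat"
    and d d' :: nat and P P' :: "complex mat" and X X' :: "nat \<Rightarrow> complex mat"
  assumes "n \<ge> 1"
    and "\<sigma> permutes {..<n}"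
    and "simple_hmod n s d P X"
    and "simple_hmod n (s \<circ> \<sigma>) d' P' X'"
  shows "((\<forall>i<n. \<forall>j<n. i \<noteq> j \<longrightarrow> s i + s j \<noteq> 0) \<longrightarrow>
            wiso n d P (wact n d s X) d' P' (wact n d' (s \<circ> \<sigma>) X') \<or>
            wiso n d P (wact n d s X) d' (- P') (wact n d' (s \<circ> \<sigma>) X'))
       \<and> (same_K0 n d P (wact n d s X) d' P' (wact n d' (s \<circ> \<sigma>) X') \<or>
          same_K0 n d P (wact n d s X) d' (- P') (wact n d' (s \<circ> \<sigma>) X'))"
proof
  note V = assms(3) and W = assms(4)
  note DW = hmodD[OF simple_hmodD(1)[OF W]]
  let ?A' = "wact n d' (s \<circ> \<sigma>) X'"
  show "(\<forall>i<n. \<forall>j<n. i \<noteq> j \<longrightarrow> s i + s j \<noteq> 0) \<longrightarrow>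
            wiso n d P (wact n d s X) d' P' ?A' \<or> wiso n d P (wact n d s X) d' (- P') ?A'"
  proof
    assume typical: "\<forall>i<n. \<forall>j<n. i \<noteq> j \<longrightarrow> s i + s j \<noteq> 0"
    \<comment> \<open>The space, its parity and the action of every u_k(e) stay literally the same
      along the induction; only the odd operators behind that action are replaced.\<close>
    have "\<exists>Y. simple_hmod n (s \<circ> \<sigma>) d P Y \<and> (\<forall>k e. wact n d (s \<circ> \<sigma>) Y k e = wact n d s X k e)"
      using assms(2)
    proof (induction rule: permutes_adjacent_induct)
      case id
      then show ?case using V by auto
    next
      case (swap p m)
      then obtain Y where Y: "simple_hmod n (s \<circ> p) d P Y" "\<And>k e. wact n d (s \<circ> p) Y k e = wact n d s X k e"
        by blast
      have "p m < n" "p (Suc m) < n" "p m \<noteq> p (Suc m)"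
        using permutes_in_image[OF swap.hyps(1)] permutes_inj[OF swap.hyps(1)] swap.hyps(2) by (auto dest: injD)
      then have "(s \<circ> p) m + (s \<circ> p) (Suc m) \<noteq> 0" using typical by simp
      from swap_typical[OF Y(1) swap.hyps(2) this] show ?case using Y(2) unfolding comp_assoc by metis
    qed
    then obtain Y where Y: "simple_hmod n (s \<circ> \<sigma>) d P Y"
      "\<And>k e. wact n d (s \<circ> \<sigma>) Y k e = wact n d s X k e" by blast
    note DY = hmodD[OF simple_hmodD(1)[OF Y(1)]]
    obtain T G where T: "d' = d" "T \<in> carrier_mat d' d" "G \<in> carrier_mat d d'" "T * G = 1\<^sub>m d'" "G * T = 1\<^sub>m d"
      "\<forall>i<n. T * Y i = X' i * T" "T * P = P' * T \<or> T * P = - P' * T"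
      using simple_hmod_unique[OF Y(1) W] by blast
    have "T * wact n d (s \<circ> \<sigma>) Y k e = ?A' k e * T" for k e
      by (rule wact_intertwine_all[OF T(2)]) (use DY(3) DW(3) T(6) in auto)
    then have "T * wact n d s X k e = ?A' k e * T" for k e unfolding Y(2) .
    moreover have "invertible_mat T"
      using T(1-5) unfolding invertible_mat_def inverts_mat_def by (auto intro!: exI[of _ G])
    ultimately show "wiso n d P (wact n d s X) d' P' ?A' \<or> wiso n d P (wact n d s X) d' (- P') ?A'"
      unfolding wiso_def using T(1,2,7) by auto
  qed
  \<comment> \<open>Here the parity \<open>Q\<close> must vary as well, since exchanging two
    cancelling nonzero entries negates it.\<close>
  have "\<exists>Q Y. simple_hmod n (s \<circ> \<sigma>) d Q Y \<and>
      same_factors d (wfam n P (wact n d s X)) d (wfam n Q (wact n d (s \<circ> \<sigma>) Y))"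
    using assms(2)
  proof (induction rule: permutes_adjacent_induct)
    case id
    have "fam d (wfam n P (wact n d s X))" using hmodD(1)[OF simple_hmodD(1)[OF V]] by (rule fam_wfam)
    then show ?case using V same_factors_refl by auto
  next
    case (swap p m)
    then obtain Q Y where Y: "simple_hmod n (s \<circ> p) d Q Y"
      "same_factors d (wfam n P (wact n d s X)) d (wfam n Q (wact n d (s \<circ> p) Y))"
      by blast
    have famY: "fam d (wfam n Q (wact n d (s \<circ> p) Y))"
      using hmodD(1)[OF simple_hmodD(1)[OF Y(1)]] by (rule fam_wfam)
    let ?t = "Transposition.transpose m (Suc m)"
    consider "(s \<circ> p) m + (s \<circ> p) (Suc m) \<noteq> 0"
      | "(s \<circ> p) m + (s \<circ> p) (Suc m) = 0" "(s \<circ> p) m \<noteq> 0"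
      | "(s \<circ> p) m = 0" "(s \<circ> p) (Suc m) = 0" by fastforce
    then have "\<exists>Q' Z. simple_hmod n (s \<circ> p \<circ> ?t) d Q' Z \<and>
        same_factors d (wfam n Q (wact n d (s \<circ> p) Y)) d (wfam n Q' (wact n d (s \<circ> p \<circ> ?t) Z))"
    proof cases
      case 1
      then obtain Z where Z: "simple_hmod n (s \<circ> p \<circ> ?t) d Q Z"
        "\<forall>k e. wact n d (s \<circ> p \<circ> ?t) Z k e = wact n d (s \<circ> p) Y k e"
        using swap_typical[OF Y(1) swap.hyps(2)] by blast
      then have "wact n d (s \<circ> p \<circ> ?t) Z = wact n d (s \<circ> p) Y" by (simp add: fun_eq_iff)
      then show ?thesis using Z(1) same_factors_refl[OF famY] by metis
    next
      case 2
      show ?thesis using swap_atypical[OF Y(1) swap.hyps(2) 2] .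
    next
      case 3
      \<comment> \<open>Both entries are zero, so the exchange leaves the parameters as they are and
        \<open>Y\<close> serves again.\<close>
      have "s \<circ> p \<circ> ?t = s \<circ> p" using 3 by (auto simp: fun_eq_iff transpose_def)
      then show ?thesis using Y(1) same_factors_refl[OF famY] by metis
    qed
    then show ?case using same_factors_trans[OF famY Y(2)] unfolding comp_assoc by blast
  qed
  then obtain Q Y where Y: "simple_hmod n (s \<circ> \<sigma>) d Q Y"
    "same_factors d (wfam n P (wact n d s X)) d (wfam n Q (wact n d (s \<circ> \<sigma>) Y))" by blast
  note DY = hmodD[OF simple_hmodD(1)[OF Y(1)]]
  obtain T G where T: "T \<in> carrier_mat d' d" "G \<in> carrier_mat d d'" "T * G = 1\<^sub>m d'" "G * T = 1\<^sub>m d"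
    "\<forall>i<n. T * Y i = X' i * T" "T * Q = P' * T \<or> T * Q = - P' * T"
    using simple_hmod_unique[OF Y(1) W] by blast
  have TA: "T * wact n d (s \<circ> \<sigma>) Y k e = ?A' k e * T" for k e
    by (rule wact_intertwine_all[OF T(1)]) (use DY(3) DW(3) T(5) in auto)
  \<comment> \<open>The parity \<open>R\<close> stands for \<open>P'\<close> or \<open>- P'\<close>.
    The action \<open>?A'\<close> does not involve the parity, so one argument covers both outcomes
    of the uniqueness lemma.\<close>
  have K: "same_K0 n d P (wact n d s X) d' R ?A'" if R: "R \<in> carrier_mat d' d'" "T * Q = R * T" for R
  proof (rule same_K0I)
    show "fam d (wfam n P (wact n d s X))" using hmodD(1)[OF simple_hmodD(1)[OF V]] by (rule fam_wfam)
    show famW: "fam d' (wfam n R ?A')" using R(1) by (rule fam_wfam)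
    have famY: "fam d (wfam n Q (wact n d (s \<circ> \<sigma>) Y))" using DY(1) by (rule fam_wfam)
    have "T * wfam n Q (wact n d (s \<circ> \<sigma>) Y) i = wfam n R ?A' i * T" for i
      using R(2) TA all_wfam[where Q = "\<lambda>B C. T * B = C * T", of n Q "wact n d (s \<circ> \<sigma>) Y" R ?A'] by blast
    from same_factors_iso[OF famY famW T(1-4) this]
    show "same_factors d (wfam n P (wact n d s X)) d' (wfam n R ?A')"
      by (rule same_factors_trans[OF famY Y(2)])
  qed
  show "same_K0 n d P (wact n d s X) d' P' ?A' \<or> same_K0 n d P (wact n d s X) d' (- P') ?A'"
    using T(6) K[of P'] K[of "- P'"] DW(1) by auto
qed

end
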